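(* Let $E$ be a continuous tangent subbundle of rank $m$ on a Euclidean ball $U\subset\mathbb{R}^{n+m}$. If $E$ is strongly asymptotically involutive, then it is integrable. If $E$ is integrable and strongly exterior regular, then it is uniquely integrable.
   Context: $E$ is integrable if through every point $p\in U$ there is a local integral manifold, i.e. an $m$-dimensional $C^1$ submanifold $N\ni p$ with $T_qN=E_q$ for all $q\in N$. $E$ is uniquely integrable if moreover whenever two integral manifolds intersect, their intersection is relatively open in both. $\mathcal{A}^1(E)$ is the space of all (continuous) 1-forms $\eta$ on $U$ with $E\subset\ker\eta$. A basis of $\mathcal{A}^1(E)$ is a set of $n$ pointwise linearly independent 1-forms in $\mathcal{A}^1(E)$. $|\cdot|$ is the induced Euclidean norm on differential forms and $|\cdot|_\infty$ the sup-norm over $U$. $E$ is strongly asymptotically involutive if there exist a basis $\{\eta_i\}_{i=1}^n$ of $\mathcal{A}^1(E)$, a constant $\epsilon_0>0$ and a sequence of $C^1$ differential 1-forms $\{\eta^k_i\}_{i=1}^n$ on $U$ such that $\max_i|\eta^k_i-\eta_i|_\infty\to0$ and $$\max_j|\eta^k_1\wedge\cdots\wedge\eta^k_n\wedge d\eta^k_j|_\infty\;e^{\epsilon_0\max_i|d\eta^k_i|_\infty}\to0\quad\text{as }k\to\infty.$$ $E$ is strongly exterior regular if there exist a basis $\{\beta_i\}_{i=1}^n$ of $\mathcal{A}^1(E)$, a constant $\epsilon_1>0$ and a sequence of $C^1$ differential 1-forms $\{\beta^k_i\}_{i=1}^n$ on $U$ such that $$\max_j|\beta^k_j-\beta_j|_\infty\;e^{\epsilon_1\max_i|d\beta^k_i|_\infty}\to0\quad\text{as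 }k\to\infty.$$ *)

theory Defs
  imports "HOL-Analysis.Analysis"
begin

section \<open>Maps of class C1\<close>

text \<open>Meant for open \<open>S\<close>; the derivative is continuous for the operator norm.\<close>

definition C1_on :: "'a::real_normed_vector set \<Rightarrow> ('a \<Rightarrow> 'b::real_normed_vector) \<Rightarrow> bool" where
  "C1_on S f \<longleftrightarrow>
     (\<exists>f' :: 'a \<Rightarrow> 'a \<Rightarrow>\<^sub>L 'b.
        (\<forall>x\<in>S. (f has_derivative blinfun_apply (f' x)) (at x)) \<and> continuous_on S f')"

section \<open>Submanifolds, tangent subbundles, integrability\<close>

text \<open>Embedded submanifolds (not necessarily connected), described by slice charts.\<close>

definition C1_submanifold :: "nat \<Rightarrow> 'a::euclidean_space set \<Rightarrow> bool" where
  "C1_submanifold m N \<longleftrightarrow>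
     (\<forall>p\<in>N. \<exists>V W \<phi> \<psi> L.
        open V \<and> p \<in> V \<and> open (W :: 'a set) \<and>
        homeomorphism V W \<phi> \<psi> \<and> C1_on V \<phi> \<and> C1_on W \<psi> \<and>
        subspace L \<and> dim L = m \<and> \<phi> ` (N \<inter> V) = L \<inter> W)"

definition tangent_space :: "'a::real_normed_vector set \<Rightarrow> 'a \<Rightarrow> 'a set" where
  "tangent_space N q =
     {v. \<exists>\<gamma> e. 0 < e \<and> \<gamma> C1_differentiable_on {-e<..<e} \<and> \<gamma> ` {-e<..<e} \<subseteq> N \<and>
           \<gamma> 0 = q \<and> (\<gamma> has_vector_derivative v) (at 0)}"

text \<open>A subbundle of the tangent bundle of \<open>U\<close> assigns to each point of \<open>U\<close> a linear subspace;
  it is continuous of rank \<open>m\<close> if it has continuous local frames of \<open>m\<close> vector fields.\<close>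

definition continuous_subbundle :: "'a::euclidean_space set \<Rightarrow> nat \<Rightarrow> ('a \<Rightarrow> 'a set) \<Rightarrow> bool" where
  "continuous_subbundle U m E \<longleftrightarrow>
     (\<forall>p\<in>U. \<exists>V (X :: nat \<Rightarrow> 'a \<Rightarrow> 'a).
        open V \<and> p \<in> V \<and> (\<forall>i<m. continuous_on (U \<inter> V) (X i)) \<and>
        (\<forall>q\<in>U \<inter> V. inj_on (\<lambda>i. X i q) {..<m} \<and> independent ((\<lambda>i. X i q) ` {..<m}) \<and>
                    E q = span ((\<lambda>i. X i q) ` {..<m})))"

definition integral_manifold ::
    "'a::euclidean_space set \<Rightarrow> nat \<Rightarrow> ('a \<Rightarrow> 'a set) \<Rightarrow> 'a set \<Rightarrow> bool" where
  "integral_manifold U m E N \<longleftrightarrow>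
     N \<subseteq> U \<and> C1_submanifold m N \<and> (\<forall>q\<in>N. tangent_space N q = E q)"

definition integrable_bundle :: "'a::euclidean_space set \<Rightarrow> nat \<Rightarrow> ('a \<Rightarrow> 'a set) \<Rightarrow> bool" where
  "integrable_bundle U m E \<longleftrightarrow> (\<forall>p\<in>U. \<exists>N. integral_manifold U m E N \<and> p \<in> N)"

definition uniquely_integrable_bundle ::
    "'a::euclidean_space set \<Rightarrow> nat \<Rightarrow> ('a \<Rightarrow> 'a set) \<Rightarrow> bool" where
  "uniquely_integrable_bundle U m E \<longleftrightarrow>
     integrable_bundle U m E \<and>
     (\<forall>N\<^sub>1 N\<^sub>2. integral_manifold U m E N\<^sub>1 \<and> integral_manifold U m E N\<^sub>2 \<and> N\<^sub>1 \<inter> N\<^sub>2 \<noteq> {} \<longrightarrow>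
        openin (top_of_set N\<^sub>1) (N\<^sub>1 \<inter> N\<^sub>2) \<and> openin (top_of_set N\<^sub>2) (N\<^sub>1 \<inter> N\<^sub>2))"

section \<open>Differential forms\<close>

text \<open>A \<open>k\<close>-form at a point is a function of \<open>v :: nat \<Rightarrow> 'a\<close> that is alternating and multilinear in
  \<open>v 0, \<dots>, v (k - 1)\<close> and ignores the remaining values of \<open>v\<close>. A 1-form on \<open>U\<close> is a function from
  points to covectors, i.e. to bounded linear functionals.\<close>

type_synonym 'a alt_form = "(nat \<Rightarrow> 'a) \<Rightarrow> real"

type_synonym 'a one_form = "'a \<Rightarrow> 'a \<Rightarrow>\<^sub>L real"

definition covector_form :: "('a::real_normed_vector \<Rightarrow>\<^sub>L real) \<Rightarrow> 'a alt_form" where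
  "covector_form a = (\<lambda>v. blinfun_apply a (v 0))"

text \<open>Normalised so that the wedge product of two covectors is \<open>a u * b v - a v * b u\<close>.\<close>

definition wedge :: "nat \<Rightarrow> nat \<Rightarrow> 'a alt_form \<Rightarrow> 'a alt_form \<Rightarrow> 'a alt_form" where
  "wedge k l \<alpha> \<beta> = (\<lambda>v.
     (\<Sum>\<sigma> | \<sigma> permutes {..<k + l}.
        of_int (sign \<sigma>) * \<alpha> (\<lambda>i. v (\<sigma> i)) * \<beta> (\<lambda>i. v (\<sigma> (k + i)))) / (fact k * fact l))"

primrec wedge_covectors :: "(nat \<Rightarrow> 'a::real_normed_vector \<Rightarrow>\<^sub>L real) \<Rightarrow> nat \<Rightarrow> 'a alt_form" where
  "wedge_covectors a 0 = (\<lambda>v. 1)"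
| "wedge_covectors a (Suc n) = wedge n 1 (wedge_covectors a n) (covector_form (a n))"

text \<open>The exterior derivative of a 1-form: \<open>d\<eta>(u, v) = (D\<^sub>u \<eta>) v - (D\<^sub>v \<eta>) u\<close>.\<close>

definition ext_deriv :: "('a::real_normed_vector) one_form \<Rightarrow> 'a \<Rightarrow> 'a alt_form" where
  "ext_deriv \<eta> x = (\<lambda>v.
     blinfun_apply (frechet_derivative \<eta> (at x) (v 0)) (v 1) -
     blinfun_apply (frechet_derivative \<eta> (at x) (v 1)) (v 0))"

text \<open>The induced Euclidean norm, for which the forms \<open>e\<^sub>I\<close> with \<open>I\<close> increasing are orthonormal.
  The sum runs over all index tuples, so it counts each increasing tuple \<open>fact k\<close> times.\<close>

definition form_norm :: "nat \<Rightarrow> ('a::euclidean_space) alt_form \<Rightarrow> real" where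
  "form_norm k \<omega> = sqrt ((\<Sum>e\<in>{..<k} \<rightarrow>\<^sub>E Basis. (\<omega> e)\<^sup>2) / fact k)"

text \<open>Forms on \<open>U\<close> may be unbounded, so sup-norms are extended reals.\<close>

definition form_sup_norm ::
    "'a::euclidean_space set \<Rightarrow> nat \<Rightarrow> ('a \<Rightarrow> 'a alt_form) \<Rightarrow> ennreal" where
  "form_sup_norm U k \<omega> = (SUP x\<in>U. ennreal (form_norm k (\<omega> x)))"

definition ennreal_exp :: "ennreal \<Rightarrow> ennreal" where
  "ennreal_exp t = (if t = \<infinity> then \<infinity> else ennreal (exp (enn2real t)))"

definition annihilator_forms ::
    "'a::euclidean_space set \<Rightarrow> ('a \<Rightarrow> 'a set) \<Rightarrow> 'a one_form set" where
  "annihilator_forms U E =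
     {\<eta>. continuous_on U \<eta> \<and> (\<forall>x\<in>U. \<forall>v\<in>E x. blinfun_apply (\<eta> x) v = 0)}"

definition annihilator_basis ::
    "'a::euclidean_space set \<Rightarrow> nat \<Rightarrow> ('a \<Rightarrow> 'a set) \<Rightarrow> (nat \<Rightarrow> 'a one_form) \<Rightarrow> bool" where
  "annihilator_basis U n E \<eta> \<longleftrightarrow>
     (\<forall>i<n. \<eta> i \<in> annihilator_forms U E) \<and>
     (\<forall>x\<in>U. inj_on (\<lambda>i. \<eta> i x) {..<n} \<and> independent ((\<lambda>i. \<eta> i x) ` {..<n}))"

section \<open>Asymptotic involutivity and exterior regularity\<close>

text \<open>The maxima over the indices \<open>i < n\<close> are written as suprema in \<open>ennreal\<close>, which are maxima if
  \<open>n > 0\<close> and \<open>0\<close> if \<open>n = 0\<close>. In the products \<open>0 * \<infinity> = 0\<close>.\<close>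

definition strongly_asymptotically_involutive ::
    "'a::euclidean_space set \<Rightarrow> nat \<Rightarrow> ('a \<Rightarrow> 'a set) \<Rightarrow> bool" where
  "strongly_asymptotically_involutive U n E \<longleftrightarrow>
     (\<exists>(\<eta> :: nat \<Rightarrow> 'a one_form) (\<epsilon>\<^sub>0 :: real) (\<eta>k :: nat \<Rightarrow> nat \<Rightarrow> 'a one_form).
        annihilator_basis U n E \<eta> \<and> 0 < \<epsilon>\<^sub>0 \<and> (\<forall>k. \<forall>i<n. C1_on U (\<eta>k k i)) \<and>
        (\<lambda>k. SUP i\<in>{..<n}. form_sup_norm U 1 (\<lambda>x. covector_form (\<eta>k k i x - \<eta> i x)))
          \<longlonglongrightarrow> 0 \<and>
        (\<lambda>k. (SUP j\<in>{..<n}. form_sup_norm U (n + 2)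
                 (\<lambda>x. wedge n 2 (wedge_covectors (\<lambda>i. \<eta>k k i x) n) (ext_deriv (\<eta>k k j) x))) *
             ennreal_exp (ennreal \<epsilon>\<^sub>0 * (SUP i\<in>{..<n}. form_sup_norm U 2 (ext_deriv (\<eta>k k i)))))
          \<longlonglongrightarrow> 0)"

definition strongly_exterior_regular ::
    "'a::euclidean_space set \<Rightarrow> nat \<Rightarrow> ('a \<Rightarrow> 'a set) \<Rightarrow> bool" where
  "strongly_exterior_regular U n E \<longleftrightarrow>
     (\<exists>(\<beta> :: nat \<Rightarrow> 'a one_form) (\<epsilon>\<^sub>1 :: real) (\<beta>k :: nat \<Rightarrow> nat \<Rightarrow> 'a one_form).
        annihilator_basis U n E \<beta> \<and> 0 < \<epsilon>\<^sub>1 \<and> (\<forall>k. \<forall>i<n. C1_on U (\<beta>k k i)) \<and>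
        (\<lambda>k. (SUP j\<in>{..<n}. form_sup_norm U 1 (\<lambda>x. covector_form (\<beta>k k j x - \<beta> j x))) *
             ennreal_exp (ennreal \<epsilon>\<^sub>1 * (SUP i\<in>{..<n}. form_sup_norm U 2 (ext_deriv (\<beta>k k i)))))
          \<longlonglongrightarrow> 0)"

end

theory Submission
  imports Defs "HOL-Complex_Analysis.Great_Picard"
begin

text \<open>
  Fix a point \<open>p\<close>. Vectors \<open>k\<^sub>i\<close> dual to the covectors \<open>\<eta>\<^sub>i(p)\<close> turn the forms into the endomorphisms
  \<open>A(z) = id + \<Sum> (\<eta>\<^sub>i(z) - \<eta>\<^sub>i(p)) \<otimes> k\<^sub>i\<close>, which are close to the identity near \<open>p\<close> and satisfy
  \<open>E(z) = {v. A(z) v \<in> E(p)}\<close>; the approximating forms give \<open>C\<^sup>1\<close> maps \<open>A\<^sub>k\<close> with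
  \<open>dA\<^sub>k(u, v) = \<Sum> d\<eta>\<^sup>k\<^sub>i(u, v) k\<^sub>i\<close>.

  Existence. For \<open>\<xi> \<in> E(p)\<close> let \<open>G\<^sub>k(\<xi>)\<close> be the end of an Euler polygon for \<open>\<gamma>' = A\<^sub>k(\<gamma>)\<^sup>-\<^sup>1 \<xi>\<close> that starts at
  \<open>p\<close>. If \<open>\<Delta>\<close> is the difference of the polygons for \<open>\<xi>\<close> and \<open>\<xi> + h\<close>, then \<open>Q = A\<^sub>k(\<gamma>) \<Delta> - t h\<close> changes, up to
  terms of second order, at the rate \<open>dA\<^sub>k(\<gamma>', \<Delta>)\<close>. Here the part of \<open>\<Delta>\<close> in the kernel of the forms contributes the
  small quantity \<open>\<eta>\<^sup>k\<^sub>1 \<and> \<dots> \<and> \<eta>\<^sup>k\<^sub>n \<and> d\<eta>\<^sup>k\<^sub>j\<close>, and the rest at most \<open>|d\<eta>\<^sup>k| |Q|\<close>, so that Gronwall's inequality and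
  the exponential weight show that \<open>A\<^sub>k(G\<^sub>k) DG\<^sub>k\<close> tends to the identity of \<open>E(p)\<close>. A limit \<open>G\<close> of the \<open>G\<^sub>k\<close>
  (Arzela--Ascoli) has \<open>DG = A(G)\<^sup>-\<^sup>1\<close>, so that its image is an integral manifold.

  Uniqueness. Two integral manifolds through \<open>q\<close> are graphs over \<open>E(q)\<close>; on a line in \<open>E(q)\<close> they give curves
  \<open>\<gamma>\<^sub>1\<close>, \<open>\<gamma>\<^sub>2\<close> with \<open>A(\<gamma>\<^sub>i) \<gamma>\<^sub>i' = x\<close>. By Stokes' theorem on the strip of segments between them, the integral of
  \<open>A\<^sub>k\<close> over the segment from \<open>\<gamma>\<^sub>1(t)\<close> to \<open>\<gamma>\<^sub>2(t)\<close> satisfies a Gronwall inequality, hence tends to 0 with \<open>k\<close>; but it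
  dominates \<open>|\<gamma>\<^sub>2(t) - \<gamma>\<^sub>1(t)|\<close>.
\<close>

section \<open>Multilinear forms and wedge products\<close>

text \<open>The second conjunct makes a form blind to arguments of index \<open>k\<close> and
  beyond, so that tuples may be truncated or altered there. The behaviour under permutations is
  treated separately, in \<open>wedge_permute\<close>.\<close>

definition multilinear_form :: "nat \<Rightarrow> 'a::real_normed_vector alt_form \<Rightarrow> bool" where
  "multilinear_form k \<omega> \<longleftrightarrow>
     (\<forall>v i. i < k \<longrightarrow> linear (\<lambda>x. \<omega> (v(i := x)))) \<and>
     (\<forall>v w. (\<forall>i<k. v i = w i) \<longrightarrow> \<omega> v = \<omega> w)"

lemma multilinear_form_cong:
  "multilinear_form k \<omega> \<Longrightarrow> (\<And>i. i < k \<Longrightarrow> v i = w i) \<Longrightarrow> \<omega> v = \<omega> w"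
  unfolding multilinear_form_def by blast

lemma multilinear_form_linear:
  "multilinear_form k \<omega> \<Longrightarrow> i < k \<Longrightarrow> linear (\<lambda>x. \<omega> (v(i := x)))"
  unfolding multilinear_form_def by blast

lemma multilinear_covector_form: "multilinear_form 1 (covector_form a)"
  unfolding multilinear_form_def covector_form_def
  by (auto intro: bounded_linear.linear[OF blinfun.bounded_linear_right])

text \<open>For each permutation \<open>\<sigma>\<close> the vector of index \<open>i\<close> enters
  exactly one factor: \<open>\<alpha>\<close> if its preimage under \<open>\<sigma>\<close> lies
  below \<open>k\<close>, otherwise \<open>\<beta>\<close>. Hence every summand is linear in
  it.\<close>

lemma multilinear_wedge:
  assumes "multilinear_form k \<alpha>" "multilinear_form l \<beta>"
  shows "multilinear_form (k + l) (wedge k l \<alpha> \<beta>)"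
  unfolding multilinear_form_def
proof (intro conjI allI impI)
  fix v :: "nat \<Rightarrow> 'a" and i assume i: "i < k + l"
  have "linear (\<lambda>x. of_int (sign \<sigma>) * \<alpha> (\<lambda>j. (v(i := x)) (\<sigma> j)) * \<beta> (\<lambda>j. (v(i := x)) (\<sigma> (k + j))))"
    if \<sigma>: "\<sigma> permutes {..<k + l}" for \<sigma>
  proof -
    obtain j where j: "j < k + l" "\<sigma> j = i"
      using permutes_image[OF \<sigma>] i by (metis imageE lessThan_iff)
    \<comment> \<open>Injectivity of \<open>\<sigma>\<close> turns the update of \<open>v\<close> at
      \<open>i\<close> into an update of the permuted tuple at the preimage
      \<open>j\<close>.\<close>
    have upd: "(v(i := x)) (\<sigma> j') = ((\<lambda>j. v (\<sigma> j))(j := x)) j'" for x j'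
      using j(2) permutes_inj[OF \<sigma>] by (auto simp: inj_eq)
    show ?thesis
    proof (cases "j < k")
      case True
      have b: "\<beta> (\<lambda>j. (v(i := x)) (\<sigma> (k + j))) = \<beta> (\<lambda>j. v (\<sigma> (k + j)))" for x
        using True unfolding upd by (intro arg_cong[of _ _ \<beta>]) auto
      have a: "\<alpha> (\<lambda>j. (v(i := x)) (\<sigma> j)) = \<alpha> ((\<lambda>j. v (\<sigma> j))(j := x))" for x
        unfolding upd ..
      have "linear (\<lambda>x. \<alpha> ((\<lambda>j. v (\<sigma> j))(j := x)))"
        by (rule multilinear_form_linear[OF assms(1) True])
      from linear_compose_scale_right[OF this, of "of_int (sign \<sigma>) * \<beta> (\<lambda>j. v (\<sigma> (k + j)))"]
      show ?thesis
        unfolding a b by (simp only: mult_ac real_scaleR_def)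
    next
      case False
      have a: "\<alpha> (\<lambda>j. (v(i := x)) (\<sigma> j)) = \<alpha> (\<lambda>j. v (\<sigma> j))" for x
        unfolding upd using False by (intro multilinear_form_cong[OF assms(1)]) auto
      have b: "(\<lambda>j. (v(i := x)) (\<sigma> (k + j))) = (\<lambda>j. v (\<sigma> (k + j)))(j - k := x)" for x
        unfolding upd using False by (auto simp: fun_eq_iff)
      have "linear (\<lambda>x. \<beta> ((\<lambda>j. v (\<sigma> (k + j)))(j - k := x)))"
        using False j by (intro multilinear_form_linear[OF assms(2)]) auto
      from linear_compose_scale_right[OF this, of "of_int (sign \<sigma>) * \<alpha> (\<lambda>j. v (\<sigma> j))"]
      show ?thesis
        unfolding a b by (simp only: mult_ac real_scaleR_def)
    qed
  qed
  then have "linear (\<lambda>x. \<Sum>\<sigma> | \<sigma> permutes {..<k + l}.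
      of_int (sign \<sigma>) * \<alpha> (\<lambda>j. (v(i := x)) (\<sigma> j)) * \<beta> (\<lambda>j. (v(i := x)) (\<sigma> (k + j))))"
    by (intro linear_compose_sum ballI) auto
  from linear_compose_scale_right[OF this, of "inverse (fact k * fact l)"]
  show "linear (\<lambda>x. wedge k l \<alpha> \<beta> (v(i := x)))"
    unfolding wedge_def by (simp add: divide_inverse mult.commute)
next
  fix v w :: "nat \<Rightarrow> 'a" assume "\<forall>i<k + l. v i = w i"
  then have e: "v (\<sigma> j) = w (\<sigma> j)" if "\<sigma> permutes {..<k + l}" "j < k + l" for \<sigma> j
    using that by (metis lessThan_iff permutes_in_image)
  show "wedge k l \<alpha> \<beta> v = wedge k l \<alpha> \<beta> w"
    unfolding wedge_def
    using e by (intro arg_cong2[of _ _ _ _ "(/)"] sum.cong refl arg_cong2[of _ _ _ _ "(*)"]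
      multilinear_form_cong[OF assms(1)] multilinear_form_cong[OF assms(2)]) auto
qed

lemma multilinear_wedge_covectors: "multilinear_form n (wedge_covectors a n)"
proof (induction n)
  case 0
  then show ?case by (simp add: multilinear_form_def)
next
  case (Suc n)
  then show ?case
    using multilinear_wedge[OF Suc multilinear_covector_form] by simp
qed

lemma multilinear_ext_deriv:
  assumes "\<eta> differentiable (at x)"
  shows "multilinear_form 2 (ext_deriv \<eta> x)"
proof -
  have l: "linear (frechet_derivative \<eta> (at x))"
    using assms linear_frechet_derivative by blast
  have 1: "linear (\<lambda>u. blinfun_apply (frechet_derivative \<eta> (at x) u) w)" for w
    by (rule linearI) (simp_all add: linear_add[OF l] linear_scale[OF l] blinfun.add_left blinfun.scaleR_left)
  have 2: "linear (\<lambda>u. blinfun_apply (frechet_derivative \<eta> (at x) w) u)" for w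
    by (rule bounded_linear.linear[OF blinfun.bounded_linear_right])
  have 3: "linear (\<lambda>u. blinfun_apply (frechet_derivative \<eta> (at x) u) w
      - blinfun_apply (frechet_derivative \<eta> (at x) w) u)" for w
    by (rule linear_compose_sub[OF 1 2])
  have 4: "linear (\<lambda>u. blinfun_apply (frechet_derivative \<eta> (at x) w) u
      - blinfun_apply (frechet_derivative \<eta> (at x) u) w)" for w
    by (rule linear_compose_sub[OF 2 1])
  show ?thesis
    unfolding multilinear_form_def ext_deriv_def
    using 3 4 by (auto simp: less_2_cases_iff)
qed

text \<open>A squared coefficient is one term of the sum in \<open>form_norm\<close>; undoing the
  division by \<open>fact k\<close> costs \<open>sqrt (fact k)\<close>.\<close>

lemma form_norm_basis:
  fixes \<omega> :: "'a::euclidean_space alt_form"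
  assumes "multilinear_form k \<omega>" "\<And>i. i < k \<Longrightarrow> e i \<in> Basis"
  shows "\<bar>\<omega> e\<bar> \<le> sqrt (fact k) * form_norm k \<omega>"
proof -
  \<comment> \<open>The sum in \<open>form_norm\<close> ranges over extensional tuples, hence the
    restriction.\<close>
  define e' where "e' = restrict e {..<k}"
  have e': "e' \<in> {..<k} \<rightarrow>\<^sub>E Basis" using assms(2) unfolding e'_def by auto
  have "\<omega> e = \<omega> e'"
    by (rule multilinear_form_cong[OF assms(1)]) (auto simp: e'_def)
  moreover have "(\<omega> e')\<^sup>2 \<le> (\<Sum>e\<in>{..<k} \<rightarrow>\<^sub>E Basis. (\<omega> e)\<^sup>2)"
    by (rule member_le_sum[OF e']) (auto intro!: finite_PiE)
  then have "sqrt ((\<omega> e')\<^sup>2) \<le> sqrt (\<Sum>e\<in>{..<k} \<rightarrow>\<^sub>E Basis. (\<omega> e)\<^sup>2)"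
    using real_sqrt_le_mono by blast
  ultimately show ?thesis
    by (simp add: form_norm_def real_sqrt_mult[symmetric])
qed

text \<open>The arguments are expanded in \<open>Basis\<close> one after another, and each expansion
  has \<open>DIM('a)\<close> terms.\<close>

lemma multilinear_form_bound:
  fixes \<omega> :: "'a::euclidean_space alt_form"
  assumes "multilinear_form k \<omega>"
  shows "\<bar>\<omega> v\<bar> \<le> real DIM('a) ^ k * sqrt (fact k) * form_norm k \<omega> * (\<Prod>i<k. norm (v i))"
proof -
  let ?c = "sqrt (fact k) * form_norm k \<omega>"
  \<comment> \<open>Induction on the number \<open>J\<close> of leading arguments that are still
    arbitrary; the later ones are already basis vectors.\<close>
  have "\<bar>\<omega> v\<bar> \<le> real DIM('a) ^ J * ?c * (\<Prod>i<J. norm (v i))"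
    if "J \<le> k" "\<And>i. J \<le> i \<Longrightarrow> i < k \<Longrightarrow> v i \<in> Basis" for J v
    using that
  proof (induction J arbitrary: v)
    case 0
    then show ?case using form_norm_basis[OF assms] by simp
  next
    case (Suc J)
    let ?N = "real DIM('a) ^ J * ?c * (\<Prod>i<J. norm (v i))"
    have lin: "linear (\<lambda>x. \<omega> (v(J := x)))"
      using Suc by (intro multilinear_form_linear[OF assms]) auto
    have "\<omega> v = \<omega> (v(J := \<Sum>b\<in>Basis. (v J \<bullet> b) *\<^sub>R b))"
      by (simp add: euclidean_representation)
    also have "\<dots> = (\<Sum>b\<in>Basis. (v J \<bullet> b) * \<omega> (v(J := b)))"
      using linear_sum[OF lin, of "\<lambda>b. (v J \<bullet> b) *\<^sub>R b" Basis] linear_scale[OF lin] by simp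
    finally have "\<bar>\<omega> v\<bar> \<le> (\<Sum>b\<in>Basis. \<bar>(v J \<bullet> b) * \<omega> (v(J := b))\<bar>)"
      by (metis sum_abs)
    also have "\<dots> \<le> (\<Sum>b\<in>(Basis::'a set). norm (v J) * ?N)"
    proof (rule sum_mono)
      fix b :: 'a assume b: "b \<in> Basis"
      have "\<bar>\<omega> (v(J := b))\<bar> \<le> real DIM('a) ^ J * ?c * (\<Prod>i<J. norm ((v(J := b)) i))"
        using Suc b by (intro Suc.IH) auto
      also have "\<dots> = ?N" by (intro arg_cong2[of _ _ _ _ "(*)"] prod.cong) auto
      finally show "\<bar>(v J \<bullet> b) * \<omega> (v(J := b))\<bar> \<le> norm (v J) * ?N"
        unfolding abs_mult by (intro mult_mono) (auto simp: Basis_le_norm[OF b])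
    qed
    also have "\<dots> = real DIM('a) ^ Suc J * ?c * (\<Prod>i<Suc J. norm (v i))"
      by simp
    finally show ?case .
  qed
  from this[of k v] show ?thesis by (simp add: mult.assoc)
qed

section \<open>Sign rule and evaluation of wedge products of covectors\<close>

text \<open>Replacing \<open>\<sigma>\<close> by \<open>\<tau> \<circ> \<sigma>\<close> in the sum
  extracts the factor \<open>sign \<tau>\<close>, so a wedge alternates whatever its factors
  are.\<close>

lemma wedge_permute:
  assumes "\<tau> permutes {..<k + l}"
  shows "wedge k l \<alpha> \<beta> (\<lambda>i. v (\<tau> i)) = of_int (sign \<tau>) * wedge k l \<alpha> \<beta> v"
proof -
  let ?F = "\<lambda>\<sigma>. of_int (sign \<sigma>) * \<alpha> (\<lambda>i. v (\<sigma> i)) * \<beta> (\<lambda>i. v (\<sigma> (k + i)))"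
  have p: "permutation \<tau>" using assms permutation_permutes by blast
  have "(\<Sum>\<sigma> | \<sigma> permutes {..<k + l}. ?F \<sigma>) = (\<Sum>\<sigma> | \<sigma> permutes {..<k + l}. ?F (\<tau> \<circ> \<sigma>))"
    by (rule setum_permutations_compose_left[OF assms])
  also have "\<dots> = (\<Sum>\<sigma> | \<sigma> permutes {..<k + l}. of_int (sign \<tau>) *
      (of_int (sign \<sigma>) * \<alpha> (\<lambda>i. v (\<tau> (\<sigma> i))) * \<beta> (\<lambda>i. v (\<tau> (\<sigma> (k + i))))))"
  proof (intro sum.cong refl)
    fix \<sigma> assume "\<sigma> \<in> {\<sigma>. \<sigma> permutes {..<k + l}}"
    then have "permutation \<sigma>" using permutation_permutes by blast
    with p show "?F (\<tau> \<circ> \<sigma>) = of_int (sign \<tau>) * (of_int (sign \<sigma>) *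
        \<alpha> (\<lambda>i. v (\<tau> (\<sigma> i))) * \<beta> (\<lambda>i. v (\<tau> (\<sigma> (k + i)))))"
      by (simp add: sign_compose)
  qed
  finally have *: "(\<Sum>\<sigma> | \<sigma> permutes {..<k + l}. ?F \<sigma>) = of_int (sign \<tau>) *
     (\<Sum>\<sigma> | \<sigma> permutes {..<k + l}.
      (of_int (sign \<sigma>) * \<alpha> (\<lambda>i. v (\<tau> (\<sigma> i))) * \<beta> (\<lambda>i. v (\<tau> (\<sigma> (k + i))))))"
    by (simp add: sum_distrib_left)
  have "(of_int (sign \<tau>) * of_int (sign \<tau>) :: real) = 1"
    by (metis of_int_1 of_int_mult sign_idempotent)
  then show ?thesis
    unfolding wedge_def * by (simp add: mult.assoc[symmetric])
qed

lemma wedge_covectors_permute: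
  assumes "\<tau> permutes {..<n}"
  shows "wedge_covectors a n (\<lambda>i. v (\<tau> i)) = of_int (sign \<tau>) * wedge_covectors a n v"
proof (cases n)
  case 0
  with assms show ?thesis by simp
next
  case (Suc n')
  with assms show ?thesis
    using wedge_permute[of \<tau> n' 1] by simp
qed

text \<open>In each summand the vector \<open>v i\<close> sits either in the last slot, where
  \<open>a n\<close> kills it, or among the first \<open>n\<close>, where the induction hypothesis
  applies to the permuted tuple.\<close>

lemma wedge_covectors_kernel:
  assumes "i < n" "\<And>j. j < n \<Longrightarrow> blinfun_apply (a j) (v i) = 0"
  shows "wedge_covectors a n v = 0"
  using assms
proof (induction n arbitrary: i v)
  case 0
  then show ?case by simp
next
  case (Suc n)
  have "wedge_covectors a n (\<lambda>j. v (\<sigma> j)) * covector_form (a n) (\<lambda>j. v (\<sigma> (n + j))) = 0"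
    if \<sigma>: "\<sigma> permutes {..<Suc n}" for \<sigma>
  proof -
    obtain j where j: "j < Suc n" "\<sigma> j = i"
      using permutes_image[OF \<sigma>] Suc.prems(1) by (metis imageE lessThan_iff)
    show ?thesis
    proof (cases "j = n")
      case True
      then show ?thesis using Suc.prems(2)[of n] j by (simp add: covector_form_def)
    next
      case False
      with j have "j < n" by simp
      from Suc.IH[OF this, of "\<lambda>j. v (\<sigma> j)"] show ?thesis
        using j Suc.prems(2) by simp
    qed
  qed
  then have "(\<Sum>\<sigma> | \<sigma> permutes {..<Suc n}. of_int (sign \<sigma>) *
      wedge_covectors a n (\<lambda>i. v (\<sigma> i)) * covector_form (a n) (\<lambda>i. v (\<sigma> (n + i)))) = 0"
    by (intro sum.neutral) (auto simp: mult.assoc)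
  then show ?case by (simp add: wedge_def)
qed

text \<open>Only permutations fixing \<open>n\<close> survive. Each contributes
  \<open>sign \<sigma>\<close> twice, hence 1, and their number \<open>fact n\<close> is cancelled
  by the normalisation of \<open>wedge\<close>.\<close>

lemma wedge_covectors_dual:
  assumes "\<And>i j. i < n \<Longrightarrow> j < n \<Longrightarrow> blinfun_apply (a i) (w j) = (if i = j then 1 else 0)"
  shows "wedge_covectors a n w = 1"
  using assms
proof (induction n)
  case 0
  then show ?case by simp
next
  case (Suc n)
  have 1: "wedge_covectors a n w = 1" using Suc by simp
  let ?F = "\<lambda>\<sigma>. of_int (sign \<sigma>) * wedge_covectors a n (\<lambda>i. w (\<sigma> i)) *
      covector_form (a n) (\<lambda>i. w (\<sigma> (n + i)))"
  have sub: "{\<sigma>. \<sigma> permutes {..<n}} \<subseteq> {\<sigma>. \<sigma> permutes {..<Suc n}}"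
    by (intro Collect_mono impI) (erule permutes_subset, simp)
  have "(\<Sum>\<sigma> | \<sigma> permutes {..<Suc n}. ?F \<sigma>) = (\<Sum>\<sigma> | \<sigma> permutes {..<n}. ?F \<sigma>)"
  proof -
    \<comment> \<open>A permutation that moves \<open>n\<close> feeds \<open>a n\<close> with some
      \<open>w j\<close>, \<open>j < n\<close>, on which it vanishes.\<close>
    have "?F \<sigma> = 0" if \<sigma>: "\<sigma> \<in> {\<sigma>. \<sigma> permutes {..<Suc n}} - {\<sigma>. \<sigma> permutes {..<n}}" for \<sigma>
    proof -
      have "\<sigma> n \<noteq> n"
      proof
        assume n: "\<sigma> n = n"
        have D: "x = n" if "x \<in> {..<Suc n} - {..<n}" for x using that by auto
        have "\<sigma> permutes {..<Suc n}" using \<sigma> by blast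
        then have "\<sigma> permutes {..<n}"
          by (rule permutes_superset) (use D n in blast)
        with \<sigma> show False by simp
      qed
      moreover have "\<sigma> n < Suc n"
        using \<sigma> by (metis DiffD1 lessI lessThan_iff mem_Collect_eq permutes_in_image)
      ultimately show "?F \<sigma> = 0" using Suc.prems[of n "\<sigma> n"] by (simp add: covector_form_def)
    qed
    then show ?thesis
      by (intro sum.mono_neutral_right[OF _ sub] ballI) (simp_all add: finite_permutations)
  qed
  also have "\<dots> = (\<Sum>\<sigma> | \<sigma> permutes {..<n}. 1)"
  proof (rule sum.cong)
    fix \<sigma> assume "\<sigma> \<in> {\<sigma>. \<sigma> permutes {..<n}}"
    then have \<sigma>: "\<sigma> permutes {..<n}" by simp
    have "\<sigma> n = n" using \<sigma> by (simp add: permutes_not_in)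
    moreover have "(of_int (sign \<sigma>) * of_int (sign \<sigma>) :: real) = 1"
      by (metis of_int_1 of_int_mult sign_idempotent)
    ultimately show "?F \<sigma> = 1"
      using Suc.prems[of n n] by (simp add: wedge_covectors_permute[OF \<sigma>] covector_form_def 1)
  qed simp
  also have "\<dots> = fact n" by (simp add: card_permutations[of "{..<n}" n])
  finally show ?case by (simp add: wedge_def)
qed

text \<open>This recovers a 2-form on the common kernel from its wedge with the covectors. The
  surviving permutations are those of \<open>{..<n}\<close>, with or without the swap of the last
  two slots; their \<open>2 * fact n\<close> equal contributions cancel against the
  normalisation.\<close>

lemma wedge_2_dual_kernel:
  assumes dual: "\<And>i j. i < n \<Longrightarrow> j < n \<Longrightarrow> blinfun_apply (a i) (v j) = (if i = j then 1 else 0)"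
    and ker: "\<And>i. i < n \<Longrightarrow> blinfun_apply (a i) (v n) = 0"
      "\<And>i. i < n \<Longrightarrow> blinfun_apply (a i) (v (Suc n)) = 0"
    and \<omega>: "multilinear_form 2 \<omega>" "\<And>v. \<omega> (\<lambda>i. v (Transposition.transpose 0 1 i)) = - \<omega> v"
  shows "wedge n 2 (wedge_covectors a n) \<omega> v = \<omega> (\<lambda>i. v (n + i))"
proof -
  let ?W = "wedge_covectors a n"
  let ?F = "\<lambda>\<sigma>. of_int (sign \<sigma>) * ?W (\<lambda>i. v (\<sigma> i)) * \<omega> (\<lambda>i. v (\<sigma> (n + i)))"
  let ?P = "{\<sigma>. \<sigma> permutes {..<n}}"
  let ?s = "Transposition.transpose n (Suc n)"
  have W1: "?W v = 1" by (rule wedge_covectors_dual[OF dual])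
  have fin: "finite ?P" by (simp add: finite_permutations)
  have s: "?s permutes {..<n + 2}" by (rule permutes_swap_id) auto
  have P_sub: "\<sigma> permutes {..<n + 2}" if "\<sigma> \<in> ?P" for \<sigma>
    using that permutes_subset[of \<sigma> "{..<n}" "{..<n + 2}"] by simp
  have Pn: "\<sigma> n = n" "\<sigma> (Suc n) = Suc n" if "\<sigma> \<in> ?P" for \<sigma>
    using that by (auto simp: permutes_not_in)
  have sub: "?P \<union> (\<lambda>\<tau>. \<tau> \<circ> ?s) ` ?P \<subseteq> {\<sigma>. \<sigma> permutes {..<n + 2}}"
    using P_sub permutes_compose[OF s] by auto
  \<comment> \<open>Any other permutation puts one of the two kernel vectors into a slot of the
    covectors.\<close>
  have z: "?F \<sigma> = 0" if \<sigma>: "\<sigma> permutes {..<n + 2}" "\<sigma> \<notin> ?P \<union> (\<lambda>\<tau>. \<tau> \<circ> ?s) ` ?P" for \<sigma>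
  proof -
    have "\<exists>j<n. \<sigma> j \<in> {n, Suc n}"
    proof (rule ccontr)
      assume neg: "\<not> (\<exists>j<n. \<sigma> j \<in> {n, Suc n})"
      obtain j1 where j1: "j1 < n + 2" "\<sigma> j1 = n"
        using permutes_image[OF \<sigma>(1)] by (metis imageE lessThan_iff less_add_same_cancel1 zero_less_numeral)
      obtain j2 where j2: "j2 < n + 2" "\<sigma> j2 = Suc n"
        using permutes_image[OF \<sigma>(1)] by (metis imageE lessThan_iff add_2_eq_Suc' lessI)
      have D: "x = n \<or> x = Suc n" if "x \<in> {..<n + 2} - {..<n}" for x using that by auto
      have "j1 \<noteq> j2" using j1 j2 by auto
      with j1 j2 neg have j: "(j1 = n \<and> j2 = Suc n) \<or> (j1 = Suc n \<and> j2 = n)"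
        by (metis insertCI less_Suc_eq add_2_eq_Suc')
      then show False
      proof
        assume "j1 = n \<and> j2 = Suc n"
        then have fixed: "\<sigma> n = n" "\<sigma> (Suc n) = Suc n" using j1 j2 by auto
        have "\<sigma> permutes {..<n}"
          by (rule permutes_superset[OF \<sigma>(1)]) (use D fixed in blast)
        with \<sigma> show False by simp
      next
        assume "j1 = Suc n \<and> j2 = n"
        then have fixed: "(\<sigma> \<circ> ?s) n = n" "(\<sigma> \<circ> ?s) (Suc n) = Suc n" using j1 j2 by auto
        have "\<sigma> \<circ> ?s permutes {..<n}"
          by (rule permutes_superset[OF permutes_compose[OF s \<sigma>(1)]]) (use D fixed in blast)
        moreover have "\<sigma> = (\<sigma> \<circ> ?s) \<circ> ?s" by (simp add: comp_assoc)
        ultimately have "\<sigma> \<in> (\<lambda>\<tau>. \<tau> \<circ> ?s) ` ?P" by blast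
        with \<sigma> show False by simp
      qed
    qed
    then obtain j where "j < n" "\<sigma> j \<in> {n, Suc n}" by blast
    then have "?W (\<lambda>i. v (\<sigma> i)) = 0"
      using ker by (intro wedge_covectors_kernel[of j]) auto
    then show ?thesis by simp
  qed
  have disj: "?P \<inter> (\<lambda>\<tau>. \<tau> \<circ> ?s) ` ?P = {}"
  proof -
    have "\<sigma> \<circ> ?s \<notin> ?P" if "\<sigma> \<in> ?P" for \<sigma>
      using Pn(1)[of "\<sigma> \<circ> ?s"] Pn(2)[OF that] by auto
    then show ?thesis by blast
  qed
  have inj: "inj_on (\<lambda>\<tau>. \<tau> \<circ> ?s) ?P"
    by (rule inj_onI) (metis comp_assoc comp_id transpose_comp_involutory)
  have sq: "(of_int (sign \<sigma>) * of_int (sign \<sigma>) :: real) = 1" for \<sigma> :: "nat \<Rightarrow> nat"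
    by (metis of_int_1 of_int_mult sign_idempotent)
  have F1: "?F \<sigma> = \<omega> (\<lambda>i. v (n + i))" if \<sigma>: "\<sigma> \<in> ?P" for \<sigma>
  proof -
    have "\<omega> (\<lambda>i. v (\<sigma> (n + i))) = \<omega> (\<lambda>i. v (n + i))"
      using Pn[OF \<sigma>] by (intro multilinear_form_cong[OF \<omega>(1)]) (auto simp: less_2_cases_iff)
    then show ?thesis using \<sigma> by (simp add: wedge_covectors_permute W1 sq)
  qed
  \<comment> \<open>The swap changes the sign of the permutation and that of
    \<open>\<omega>\<close>, so the summand is unchanged.\<close>
  have F2: "?F (\<sigma> \<circ> ?s) = \<omega> (\<lambda>i. v (n + i))" if \<sigma>: "\<sigma> \<in> ?P" for \<sigma>
  proof -
    have 1: "\<omega> (\<lambda>i. v ((\<sigma> \<circ> ?s) (n + i))) = \<omega> (\<lambda>i. v (n + Transposition.transpose 0 1 i))"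
      using Pn[OF \<sigma>] by (intro multilinear_form_cong[OF \<omega>(1)]) (auto simp: less_2_cases_iff)
    have 2: "?W (\<lambda>i. v ((\<sigma> \<circ> ?s) i)) = ?W (\<lambda>i. v (\<sigma> i))"
      by (intro multilinear_form_cong[OF multilinear_wedge_covectors]) (auto simp: Transposition.transpose_def)
    have "permutation \<sigma>" using \<sigma> permutation_permutes by blast
    then have "sign (\<sigma> \<circ> ?s) = - sign \<sigma>"
      by (simp add: sign_compose permutation_swap_id sign_swap_id)
    then have 3: "(of_int (sign (\<sigma> \<circ> ?s)) :: real) = - of_int (sign \<sigma>)" by simp
    have 4: "\<omega> (\<lambda>i. v (n + Transposition.transpose 0 1 i)) = - \<omega> (\<lambda>i. v (n + i))"
      by (rule \<omega>(2))
    have 5: "?W (\<lambda>i. v (\<sigma> i)) = of_int (sign \<sigma>)"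
      using \<sigma> wedge_covectors_permute[of \<sigma> n a v] W1 by simp
    show ?thesis unfolding 1 2 3 4 5 using sq[of \<sigma>] by simp
  qed
  have "(\<Sum>\<sigma> | \<sigma> permutes {..<n + 2}. ?F \<sigma>) = (\<Sum>\<sigma> \<in> ?P \<union> (\<lambda>\<tau>. \<tau> \<circ> ?s) ` ?P. ?F \<sigma>)"
    using z by (intro sum.mono_neutral_right[OF _ sub]) (auto simp: finite_permutations)
  also have "\<dots> = (\<Sum>\<sigma> \<in> ?P. ?F \<sigma>) + (\<Sum>\<sigma> \<in> ?P. ?F (\<sigma> \<circ> ?s))"
    using sum.union_disjoint[OF fin finite_imageI[OF fin] disj, of ?F]
    unfolding sum.reindex[OF inj] by (simp only: o_def[of ?F])
  also have "\<dots> = (\<Sum>\<sigma> \<in> ?P. \<omega> (\<lambda>i. v (n + i))) + (\<Sum>\<sigma> \<in> ?P. \<omega> (\<lambda>i. v (n + i)))"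
    by (intro arg_cong2[of _ _ _ _ "(+)"] sum.cong refl F1 F2)
  also have "\<dots> = 2 * fact n * \<omega> (\<lambda>i. v (n + i))"
    by (simp add: card_permutations[of "{..<n}" n])
  finally have E: "(\<Sum>\<sigma> | \<sigma> permutes {..<n + 2}. ?F \<sigma>) = 2 * fact n * \<omega> (\<lambda>i. v (n + i))" .
  have "2 * fact n * x / (fact n * fact 2) = x" for x :: real
    by (simp add: fact_2)
  then show ?thesis unfolding wedge_def E .
qed

section \<open>Endomorphisms near the identity\<close>

lemma norm_blinfun_apply_le:
  fixes X :: "'a::real_normed_vector \<Rightarrow>\<^sub>L 'b::real_normed_vector"
  assumes "norm X \<le> a" "norm v \<le> b"
  shows "norm (X v) \<le> a * b"
  using norm_blinfun[of X v] mult_mono[OF assms] norm_ge_zero[of X] norm_ge_zero[of v] assms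
  by linarith

text \<open>Meaningful for injective \<open>A\<close>: in finite dimension \<open>inv\<close> is
  then a bounded linear inverse.\<close>

definition blinfun_inv :: "('a::euclidean_space \<Rightarrow>\<^sub>L 'a) \<Rightarrow> 'a \<Rightarrow>\<^sub>L 'a" where
  "blinfun_inv A = Blinfun (inv (blinfun_apply A))"

lemma blinfun_inv:
  fixes A :: "'a::euclidean_space \<Rightarrow>\<^sub>L 'a"
  assumes "inj (blinfun_apply A)"
  shows "blinfun_inv A (A v) = v" "A (blinfun_inv A v) = v"
proof -
  have lin: "linear (blinfun_apply A)"
    by (rule bounded_linear.linear[OF blinfun.bounded_linear_right])
  have surj: "surj (blinfun_apply A)"
    using lin assms linear_injective_imp_surjective by blast
  have "linear (inv (blinfun_apply A))"
    using lin assms inj_linear_imp_inv_linear bij_def surj by blast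
  then have "bounded_linear (inv (blinfun_apply A))"
    by (rule linear_conv_bounded_linear[THEN iffD1])
  then have "blinfun_apply (blinfun_inv A) = inv (blinfun_apply A)"
    unfolding blinfun_inv_def by (rule bounded_linear_Blinfun_apply)
  then show "blinfun_inv A (A v) = v" "A (blinfun_inv A v) = v"
    using assms surj by (simp_all add: surj_f_inv_f)
qed

text \<open>Reverse triangle inequality. The tolerance 1/2 is the source of the constants 2 and 4 in
  the later estimates of inverses.\<close>

lemma near_id_lower_bound:
  fixes A :: "'a::euclidean_space \<Rightarrow>\<^sub>L 'a"
  assumes "norm (A - id_blinfun) \<le> 1/2"
  shows "norm v \<le> 2 * norm (A v)"
proof -
  have "norm (A v - v) = norm ((A - id_blinfun) v)" by (simp add: blinfun.diff_left)
  also have "\<dots> \<le> norm (A - id_blinfun) * norm v" by (rule norm_blinfun)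
  also have "\<dots> \<le> 1/2 * norm v" by (intro mult_right_mono assms) simp
  finally show ?thesis using norm_triangle_ineq2[of v "v - A v"] by (simp add: norm_minus_commute)
qed

lemma near_id_inj:
  fixes A :: "'a::euclidean_space \<Rightarrow>\<^sub>L 'a"
  assumes "norm (A - id_blinfun) \<le> 1/2"
  shows "inj (blinfun_apply A)"
proof (rule injI)
  fix v w assume "A v = A w"
  then have "A (v - w) = 0" by (simp add: blinfun.diff_right)
  then show "v = w" using near_id_lower_bound[OF assms, of "v - w"] by simp
qed

lemmas near_id_inv = blinfun_inv[OF near_id_inj]

lemma near_id_inv_bound:
  fixes A :: "'a::euclidean_space \<Rightarrow>\<^sub>L 'a"
  assumes "norm (A - id_blinfun) \<le> 1/2"
  shows "norm (blinfun_inv A v) \<le> 2 * norm v"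
  using near_id_lower_bound[OF assms, of "blinfun_inv A v"] near_id_inv(2)[OF assms] by simp

text \<open>Resolvent identity: the difference of the inverses of \<open>A\<close> and
  \<open>B\<close> is the inverse of \<open>A\<close>, times \<open>B - A\<close>, times the inverse
  of \<open>B\<close>, and both inverses have norm at most 2.\<close>

lemma near_id_inv_diff:
  fixes A B :: "'a::euclidean_space \<Rightarrow>\<^sub>L 'a"
  assumes A: "norm (A - id_blinfun) \<le> 1/2" and B: "norm (B - id_blinfun) \<le> 1/2"
  shows "norm (blinfun_inv A - blinfun_inv B) \<le> 4 * norm (A - B)"
proof (rule norm_blinfun_bound)
  fix v
  have "blinfun_inv A v - blinfun_inv B v = blinfun_inv A ((B - A) (blinfun_inv B v))"
    by (simp add: blinfun.diff_left blinfun.diff_right near_id_inv[OF A] near_id_inv[OF B])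
  then have "norm ((blinfun_inv A - blinfun_inv B) v) \<le> 2 * norm ((B - A) (blinfun_inv B v))"
    using near_id_inv_bound[OF A] by (simp add: blinfun.diff_left)
  also have "\<dots> \<le> 2 * (norm (B - A) * norm (blinfun_inv B v))"
    by (intro mult_left_mono norm_blinfun) simp
  also have "\<dots> \<le> 2 * (norm (B - A) * (2 * norm v))"
    by (intro mult_left_mono near_id_inv_bound[OF B]) simp_all
  finally show "norm ((blinfun_inv A - blinfun_inv B) v) \<le> 4 * norm (A - B) * norm v"
    by (simp add: norm_minus_commute)
qed simp

lemma continuous_on_near_id_inv:
  fixes F :: "'b::topological_space \<Rightarrow> 'a::euclidean_space \<Rightarrow>\<^sub>L 'a"
  assumes "continuous_on T F" "\<And>t. t \<in> T \<Longrightarrow> norm (F t - id_blinfun) \<le> 1/2"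
  shows "continuous_on T (\<lambda>t. blinfun_inv (F t))"
  unfolding continuous_on_def
proof
  fix t assume t: "t \<in> T"
  have "((\<lambda>s. 4 * norm (F s - F t)) \<longlongrightarrow> 4 * norm (F t - F t)) (at t within T)"
    using assms(1) t unfolding continuous_on_def by (intro tendsto_intros) auto
  then have "((\<lambda>s. 4 * norm (F s - F t)) \<longlongrightarrow> 0) (at t within T)" by simp
  moreover have "\<forall>\<^sub>F s in at t within T. norm (blinfun_inv (F s) - blinfun_inv (F t)) \<le> 4 * norm (F s - F t)"
    unfolding eventually_at_filter using t by (auto intro!: always_eventually near_id_inv_diff assms(2))
  ultimately have "((\<lambda>s. blinfun_inv (F s) - blinfun_inv (F t)) \<longlongrightarrow> 0) (at t within T)"
    by (rule Lim_null_comparison[rotated])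
  then show "((\<lambda>s. blinfun_inv (F s)) \<longlongrightarrow> blinfun_inv (F t)) (at t within T)"
    by (rule Lim_null[THEN iffD2])
qed

section \<open>Uniqueness of integral curves\<close>

text \<open>A differential inequality for the regularised norm \<open>f\<close>, solved with the
  integrating factor \<open>exp (- b * s)\<close>; the regularisation then tends to 0.\<close>

lemma gronwall_vector:
  fixes Q :: "real \<Rightarrow> 'a::real_inner"
  assumes der: "\<And>t. t \<in> {0..1} \<Longrightarrow> (Q has_vector_derivative Q' t) (at t within {0..1})"
    and bound: "\<And>t. t \<in> {0..1} \<Longrightarrow> norm (Q' t) \<le> a + b * norm (Q t)"
    and "Q 0 = 0" "0 \<le> a" "0 \<le> b" "t \<in> {0..1}"
  shows "norm (Q t) \<le> a * t * exp (b * t)"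
proof (rule field_le_epsilon)
  fix e :: real assume "0 < e"
  \<comment> \<open>\<open>k\<close> is the starting value of \<open>f\<close>; its exponential
    cancels the growth \<open>exp (b * t)\<close>, so that exactly the error \<open>e\<close>
    remains.\<close>
  define k where "k = e * exp (- b * t)"
  have "0 < k" using \<open>0 < e\<close> by (simp add: k_def)
  \<comment> \<open>differentiable, unlike the norm itself\<close>
  define f where "f = (\<lambda>s. sqrt (Q s \<bullet> Q s + k\<^sup>2))"
  have pos: "0 < Q s \<bullet> Q s + k\<^sup>2" for s
    using \<open>0 < k\<close> by (intro add_nonneg_pos) auto
  have f_ge: "norm (Q s) \<le> f s" for s
    unfolding f_def norm_eq_sqrt_inner by simp
  have fpos: "0 < f s" for s using pos by (simp add: f_def)
  define f' where "f' = (\<lambda>s. (Q s \<bullet> Q' s) / f s)"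
  have f_der: "(f has_field_derivative f' s) (at s within {0..1})" if s: "s \<in> {0..1}" for s
  proof -
    have "((\<lambda>s. Q s \<bullet> Q s) has_vector_derivative (Q s \<bullet> Q' s + Q' s \<bullet> Q s)) (at s within {0..1})"
      by (rule bounded_bilinear.has_vector_derivative[OF bounded_bilinear_inner der[OF s] der[OF s]])
    then have "((\<lambda>s. Q s \<bullet> Q s) has_field_derivative (2 * (Q s \<bullet> Q' s))) (at s within {0..1})"
      by (simp add: has_real_derivative_iff_has_vector_derivative inner_commute)
    then show ?thesis unfolding f_def f'_def
      using pos[of s] by (auto intro!: derivative_eq_intros simp: divide_simps)
  qed
  have f'_le: "f' s \<le> a + b * f s" if s: "s \<in> {0..1}" for s
  proof -
    have "Q s \<bullet> Q' s \<le> norm (Q s) * norm (Q' s)" by (rule norm_cauchy_schwarz)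
    also have "\<dots> \<le> f s * (a + b * f s)"
      using bound[OF s] f_ge[of s] \<open>0 \<le> b\<close> fpos[of s]
      by (intro mult_mono) (auto intro: order_trans[OF _ add_left_mono[OF mult_left_mono]])
    finally show ?thesis using fpos[of s] by (simp add: f'_def divide_simps mult.commute)
  qed
  \<comment> \<open>\<open>g\<close> is nonincreasing and starts at \<open>k\<close>.\<close>
  define g where "g = (\<lambda>s. f s * exp (- b * s) - a * s)"
  define g' where "g' = (\<lambda>s. f' s * exp (- b * s) + f s * (exp (- b * s) * (- b)) - a)"
  have g_der: "(g has_field_derivative g' s) (at s within {0..1})" if "s \<in> {0..1}" for s
    unfolding g_def g'_def
    by (auto intro!: derivative_eq_intros f_der[OF that])
  have g'_le: "g' s \<le> 0" if s: "s \<in> {0..1}" for s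
  proof -
    have "g' s = (f' s - b * f s) * exp (- b * s) - a" by (simp add: g'_def algebra_simps)
    also have "\<dots> \<le> a * exp (- b * s) - a"
      using f'_le[OF s] by (intro diff_mono mult_right_mono) auto
    also have "\<dots> \<le> a * 1 - a"
      using \<open>0 \<le> a\<close> \<open>0 \<le> b\<close> s by (intro diff_mono mult_left_mono) auto
    finally show ?thesis by simp
  qed
  have "g t \<le> g 0"
  proof (rule DERIV_nonpos_imp_decreasing_open[of 0 t g])
    fix s assume "0 < s" "s < t"
    then have "s \<in> {0..1}" "at s within {0..1} = at s"
      using assms(6) by (auto intro: at_within_Icc_at)
    then show "\<exists>y. (g has_field_derivative y) (at s) \<and> y \<le> 0"
      using g_der[of s] g'_le[of s] by auto
  next
    have "continuous_on {0..1} g"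
      by (rule DERIV_continuous_on[OF g_der])
    then show "continuous_on {0..t} g"
      by (rule continuous_on_subset) (use assms(6) in auto)
  qed (use assms(6) in auto)
  then have "f t * exp (- b * t) \<le> k + a * t"
    using \<open>Q 0 = 0\<close> \<open>0 < k\<close> by (simp add: g_def f_def)
  then have "f t * exp (- b * t) * exp (b * t) \<le> (k + a * t) * exp (b * t)"
    by (rule mult_right_mono) simp
  then have "f t \<le> a * t * exp (b * t) + e"
    by (simp add: k_def algebra_simps exp_add[symmetric] flip: exp_add)
  then show "norm (Q t) \<le> a * t * exp (b * t) + e"
    using f_ge[of t] by linarith
qed

text \<open>Stokes' theorem is carried out by hand on the strip \<open>c t s\<close>. The derivative
  of \<open>Q\<close>, the integral of \<open>A'\<close> over the segment at time \<open>t\<close>,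
  consists of two endpoint terms, both close to \<open>x\<close>, and of the antisymmetrised
  derivative of \<open>A'\<close>. The condition \<open>4 * norm x \<le> \<epsilon>\<close> keeps
  Gronwall's exponent below \<open>\<epsilon> * M\<close>, which the weight in \<open>approx\<close>
  absorbs.\<close>

lemma integral_curves_unique:
  fixes A :: "'a::euclidean_space \<Rightarrow> 'a \<Rightarrow>\<^sub>L 'a" and \<gamma>\<^sub>1 \<gamma>\<^sub>2 :: "real \<Rightarrow> 'a"
  assumes near: "\<And>z. z \<in> ball q \<rho> \<Longrightarrow> norm (A z - id_blinfun) \<le> 1/4"
    and approx: "\<And>e. 0 < e \<Longrightarrow> \<exists>A' DA' M S.
        (\<forall>z\<in>ball q \<rho>. (A' has_derivative blinfun_apply (DA' z)) (at z)) \<and>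
        continuous_on (ball q \<rho>) (DA' :: 'a \<Rightarrow> 'a \<Rightarrow>\<^sub>L 'a \<Rightarrow>\<^sub>L 'a) \<and> 0 \<le> M \<and> 0 \<le> S \<and>
        (\<forall>z\<in>ball q \<rho>. norm (A' z - A z) \<le> S) \<and>
        (\<forall>z\<in>ball q \<rho>. \<forall>u v. norm (DA' z u v - DA' z v u) \<le> M * norm u * norm v) \<and>
        S * exp (\<epsilon> * M) \<le> e"
    and "0 < \<epsilon>" "4 * norm x \<le> \<epsilon>"
    and der1: "\<And>t. t \<in> {0..1} \<Longrightarrow> (\<gamma>\<^sub>1 has_vector_derivative D\<^sub>1 t) (at t within {0..1})"
    and der2: "\<And>t. t \<in> {0..1} \<Longrightarrow> (\<gamma>\<^sub>2 has_vector_derivative D\<^sub>2 t) (at t within {0..1})"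
    and cont: "continuous_on {0..1} D\<^sub>1" "continuous_on {0..1} D\<^sub>2"
    and ball: "\<And>t. t \<in> {0..1} \<Longrightarrow> \<gamma>\<^sub>1 t \<in> ball q \<rho>" "\<And>t. t \<in> {0..1} \<Longrightarrow> \<gamma>\<^sub>2 t \<in> ball q \<rho>"
    and x: "\<And>t. t \<in> {0..1} \<Longrightarrow> A (\<gamma>\<^sub>1 t) (D\<^sub>1 t) = x" "\<And>t. t \<in> {0..1} \<Longrightarrow> A (\<gamma>\<^sub>2 t) (D\<^sub>2 t) = x"
    and "\<gamma>\<^sub>1 0 = \<gamma>\<^sub>2 0" "t \<in> {0..1}"
  shows "\<gamma>\<^sub>1 t = \<gamma>\<^sub>2 t"
proof -
  define \<Delta> where "\<Delta> = (\<lambda>t. \<gamma>\<^sub>2 t - \<gamma>\<^sub>1 t)"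
  define c where "c = (\<lambda>t s. \<gamma>\<^sub>1 t + s *\<^sub>R \<Delta> t)"
  define c' where "c' = (\<lambda>t s. D\<^sub>1 t + s *\<^sub>R (D\<^sub>2 t - D\<^sub>1 t))"
  have \<Delta>_der: "(\<Delta> has_vector_derivative (D\<^sub>2 t - D\<^sub>1 t)) (at t within {0..1})" if "t \<in> {0..1}" for t
    unfolding \<Delta>_def by (intro has_vector_derivative_diff der1 der2 that)
  have c_der: "((\<lambda>t. c t s) has_vector_derivative c' t s) (at t within {0..1})" if "t \<in> {0..1}" for t s
    unfolding c_def c'_def
    by (intro has_vector_derivative_add der1 that
        bounded_linear.has_vector_derivative[OF bounded_linear_scaleR_right \<Delta>_der])
  have c_alt: "c t s = (1 - s) *\<^sub>R \<gamma>\<^sub>1 t + s *\<^sub>R \<gamma>\<^sub>2 t"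
    and c'_alt: "c' t s = (1 - s) *\<^sub>R D\<^sub>1 t + s *\<^sub>R D\<^sub>2 t" for t s
    by (simp_all add: c_def c'_def \<Delta>_def algebra_simps)
  have c_ball: "c t s \<in> ball q \<rho>" if "t \<in> {0..1}" "s \<in> {0..1}" for t s
    unfolding c_alt using that ball[OF that(1)] by (intro convexD[OF convex_ball]) auto
  have D_le: "norm (D\<^sub>1 t) \<le> 2 * norm x" "norm (D\<^sub>2 t) \<le> 2 * norm x" if "t \<in> {0..1}" for t
    using near_id_lower_bound[of "A (\<gamma>\<^sub>1 t)" "D\<^sub>1 t"] near_id_lower_bound[of "A (\<gamma>\<^sub>2 t)" "D\<^sub>2 t"]
      near[OF ball(1)[OF that]] near[OF ball(2)[OF that]] x[OF that] by auto
  have c'_le: "norm (c' t s) \<le> 2 * norm x" if "t \<in> {0..1}" "s \<in> {0..1}" for t s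
  proof -
    have "c' t s \<in> cball 0 (2 * norm x)"
      unfolding c'_alt using that D_le[OF that(1)] by (intro convexD[OF convex_cball]) auto
    then show ?thesis by simp
  qed
  have c_cont: "continuous_on ({0..1} \<times> {0..1}) (\<lambda>(t, s). c t s)"
    "continuous_on ({0..1} \<times> {0..1}) (\<lambda>(t, s). c' t s)"
    "continuous_on ({0..1} \<times> {0..1}) (\<lambda>(t, s::real). \<Delta> t)"
    "continuous_on ({0..1} \<times> {0..1}) (\<lambda>(t, s::real). D\<^sub>2 t - D\<^sub>1 t)"
  proof -
    have g: "continuous_on {0..1} \<gamma>\<^sub>1" "continuous_on {0..1} \<gamma>\<^sub>2"
      by (rule continuous_on_vector_derivative[OF der1], assumption)
        (rule continuous_on_vector_derivative[OF der2], assumption)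
    have [continuous_intros]: "continuous_on ({0..1} \<times> {0..1}) (\<lambda>p. f (fst p))"
      if "continuous_on {0..1} f" for f :: "real \<Rightarrow> 'a"
      by (rule continuous_on_compose2[OF that]) (auto intro!: continuous_intros)
    show "continuous_on ({0..1} \<times> {0..1}) (\<lambda>(t, s). c t s)"
      "continuous_on ({0..1} \<times> {0..1}) (\<lambda>(t, s). c' t s)"
      "continuous_on ({0..1} \<times> {0..1}) (\<lambda>(t, s::real). \<Delta> t)"
      "continuous_on ({0..1} \<times> {0..1}) (\<lambda>(t, s::real). D\<^sub>2 t - D\<^sub>1 t)"
      unfolding c_def c'_def \<Delta>_def split_beta by (intro continuous_intros g cont)+
  qed
  \<comment> \<open>The bound 1/4 on \<open>e\<close> passes to \<open>S\<close>, because the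
    exponential is at least 1; so \<open>A'\<close> stays within 1/2 of the identity.\<close>
  have main: "norm (\<Delta> t) \<le> 2 * \<epsilon> * e" if e: "0 < e" "e \<le> 1/4" for e
  proof -
    from approx[OF e(1)] obtain A' DA' M S where
      A': "\<And>z. z \<in> ball q \<rho> \<Longrightarrow> (A' has_derivative blinfun_apply (DA' z)) (at z)"
      and DA': "continuous_on (ball q \<rho>) (DA' :: 'a \<Rightarrow> 'a \<Rightarrow>\<^sub>L 'a \<Rightarrow>\<^sub>L 'a)"
      and nn: "0 \<le> M" "0 \<le> S"
      and S: "\<And>z. z \<in> ball q \<rho> \<Longrightarrow> norm (A' z - A z) \<le> S"
      and M: "\<And>z u v. z \<in> ball q \<rho> \<Longrightarrow> norm (DA' z u v - DA' z v u) \<le> M * norm u * norm v"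
      and SM: "S * exp (\<epsilon> * M) \<le> e" by blast
    have "S * 1 \<le> S * exp (\<epsilon> * M)"
      using nn \<open>0 < \<epsilon>\<close> by (intro mult_left_mono) auto
    then have "S \<le> 1/4" using SM e by linarith
    then have near': "norm (A' z - id_blinfun) \<le> 1/2" if "z \<in> ball q \<rho>" for z
      using near[OF that] S[OF that] norm_triangle_ineq[of "A' z - A z" "A z - id_blinfun"] by simp
    have A'_cont: "continuous_on (ball q \<rho>) A'"
      by (rule has_derivative_continuous_on[OF has_derivative_at_withinI[OF A']])
    \<comment> \<open>\<open>f\<close> is the integrand of \<open>A'\<close> along the segment and
      \<open>f'\<close> its derivative in \<open>t\<close>, whereas \<open>h'\<close> is the
      derivative in \<open>s\<close> of \<open>A' (c t s) (c' t s)\<close>. Their difference is the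
      antisymmetrised derivative of \<open>A'\<close> at \<open>c' t s\<close> and
      \<open>\<Delta> t\<close>.\<close>
    define f where "f = (\<lambda>t s. A' (c t s) (\<Delta> t))"
    define f' where "f' = (\<lambda>t s. A' (c t s) (D\<^sub>2 t - D\<^sub>1 t) + DA' (c t s) (c' t s) (\<Delta> t))"
    define h' where "h' = (\<lambda>t s. A' (c t s) (D\<^sub>2 t - D\<^sub>1 t) + DA' (c t s) (\<Delta> t) (c' t s))"
    have chain: "((\<lambda>t. A' (g t)) has_vector_derivative DA' (g t) g') (at t within T)"
      if "g t \<in> ball q \<rho>" "(g has_vector_derivative g') (at t within T)" for g g' t T
      using has_derivative_compose[OF that(2)[unfolded has_vector_derivative_def] A'[OF that(1)]]
      by (simp add: has_vector_derivative_def blinfun.scaleR_right blinfun.scaleR_left)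
    have f_der: "((\<lambda>t. f t s) has_vector_derivative f' t s) (at t within {0..1})"
      if "t \<in> {0..1}" "s \<in> {0..1}" for t s
      unfolding f_def f'_def
      by (rule bounded_bilinear.has_vector_derivative[OF bounded_bilinear_blinfun_apply
            chain[OF c_ball[OF that] c_der[OF that(1)]] \<Delta>_der[OF that(1)]])
    have comp: "continuous_on ({0..1} \<times> {0..1}) (\<lambda>p. F (case p of (t, s) \<Rightarrow> c t s))"
      if "continuous_on (ball q \<rho>) F" for F :: "'a \<Rightarrow> 'b::topological_space"
      by (rule continuous_on_compose2[OF that c_cont(1)]) (use c_ball in auto)
    have f_cont: "continuous_on ({0..1} \<times> {0..1}) (\<lambda>(t, s). f t s)"
      "continuous_on ({0..1} \<times> {0..1}) (\<lambda>(t, s). f' t s)"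
      "continuous_on ({0..1} \<times> {0..1}) (\<lambda>(t, s). h' t s)"
      using comp[OF A'_cont] comp[OF DA'] c_cont
      unfolding f_def f'_def h'_def split_beta by (auto intro!: continuous_intros)
    have slice: "continuous_on {0..1} (F t)"
      if "continuous_on ({0..1} \<times> {0..1}) (\<lambda>(t, s). F t s)" "t \<in> {0..1}" for F :: "real \<Rightarrow> real \<Rightarrow> 'a" and t
    proof -
      have "continuous_on {0..1} (Pair t)" by (intro continuous_intros)
      moreover have "Pair t ` {0..1::real} \<subseteq> {0..1} \<times> {0..1}"
        using that(2) by (intro image_subsetI) auto
      ultimately have "continuous_on {0..1} (\<lambda>s. case Pair t s of (t, s) \<Rightarrow> F t s)"
        by (rule continuous_on_compose2[OF that(1)])
      then show ?thesis by simp
    qed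
    define Q where "Q = (\<lambda>t. integral {0..1} (f t))"
    have Q_der: "(Q has_vector_derivative integral {0..1} (f' t)) (at t within {0..1})"
      if "t \<in> {0..1}" for t
      unfolding Q_def
      using leibniz_rule_vector_derivative[of "{0..1}" 0 1 f f' t] that f_der f_cont
        slice[OF f_cont(1)] by (auto intro!: integrable_continuous_interval)
    have h_int: "(h' t has_integral A' (\<gamma>\<^sub>2 t) (D\<^sub>2 t) - A' (\<gamma>\<^sub>1 t) (D\<^sub>1 t)) {0..1}"
      if t: "t \<in> {0..1}" for t
    proof -
      have "((\<lambda>s. A' (c t s) (c' t s)) has_vector_derivative h' t s) (at s within {0..1})"
        if "s \<in> {0..1}" for s
        unfolding h'_def
      proof (rule bounded_bilinear.has_vector_derivative[OF bounded_bilinear_blinfun_apply])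
        show "((\<lambda>s. A' (c t s)) has_vector_derivative DA' (c t s) (\<Delta> t)) (at s within {0..1})"
          by (rule chain[of "c t" s, OF c_ball[OF t that]])
            (auto simp: c_def intro!: derivative_eq_intros)
        show "(c' t has_vector_derivative (D\<^sub>2 t - D\<^sub>1 t)) (at s within {0..1})"
          unfolding c'_def by (auto intro!: derivative_eq_intros)
      qed
      from fundamental_theorem_of_calculus[OF _ this]
      show ?thesis by (simp add: c_alt c'_alt)
    qed
    \<comment> \<open>The average of \<open>A'\<close> along the segment is still within 1/2 of the
      identity.\<close>
    have \<Delta>_le: "norm (\<Delta> t) \<le> 2 * norm (Q t)" if t: "t \<in> {0..1}" for t
    proof -
      have "norm (integral {0..1} (\<lambda>s. f t s - \<Delta> t)) \<le> (1/2 * norm (\<Delta> t)) * (1 - 0)"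
      proof (rule integral_bound)
        show "norm (f t s - \<Delta> t) \<le> 1/2 * norm (\<Delta> t)" if "s \<in> {0..1}" for s
        proof -
          have "norm (f t s - \<Delta> t) = norm ((A' (c t s) - id_blinfun) (\<Delta> t))"
            by (simp add: f_def blinfun.diff_left)
          also have "\<dots> \<le> norm (A' (c t s) - id_blinfun) * norm (\<Delta> t)" by (rule norm_blinfun)
          also have "\<dots> \<le> 1/2 * norm (\<Delta> t)"
            by (intro mult_right_mono near' c_ball t that) simp
          finally show ?thesis .
        qed
      qed (auto intro!: continuous_intros slice[OF f_cont(1) t])
      moreover have "integral {0..1} (\<lambda>s. f t s - \<Delta> t) = Q t - \<Delta> t"
        unfolding Q_def using slice[OF f_cont(1) t]
        by (subst integral_diff) (auto intro!: integrable_continuous_interval)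
      ultimately show ?thesis
        using norm_triangle_ineq2[of "\<Delta> t" "\<Delta> t - Q t"] by (simp add: norm_minus_commute)
    qed
    \<comment> \<open>The two endpoint terms deviate from \<open>x\<close> by at most
      \<open>S * (2 * norm x)\<close> each. In the curvature term one factor 2 comes from the bound
      on \<open>c'\<close> and the other from \<open>\<Delta>_le\<close>.\<close>
    have Q'_le: "norm (integral {0..1} (f' t)) \<le> 4 * norm x * S + 4 * norm x * M * norm (Q t)"
      if t: "t \<in> {0..1}" for t
    proof -
      have "norm (integral {0..1} (\<lambda>s. f' t s - h' t s)) \<le> (M * (2 * norm x) * norm (\<Delta> t)) * (1 - 0)"
      proof (rule integral_bound)
        show "norm (f' t s - h' t s) \<le> M * (2 * norm x) * norm (\<Delta> t)" if "s \<in> {0..1}" for s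
        proof -
          have "norm (f' t s - h' t s) \<le> M * norm (c' t s) * norm (\<Delta> t)"
            using M[OF c_ball[OF t that], of "c' t s" "\<Delta> t"] by (simp add: f'_def h'_def)
          also have "\<dots> \<le> M * (2 * norm x) * norm (\<Delta> t)"
            using nn by (intro mult_right_mono mult_left_mono c'_le t that) auto
          finally show ?thesis .
        qed
      qed (auto intro!: continuous_intros slice[OF f_cont(2) t] slice[OF f_cont(3) t])
      also have "\<dots> \<le> M * (2 * norm x) * (2 * norm (Q t)) * (1 - 0)"
        using nn by (intro mult_right_mono mult_left_mono \<Delta>_le t) auto
      finally have 1: "norm (integral {0..1} (\<lambda>s. f' t s - h' t s)) \<le> 4 * norm x * M * norm (Q t)"
        by (simp add: mult_ac)
      have 2: "integral {0..1} (\<lambda>s. f' t s - h' t s) =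
          integral {0..1} (f' t) - (A' (\<gamma>\<^sub>2 t) (D\<^sub>2 t) - A' (\<gamma>\<^sub>1 t) (D\<^sub>1 t))"
        using slice[OF f_cont(2) t] h_int[OF t]
        by (subst integral_diff) (auto intro!: integrable_continuous_interval simp: integral_unique has_integral_integrable)
      have 3: "norm (A' z d - x) \<le> S * (2 * norm x)"
        if "z \<in> ball q \<rho>" "A z d = x" "norm d \<le> 2 * norm x" for z d
      proof -
        have "norm (A' z d - x) = norm ((A' z - A z) d)"
          using that by (simp add: blinfun.diff_left)
        also have "\<dots> \<le> norm (A' z - A z) * norm d" by (rule norm_blinfun)
        also have "\<dots> \<le> S * (2 * norm x)"
          using nn by (intro mult_mono S that) auto
        finally show ?thesis .
      qed
      have "norm (A' (\<gamma>\<^sub>2 t) (D\<^sub>2 t) - A' (\<gamma>\<^sub>1 t) (D\<^sub>1 t)) \<le> 4 * norm x * S"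
        using 3[OF ball(1)[OF t] x(1)[OF t] D_le(1)[OF t]] 3[OF ball(2)[OF t] x(2)[OF t] D_le(2)[OF t]]
          norm_triangle_ineq4[of "A' (\<gamma>\<^sub>2 t) (D\<^sub>2 t) - x" "A' (\<gamma>\<^sub>1 t) (D\<^sub>1 t) - x"] by (simp add: algebra_simps)
      with 1 show ?thesis unfolding 2
        using norm_triangle_sub[of "integral {0..1} (f' t)" "A' (\<gamma>\<^sub>2 t) (D\<^sub>2 t) - A' (\<gamma>\<^sub>1 t) (D\<^sub>1 t)"] by linarith
    qed
    have Q0: "Q 0 = 0"
      using \<open>\<gamma>\<^sub>1 0 = \<gamma>\<^sub>2 0\<close> by (simp add: Q_def f_def \<Delta>_def)
    have "norm (Q t) \<le> 4 * norm x * S * t * exp (4 * norm x * M * t)"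
      by (rule gronwall_vector[OF Q_der Q'_le Q0])
        (use nn \<open>t \<in> {0..1}\<close> in auto)
    also have "\<dots> \<le> \<epsilon> * S * 1 * exp (\<epsilon> * M * 1)"
      using nn \<open>t \<in> {0..1}\<close> assms(3,4)
      by (intro mult_mono exp_le_cancel_iff[THEN iffD2]) (auto intro!: mult_mono mult_nonneg_nonneg)
    also have "\<dots> \<le> \<epsilon> * e" using SM assms(3) by (simp add: mult.assoc)
    finally show ?thesis using \<Delta>_le[OF \<open>t \<in> {0..1}\<close>] by simp
  qed
  have "norm (\<Delta> t) \<le> 0"
  proof (rule field_le_epsilon)
    fix d :: real assume "0 < d"
    define e where "e = min (1/4) (d / (2 * \<epsilon>))"
    have e: "0 < e" "e \<le> 1/4" using \<open>0 < d\<close> \<open>0 < \<epsilon>\<close> by (auto simp: e_def)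
    have "2 * \<epsilon> * e \<le> 2 * \<epsilon> * (d / (2 * \<epsilon>))"
      using \<open>0 < \<epsilon>\<close> by (intro mult_left_mono) (auto simp: e_def)
    also have "\<dots> = d" using \<open>0 < \<epsilon>\<close> by simp
    finally show "norm (\<Delta> t) \<le> 0 + d" using main[OF e] by simp
  qed
  then show ?thesis by (simp add: \<Delta>_def)
qed

section \<open>Euler polygons\<close>

text \<open>The induction carries the factor \<open>j / N\<close>, since each step adds
  \<open>c / N\<close>; in the end the \<open>N\<close>-th power of \<open>1 + b / N\<close> is at
  most \<open>exp b\<close>.\<close>

lemma discrete_gronwall:
  fixes a :: "nat \<Rightarrow> real"
  assumes "a 0 = 0" and step: "\<And>j. j < N \<Longrightarrow> a (Suc j) \<le> (1 + b / real N) * a j + c / real N"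
    and "0 \<le> b" "0 \<le> c" "j \<le> N"
  shows "a j \<le> c * exp b"
proof (cases "N = 0")
  \<comment> \<open>Only \<open>j = 0\<close> is left here.\<close>
  case True
  then show ?thesis using assms by simp
next
  case False
  let ?x = "1 + b / real N"
  have x: "1 \<le> ?x" using \<open>0 \<le> b\<close> by simp
  have "a j \<le> real j / real N * c * ?x ^ j" if "j \<le> N" for j
    using that
  proof (induction j)
    case 0
    then show ?case using assms by simp
  next
    case (Suc j)
    have "a (Suc j) \<le> ?x * a j + c / real N" using step[of j] Suc.prems by simp
    also have "\<dots> \<le> ?x * (real j / real N * c * ?x ^ j) + c / real N"
      using Suc x by (intro add_right_mono mult_left_mono) auto
    also have "\<dots> \<le> ?x * (real j / real N * c * ?x ^ j) + c / real N * ?x ^ Suc j"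
      using \<open>0 \<le> c\<close> mult_left_mono[OF one_le_power[OF x, of "Suc j"], of "c / real N"] by simp
    also have "\<dots> = real (Suc j) / real N * c * ?x ^ Suc j"
      by (simp add: algebra_simps add_divide_distrib)
    finally show ?case .
  qed
  then have "a j \<le> real j / real N * c * ?x ^ j" using \<open>j \<le> N\<close> by blast
  also have "\<dots> \<le> 1 * c * ?x ^ N"
    using assms False x by (intro mult_mono power_increasing) (auto simp: divide_simps)
  also have "?x ^ N \<le> exp (b / real N) ^ N"
    using x by (intro power_mono exp_ge_add_one_self) auto
  also have "exp (b / real N) ^ N = exp b"
    using False by (simp flip: exp_of_nat_mult)
  finally show ?thesis using \<open>0 \<le> c\<close> by (simp add: mult_left_mono)
qed

text \<open>Uniform continuity of \<open>f'\<close> on the compact set makes one radius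
  \<open>\<theta>\<close> serve all points; convexity keeps the segments inside
  \<open>K\<close>.\<close>

lemma uniform_linearization:
  fixes f :: "'a::euclidean_space \<Rightarrow> 'b::real_normed_vector"
  assumes "compact K" "convex K"
    and der: "\<And>z. z \<in> K \<Longrightarrow> (f has_derivative blinfun_apply (f' z)) (at z)"
    and cont: "continuous_on K f'" and "0 < \<epsilon>"
  obtains \<theta> where "0 < \<theta>"
    "\<And>z z'. z \<in> K \<Longrightarrow> z' \<in> K \<Longrightarrow> norm (z' - z) < \<theta> \<Longrightarrow>
      norm (f z' - f z - f' z (z' - z)) \<le> \<epsilon> * norm (z' - z)"
proof -
  have "uniformly_continuous_on K f'"
    by (rule compact_uniformly_continuous[OF cont \<open>compact K\<close>])
  then obtain \<theta> where \<theta>: "0 < \<theta>" "\<And>z z'. z \<in> K \<Longrightarrow> z' \<in> K \<Longrightarrow> dist z' z < \<theta> \<Longrightarrow> dist (f' z') (f' z) < \<epsilon>"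
    using \<open>0 < \<epsilon>\<close> unfolding uniformly_continuous_on_def by metis
  show thesis
  proof
    fix z z' assume z: "z \<in> K" "z' \<in> K" "norm (z' - z) < \<theta>"
    let ?C = "closed_segment z z'"
    have sub: "?C \<subseteq> K" using z \<open>convex K\<close> closed_segment_subset by blast
    have "norm (f z' - f z - f' z (z' - z)) \<le> norm (z' - z) * \<epsilon>"
    proof (rule differentiable_bound_linearization[where f' = "\<lambda>z. blinfun_apply (f' z)" and S = ?C])
      show "z + t *\<^sub>R (z' - z) \<in> ?C" if "t \<in> {0..1}" for t
        using that by (auto simp: closed_segment_def algebra_simps intro!: exI[of _ t])
      show "(f has_derivative blinfun_apply (f' w)) (at w within ?C)" if "w \<in> ?C" for w
        using sub that der has_derivative_at_withinI by blast
      show "onorm (blinfun_apply (f' w) - blinfun_apply (f' z)) \<le> \<epsilon>" if "w \<in> ?C" for w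
      proof -
        have "norm (w - z) \<le> norm (z' - z)"
          using segment_bound1[OF that] .
        then have "dist (f' w) (f' z) < \<epsilon>"
          using \<theta>(2)[of z w] z sub that by (auto simp: dist_norm)
        then show ?thesis
          by (simp add: dist_norm norm_blinfun.rep_eq minus_blinfun.rep_eq fun_diff_def less_imp_le)
      qed
    qed simp
    then show "norm (f z' - f z - f' z (z' - z)) \<le> \<epsilon> * norm (z' - z)"
      by (simp add: mult.commute)
  qed (fact \<theta>(1))
qed

text \<open>The commutator terms combine to the exterior derivative of \<open>A\<close>; all others are of second order.\<close>

lemma euler_step_estimate:
  fixes a0 a1 a2 :: "'a::real_normed_vector \<Rightarrow>\<^sub>L 'a" and DA :: "'a \<Rightarrow>\<^sub>L 'a \<Rightarrow>\<^sub>L 'a"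
  assumes T: "a0 T = \<xi>" "a2 T' = \<xi> + h"
    and T_le: "norm T \<le> B" "norm T' \<le> B" and "0 \<le> \<eta>" "0 \<le> \<epsilon>" "0 \<le> \<Lambda>"
    and r1: "norm (a1 - a0 - DA (\<eta> *\<^sub>R T)) \<le> \<epsilon> * norm (\<eta> *\<^sub>R T)"
    and r2: "norm (a2 - a0 - DA \<Delta>) \<le> \<epsilon> * norm \<Delta>"
    and lip: "norm (a1 - a0) \<le> \<Lambda> * norm (\<eta> *\<^sub>R T)" "norm DA \<le> \<Lambda>"
  shows "norm (a1 (\<Delta> + \<eta> *\<^sub>R (T' - T)) - (s + \<eta> *\<^sub>R h) - (a0 \<Delta> - s))
     \<le> \<eta> * (norm (DA T \<Delta> - DA \<Delta> T) + 2 * B * \<epsilon> * norm \<Delta> + \<Lambda> * (norm \<Delta> + \<eta> * B) * norm (T' - T))"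
proof -
  define W where "W = T' - T"
  define R1 where "R1 = a1 - a0 - DA (\<eta> *\<^sub>R T)"
  define R2 where "R2 = a2 - a0 - DA \<Delta>"
  have a1: "a1 = a0 + \<eta> *\<^sub>R DA T + R1" by (simp add: R1_def blinfun.scaleR_right)
  have a2: "a2 = a0 + DA \<Delta> + R2" by (simp add: R2_def)
  have 0: "a0 T' = \<xi> + h - DA \<Delta> T' - R2 T'"
    using T(2) by (simp add: a2 blinfun.add_left algebra_simps)
  \<comment> \<open>The equation for \<open>T'\<close> holds at the other polygon; linearising
    \<open>a2\<close> around \<open>a0\<close> moves it to the base point. The term
    \<open>DA \<Delta> T'\<close> that appears is what pairs with \<open>DA T \<Delta>\<close>, the
    change of \<open>a0\<close> along the step, to form the commutator.\<close>
  have a0W: "a0 W = h - DA \<Delta> T' - R2 T'"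
    using T(1) 0 by (simp add: W_def blinfun.diff_right)
  have T': "T' = T + W" by (simp add: W_def)
  have "a1 (\<Delta> + \<eta> *\<^sub>R W) - (s + \<eta> *\<^sub>R h) - (a0 \<Delta> - s)
      = (a1 - a0) \<Delta> + \<eta> *\<^sub>R ((a1 - a0) W + a0 W - h)"
    by (simp add: blinfun.add_right blinfun.diff_left blinfun.scaleR_right algebra_simps)
  also have "\<dots> = \<eta> *\<^sub>R (DA T \<Delta> - DA \<Delta> T) + R1 \<Delta> + \<eta> *\<^sub>R ((a1 - a0) W - DA \<Delta> W - R2 T')"
    unfolding a0W by (simp add: a1 T' blinfun.add_left blinfun.add_right blinfun.scaleR_left algebra_simps)
  finally have eq: "a1 (\<Delta> + \<eta> *\<^sub>R W) - (s + \<eta> *\<^sub>R h) - (a0 \<Delta> - s)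
      = \<eta> *\<^sub>R (DA T \<Delta> - DA \<Delta> T) + R1 \<Delta> + \<eta> *\<^sub>R ((a1 - a0) W - DA \<Delta> W - R2 T')" .
  have \<eta>T: "norm (\<eta> *\<^sub>R T) \<le> \<eta> * B"
    using T_le \<open>0 \<le> \<eta>\<close> by (simp add: mult_left_mono)
  have "norm R1 \<le> \<epsilon> * (\<eta> * B)"
    using r1 mult_left_mono[OF \<eta>T \<open>0 \<le> \<epsilon>\<close>] unfolding R1_def by linarith
  then have 1: "norm (R1 \<Delta>) \<le> \<epsilon> * (\<eta> * B) * norm \<Delta>" by (rule norm_blinfun_apply_le) simp
  have "norm (a1 - a0) \<le> \<Lambda> * (\<eta> * B)"
    using lip(1) mult_left_mono[OF \<eta>T \<open>0 \<le> \<Lambda>\<close>] by linarith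
  then have 2: "norm ((a1 - a0) W) \<le> \<Lambda> * (\<eta> * B) * norm W" by (rule norm_blinfun_apply_le) simp
  have "norm (DA \<Delta>) \<le> \<Lambda> * norm \<Delta>" by (rule norm_blinfun_apply_le[OF lip(2)]) simp
  then have 3: "norm (DA \<Delta> W) \<le> \<Lambda> * norm \<Delta> * norm W" by (rule norm_blinfun_apply_le) simp
  have 4: "norm (R2 T') \<le> \<epsilon> * norm \<Delta> * B"
    by (rule norm_blinfun_apply_le[OF _ T_le(2)]) (use r2 in \<open>simp add: R2_def\<close>)
  have "norm ((a1 - a0) W - DA \<Delta> W - R2 T') \<le> \<Lambda> * (\<eta> * B) * norm W + \<Lambda> * norm \<Delta> * norm W + \<epsilon> * norm \<Delta> * B"
    using 2 3 4 norm_triangle_ineq4[of "(a1 - a0) W - DA \<Delta> W" "R2 T'"]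
      norm_triangle_ineq4[of "(a1 - a0) W" "DA \<Delta> W"] by linarith
  then have 5: "norm (\<eta> *\<^sub>R ((a1 - a0) W - DA \<Delta> W - R2 T')) \<le>
      \<eta> * (\<Lambda> * (\<eta> * B) * norm W + \<Lambda> * norm \<Delta> * norm W + \<epsilon> * norm \<Delta> * B)"
    using \<open>0 \<le> \<eta>\<close> by (simp add: mult_left_mono)
  have 6: "norm (\<eta> *\<^sub>R (DA T \<Delta> - DA \<Delta> T)) = \<eta> * norm (DA T \<Delta> - DA \<Delta> T)"
    using \<open>0 \<le> \<eta>\<close> by simp
  have "norm (a1 (\<Delta> + \<eta> *\<^sub>R W) - (s + \<eta> *\<^sub>R h) - (a0 \<Delta> - s)) \<le>
     \<eta> * norm (DA T \<Delta> - DA \<Delta> T) + \<epsilon> * (\<eta> * B) * norm \<Delta> +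
     \<eta> * (\<Lambda> * (\<eta> * B) * norm W + \<Lambda> * norm \<Delta> * norm W + \<epsilon> * norm \<Delta> * B)"
    unfolding eq using 1 5 6
      norm_triangle_ineq[of "\<eta> *\<^sub>R (DA T \<Delta> - DA \<Delta> T) + R1 \<Delta>" "\<eta> *\<^sub>R ((a1 - a0) W - DA \<Delta> W - R2 T')"]
      norm_triangle_ineq[of "\<eta> *\<^sub>R (DA T \<Delta> - DA \<Delta> T)" "R1 \<Delta>"] by linarith
  also have "\<dots> = \<eta> * (norm (DA T \<Delta> - DA \<Delta> T) + 2 * B * \<epsilon> * norm \<Delta> + \<Lambda> * (norm \<Delta> + \<eta> * B) * norm W)"
    by (simp add: algebra_simps)
  finally show ?thesis unfolding W_def .
qed

text \<open>\<open>G \<xi>\<close> is the end of an Euler polygon with \<open>N\<close> steps. The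
  strict inequality for \<open>\<tau>\<close> leaves a slack \<open>\<kappa>\<close>, which pays for
  all discretisation errors: \<open>\<epsilon>\<close>, \<open>d\<close> and \<open>N\<close> are
  chosen to use a third of it each. Since \<open>d\<close> depends on the modulus of continuity of
  \<open>DA\<close>, the estimate is local in \<open>\<xi>' - \<xi>\<close>.\<close>

lemma approximate_integral_section:
  fixes A :: "'a::euclidean_space \<Rightarrow> 'a \<Rightarrow>\<^sub>L 'a"
  assumes near: "\<And>z. z \<in> cball p \<rho> \<Longrightarrow> norm (A z - id_blinfun) \<le> 1/2"
    and der: "\<And>z. z \<in> cball p \<rho> \<Longrightarrow> (A has_derivative blinfun_apply (DA z)) (at z)"
    and cont: "continuous_on (cball p \<rho>) (DA :: 'a \<Rightarrow> 'a \<Rightarrow>\<^sub>L 'a \<Rightarrow>\<^sub>L 'a)"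
    and L: "subspace L"
    and P: "linear P" "\<And>v. v \<in> L \<Longrightarrow> P v = v" "\<And>z v. z \<in> cball p \<rho> \<Longrightarrow> P (A z v) = P v"
    and M: "\<And>z u v. z \<in> cball p \<rho> \<Longrightarrow> norm (DA z u v - DA z v u) \<le> M * norm u * norm v"
    and S: "\<And>z u v. z \<in> cball p \<rho> \<Longrightarrow> A z u \<in> L \<Longrightarrow> A z v \<in> L \<Longrightarrow>
        norm (DA z u v - DA z v u) \<le> S * norm u * norm v"
    and nn: "0 \<le> M" "0 \<le> S" and \<delta>: "0 < \<delta>" "2 * \<delta> \<le> \<rho>"
    and \<tau>: "4 * \<delta> * S * exp (4 * \<delta> * M) < \<tau>"
  shows "\<exists>G d. 0 < d \<and> G 0 = p \<and>
    (\<forall>\<xi>\<in>L \<inter> cball 0 \<delta>. G \<xi> \<in> cball p (2 * \<delta>) \<and> P (G \<xi> - p) = \<xi>) \<and>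
    (\<forall>\<xi>\<in>L \<inter> cball 0 \<delta>. \<forall>\<xi>'\<in>L \<inter> cball 0 \<delta>. norm (\<xi>' - \<xi>) \<le> d \<longrightarrow>
      norm (A (G \<xi>) (G \<xi>' - G \<xi>) - (\<xi>' - \<xi>)) \<le> \<tau> * norm (\<xi>' - \<xi>))"
proof -
  let ?K = "cball p \<rho>"
  have "bounded (DA ` ?K)"
    by (intro compact_imp_bounded compact_continuous_image cont compact_cball)
  then obtain \<Lambda> where "0 < \<Lambda>" and \<Lambda>: "\<And>z. z \<in> ?K \<Longrightarrow> norm (DA z) \<le> \<Lambda>"
    unfolding bounded_pos by auto
  have lip: "norm (A z' - A z) \<le> \<Lambda> * norm (z' - z)" if "z \<in> ?K" "z' \<in> ?K" for z z'
    by (rule differentiable_bound[OF convex_cball, where f' = "\<lambda>z. blinfun_apply (DA z)"])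
      (use der that \<Lambda> in \<open>auto simp: norm_blinfun.rep_eq[symmetric] intro: has_derivative_at_withinI\<close>)
  \<comment> \<open>\<open>C1\<close> and \<open>C2\<close> bound the differences of positions and
    of velocities of two polygons in units of \<open>norm h\<close>.\<close>
  define C1 where "C1 = 2 * exp (4 * \<Lambda> * \<delta>)"
  define C2 where "C2 = 2 + 4 * \<Lambda> * \<delta> * C1"
  define \<kappa> where "\<kappa> = \<tau> * exp (- (4 * \<delta> * M)) - 4 * \<delta> * S"
  have C: "0 < C1" "0 < C2"
    using \<open>0 < \<Lambda>\<close> \<delta>(1) by (auto simp: C1_def C2_def intro!: add_pos_nonneg)
  have "0 < \<kappa>"
  proof -
    have "4 * \<delta> * S * exp (4 * \<delta> * M) * exp (- (4 * \<delta> * M)) < \<tau> * exp (- (4 * \<delta> * M))"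
      by (rule mult_strict_right_mono[OF \<tau>]) simp
    then show ?thesis by (simp add: \<kappa>_def mult.assoc flip: exp_add)
  qed
  have \<tau>_eq: "(4 * \<delta> * S + \<kappa>) * exp (4 * \<delta> * M) = \<tau>"
    by (simp add: \<kappa>_def mult.assoc flip: exp_add)
  \<comment> \<open>Makes the linearisation error \<open>4 * \<delta> * \<epsilon> * C1\<close>
    equal to \<open>\<kappa> / 3\<close>.\<close>
  define \<epsilon> where "\<epsilon> = \<kappa> / (12 * \<delta> * C1)"
  have "0 < \<epsilon>" using \<open>0 < \<kappa>\<close> \<delta> C by (simp add: \<epsilon>_def)
  obtain \<theta> where \<theta>: "0 < \<theta>"
    "\<And>z z'. z \<in> ?K \<Longrightarrow> z' \<in> ?K \<Longrightarrow> norm (z' - z) < \<theta> \<Longrightarrow>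
      norm (A z' - A z - DA z (z' - z)) \<le> \<epsilon> * norm (z' - z)"
    using uniform_linearization[OF compact_cball convex_cball der cont \<open>0 < \<epsilon>\<close>] by blast
  \<comment> \<open>The first bound keeps the polygons closer than \<open>\<theta>\<close>; the
    second keeps the error quadratic in \<open>h\<close> below \<open>\<kappa> / 3\<close>.\<close>
  define d where "d = min (\<theta> / (2 * C1)) (\<kappa> / (3 * \<Lambda> * C2 * C1))"
  have "0 < d" using \<theta>(1) C \<open>0 < \<kappa>\<close> \<open>0 < \<Lambda>\<close> by (simp add: d_def)
  \<comment> \<open>So many steps that one step is shorter than \<open>\<theta>\<close> and the
    error due to the step length is at most \<open>\<kappa> / 3\<close>.\<close>
  obtain N :: nat where N: "max (2 * \<delta> / \<theta>) (6 * \<delta> * \<Lambda> * C2 / \<kappa>) < real N"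
    using reals_Archimedean2 by blast
  have "0 < 2 * \<delta> / \<theta>" using \<delta> \<theta>(1) by simp
  then have "0 < N" using N by (simp add: max_less_iff_conj del: divide_less_eq)
  have N1: "2 * \<delta> / N < \<theta>" and N2: "\<Lambda> * C2 * (2 * \<delta> / N) \<le> \<kappa> / 3"
    using N \<open>0 < N\<close> \<theta>(1) \<open>0 < \<kappa>\<close> by (auto simp: divide_simps mult_ac)
  define T where "T = (\<lambda>\<xi> z. blinfun_inv (A z) \<xi>)"
  define g where "g = (\<lambda>\<xi> j. ((\<lambda>z. z + (1 / real N) *\<^sub>R T \<xi> z) ^^ j) p)"
  have g0: "g \<xi> 0 = p" and gSuc: "g \<xi> (Suc j) = g \<xi> j + (1 / real N) *\<^sub>R T \<xi> (g \<xi> j)" for \<xi> j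
    by (simp_all add: g_def)
  have T_le: "norm (T \<xi> z) \<le> 2 * \<delta>" if "z \<in> ?K" "norm \<xi> \<le> \<delta>" for \<xi> z
    using near_id_inv_bound[OF near[OF that(1)], of \<xi>] that(2) by (simp add: T_def)
  have AT: "A z (T \<xi> z) = \<xi>" if "z \<in> ?K" for \<xi> z
    unfolding T_def by (rule near_id_inv(2)[OF near[OF that]])
  have g_near: "norm (g \<xi> j - p) \<le> real j * (2 * \<delta> / N)" if "norm \<xi> \<le> \<delta>" "j \<le> N" for \<xi> j
    using that
  proof (induction j)
    case 0
    then show ?case by (simp add: g0)
  next
    case (Suc j)
    have "real j * (2 * \<delta> / N) \<le> real N * (2 * \<delta> / N)"
      using Suc.prems \<delta> by (intro mult_right_mono) auto
    then have "g \<xi> j \<in> ?K"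
      using Suc \<open>0 < N\<close> \<delta> by (auto simp: dist_norm norm_minus_commute)
    then have "norm ((1 / real N) *\<^sub>R T \<xi> (g \<xi> j)) \<le> 2 * \<delta> / N"
      using T_le[OF _ Suc.prems(1)] \<open>0 < N\<close> by (simp add: divide_right_mono)
    then have "norm (g \<xi> j - p + (1 / real N) *\<^sub>R T \<xi> (g \<xi> j)) \<le> real j * (2 * \<delta> / N) + 2 * \<delta> / N"
      using Suc by (intro norm_triangle_le add_mono) auto
    then show ?case by (simp add: gSuc algebra_simps add_divide_distrib)
  qed
  have g_in: "g \<xi> j \<in> cball p (2 * \<delta>)" if "norm \<xi> \<le> \<delta>" "j \<le> N" for \<xi> j
  proof -
    have "real j * (2 * \<delta> / N) \<le> real N * (2 * \<delta> / N)"
      using that \<delta> by (intro mult_right_mono) auto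
    then show ?thesis using g_near[OF that] \<open>0 < N\<close> by (auto simp: dist_norm norm_minus_commute)
  qed
  have g_K: "g \<xi> j \<in> ?K" if "norm \<xi> \<le> \<delta>" "j \<le> N" for \<xi> j
    using g_in[OF that] \<delta> by auto
  \<comment> \<open>\<open>P\<close> does not see the difference between \<open>A z\<close> and the
    identity, so each step adds \<open>\<xi> / N\<close> to the projection.\<close>
  have Pg: "P (g \<xi> j - p) = (real j / N) *\<^sub>R \<xi>" if "\<xi> \<in> L" "norm \<xi> \<le> \<delta>" "j \<le> N" for \<xi> j
    using that
  proof (induction j)
    case 0
    then show ?case by (simp add: g0 linear_0[OF P(1)])
  next
    case (Suc j)
    have K: "g \<xi> j \<in> ?K" using Suc.prems by (intro g_K) auto
    have "P (T \<xi> (g \<xi> j)) = \<xi>"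
      using P(3)[OF K, of "T \<xi> (g \<xi> j)"] AT[OF K] P(2) Suc.prems by simp
    moreover have e: "g \<xi> (Suc j) - p = (g \<xi> j - p) + (1 / real N) *\<^sub>R T \<xi> (g \<xi> j)"
      by (simp add: gSuc)
    ultimately have "P (g \<xi> (Suc j) - p) = (real j / N) *\<^sub>R \<xi> + (1 / real N) *\<^sub>R \<xi>"
      using Suc unfolding e linear_add[OF P(1)] linear_scale[OF P(1)] by simp
    then show ?case by (simp add: add_divide_distrib scaleR_add_left)
  qed
  have g_zero: "g 0 j = p" for j
    by (induction j) (simp_all add: g0 gSuc T_def)
  have main: "norm (A (g \<xi> N) (g (\<xi> + h) N - g \<xi> N) - h) \<le> \<tau> * norm h"
    if \<xi>: "\<xi> \<in> L" "norm \<xi> \<le> \<delta>" and h: "h \<in> L" "norm (\<xi> + h) \<le> \<delta>" "norm h \<le> d" for \<xi> h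
  proof -
    define \<Delta> where "\<Delta> = (\<lambda>j. g (\<xi> + h) j - g \<xi> j)"
    define W where "W = (\<lambda>j. T (\<xi> + h) (g (\<xi> + h) j) - T \<xi> (g \<xi> j))"
    \<comment> \<open>The deviation from the ideal, in which after \<open>j\<close> steps
      \<open>A\<close> maps the difference of the polygons to the fraction \<open>j / N\<close> of
      \<open>h\<close>.\<close>
    define Q where "Q = (\<lambda>j. A (g \<xi> j) (\<Delta> j) - (real j / N) *\<^sub>R h)"
    have \<Delta>Suc: "\<Delta> (Suc j) = \<Delta> j + (1 / real N) *\<^sub>R W j" for j
      by (simp add: \<Delta>_def W_def gSuc algebra_simps)
    have K: "g \<xi> j \<in> ?K" "g (\<xi> + h) j \<in> ?K" if "j \<le> N" for j
      using g_K[OF \<xi>(2) that] g_K[OF h(2) that] .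
    have W_le: "norm (W j) \<le> 2 * norm h + 4 * \<Lambda> * \<delta> * norm (\<Delta> j)" if "j \<le> N" for j
    proof -
      have "W j = blinfun_inv (A (g (\<xi> + h) j)) h
          + (blinfun_inv (A (g (\<xi> + h) j)) - blinfun_inv (A (g \<xi> j))) \<xi>"
        by (simp add: W_def T_def blinfun.add_right blinfun.diff_left)
      also have "norm \<dots> \<le> 2 * norm h + 4 * \<Lambda> * norm (\<Delta> j) * \<delta>"
      proof (intro norm_triangle_le add_mono near_id_inv_bound near K that norm_blinfun_apply_le \<xi>)
        show "norm (blinfun_inv (A (g (\<xi> + h) j)) - blinfun_inv (A (g \<xi> j))) \<le> 4 * \<Lambda> * norm (\<Delta> j)"
          using near_id_inv_diff[OF near[OF K(2)[OF that]] near[OF K(1)[OF that]]]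
            lip[OF K[OF that]] by (simp add: \<Delta>_def)
      qed
      finally show ?thesis by (simp add: mult_ac)
    qed
    have \<Delta>_le: "norm (\<Delta> j) \<le> C1 * norm h" if "j \<le> N" for j
    proof -
      have "norm (\<Delta> j) \<le> (2 * norm h) * exp (4 * \<Lambda> * \<delta>)"
      proof (rule discrete_gronwall[where N = N])
        show "norm (\<Delta> 0) = 0" by (simp add: \<Delta>_def g0)
        fix j assume "j < N"
        have "norm (\<Delta> (Suc j)) \<le> norm (\<Delta> j) + norm (W j) / N"
          unfolding \<Delta>Suc using norm_triangle_ineq[of "\<Delta> j" "(1 / real N) *\<^sub>R W j"] by simp
        also have "\<dots> \<le> norm (\<Delta> j) + (2 * norm h + 4 * \<Lambda> * \<delta> * norm (\<Delta> j)) / N"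
          using W_le[of j] \<open>j < N\<close> by (intro add_left_mono divide_right_mono) auto
        also have "\<dots> = (1 + 4 * \<Lambda> * \<delta> / real N) * norm (\<Delta> j) + 2 * norm h / real N"
          by (simp add: algebra_simps add_divide_distrib)
        finally show "norm (\<Delta> (Suc j)) \<le> (1 + 4 * \<Lambda> * \<delta> / real N) * norm (\<Delta> j) + 2 * norm h / real N" .
      qed (use \<open>0 < \<Lambda>\<close> \<delta> that in auto)
      then show ?thesis by (simp add: C1_def mult_ac)
    qed
    have W_le': "norm (W j) \<le> C2 * norm h" if "j \<le> N" for j
    proof -
      have "4 * \<Lambda> * \<delta> * norm (\<Delta> j) \<le> 4 * \<Lambda> * \<delta> * (C1 * norm h)"
        using \<open>0 < \<Lambda>\<close> \<delta> by (intro mult_left_mono \<Delta>_le that) auto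
      then show ?thesis using W_le[OF that] by (simp add: C2_def algebra_simps)
    qed
    have C1h: "C1 * norm h < \<theta>" "\<Lambda> * C2 * (C1 * norm h) \<le> \<kappa> / 3"
    proof -
      have "C1 * norm h \<le> C1 * (\<theta> / (2 * C1))"
        using h(3) C by (intro mult_left_mono) (auto simp: d_def)
      also have "\<dots> < \<theta>" using C \<theta>(1) by simp
      finally show "C1 * norm h < \<theta>" .
      have "\<Lambda> * C2 * (C1 * norm h) \<le> \<Lambda> * C2 * (C1 * (\<kappa> / (3 * \<Lambda> * C2 * C1)))"
        using h(3) C \<open>0 < \<Lambda>\<close> by (intro mult_left_mono) (auto simp: d_def)
      also have "\<dots> = \<kappa> / 3" using C \<open>0 < \<Lambda>\<close> by simp
      finally show "\<Lambda> * C2 * (C1 * norm h) \<le> \<kappa> / 3" .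
    qed
    have "norm (Q N) \<le> ((4 * \<delta> * S + \<kappa>) * norm h) * exp (4 * \<delta> * M)"
    proof (rule discrete_gronwall[where N = N])
      show "norm (Q 0) = 0" by (simp add: Q_def \<Delta>_def g0)
      show "0 \<le> (4 * \<delta> * S + \<kappa>) * norm h"
        using nn \<delta> \<open>0 < \<kappa>\<close> by simp
      fix j assume "j < N"
      then have j: "j \<le> N" "Suc j \<le> N" by auto
      let ?T = "T \<xi> (g \<xi> j)" and ?\<eta> = "1 / real N"
      let ?s = "(real j / N) *\<^sub>R h"
      have diff: "g \<xi> (Suc j) - g \<xi> j = ?\<eta> *\<^sub>R ?T" by (simp add: gSuc)
      have T2: "norm ?T \<le> 2 * \<delta>" by (intro T_le K j \<xi>)
      have small: "norm (?\<eta> *\<^sub>R ?T) < \<theta>"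
      proof -
        have "norm (?\<eta> *\<^sub>R ?T) \<le> 2 * \<delta> / N" using T2 by (simp add: divide_right_mono)
        then show ?thesis using N1 by simp
      qed
      have \<Delta>_small: "norm (\<Delta> j) < \<theta>" using \<Delta>_le[OF j(1)] C1h(1) by simp
      have s_eq: "?s + ?\<eta> *\<^sub>R h = (real (Suc j) / N) *\<^sub>R h"
        by (simp add: add_divide_distrib scaleR_add_left)
      have "norm (Q (Suc j) - Q j) =
          norm (A (g \<xi> (Suc j)) (\<Delta> j + ?\<eta> *\<^sub>R W j) - (?s + ?\<eta> *\<^sub>R h) - (A (g \<xi> j) (\<Delta> j) - ?s))"
        unfolding Q_def \<Delta>Suc s_eq ..
      also have "\<dots> \<le> ?\<eta> * (norm (DA (g \<xi> j) ?T (\<Delta> j) - DA (g \<xi> j) (\<Delta> j) ?T)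
          + 2 * (2 * \<delta>) * \<epsilon> * norm (\<Delta> j) + \<Lambda> * (norm (\<Delta> j) + ?\<eta> * (2 * \<delta>)) * norm (W j))"
        unfolding W_def
      proof (rule euler_step_estimate[where \<xi> = \<xi> and ?a2.0 = "A (g (\<xi> + h) j)"])
        show "A (g \<xi> j) ?T = \<xi>" "A (g (\<xi> + h) j) (T (\<xi> + h) (g (\<xi> + h) j)) = \<xi> + h"
          by (intro AT K j)+
        show "norm ?T \<le> 2 * \<delta>" "norm (T (\<xi> + h) (g (\<xi> + h) j)) \<le> 2 * \<delta>"
          by (intro T_le K j \<xi> h)+
        show "norm (A (g \<xi> (Suc j)) - A (g \<xi> j) - DA (g \<xi> j) (?\<eta> *\<^sub>R ?T)) \<le> \<epsilon> * norm (?\<eta> *\<^sub>R ?T)"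
          using \<theta>(2)[OF K(1)[OF j(1)] K(1)[OF j(2)]] small unfolding diff by blast
        show "norm (A (g (\<xi> + h) j) - A (g \<xi> j) - DA (g \<xi> j) (\<Delta> j)) \<le> \<epsilon> * norm (\<Delta> j)"
          using \<theta>(2)[OF K(1)[OF j(1)] K(2)[OF j(1)]] \<Delta>_small unfolding \<Delta>_def by blast
        show "norm (A (g \<xi> (Suc j)) - A (g \<xi> j)) \<le> \<Lambda> * norm (?\<eta> *\<^sub>R ?T)"
          using lip[OF K(1)[OF j(1)] K(1)[OF j(2)]] unfolding diff .
        show "norm (DA (g \<xi> j)) \<le> \<Lambda>" by (intro \<Lambda> K j)
      qed (use \<open>0 < \<epsilon>\<close> \<open>0 < \<Lambda>\<close> in auto)
      finally have step: "norm (Q (Suc j) - Q j) \<le> \<dots>" .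
      \<comment> \<open>\<open>\<Delta> j\<close> splits into the preimages under \<open>A\<close>
        of \<open>?s\<close>, which lies in \<open>L\<close>, and of \<open>Q j\<close>. The first
        part meets the small bound \<open>S\<close>, since \<open>A\<close> also maps
        \<open>?T\<close> to \<open>\<xi> \<in> L\<close>; only the second meets the large bound
        \<open>M\<close>.\<close>
      have curv: "norm (DA (g \<xi> j) ?T (\<Delta> j) - DA (g \<xi> j) (\<Delta> j) ?T)
          \<le> 4 * \<delta> * S * norm h + 4 * \<delta> * M * norm (Q j)"
      proof -
        let ?D = "DA (g \<xi> j)" and ?B = "blinfun_inv (A (g \<xi> j))"
        have near': "norm (A (g \<xi> j) - id_blinfun) \<le> 1/2" by (intro near K j)
        have \<Delta>_eq: "\<Delta> j = ?B ?s + ?B (Q j)"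
          by (simp add: Q_def blinfun.diff_right near_id_inv[OF near'])
        have sL: "?s \<in> L" using subspace_scale[OF L h(1)] .
        have s_le: "norm ?s \<le> norm h" using j \<open>0 < N\<close> by (simp add: divide_simps mult.commute[of "norm h"] mult_right_mono)
        have 1: "norm (?D ?T (?B ?s) - ?D (?B ?s) ?T) \<le> S * norm ?T * norm (?B ?s)"
          using sL \<xi>(1) by (intro S K j) (simp_all add: near_id_inv[OF near'] AT[OF K(1)[OF j(1)]])
        have 2: "norm (?D ?T (?B (Q j)) - ?D (?B (Q j)) ?T) \<le> M * norm ?T * norm (?B (Q j))"
          by (intro M K j)
        have 3: "S * norm ?T * norm (?B ?s) \<le> S * (2 * \<delta>) * (2 * norm h)"
          using near_id_inv_bound[OF near', of ?s] s_le nn T2 \<delta>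
          by (intro mult_mono mult_left_mono) auto
        have 4: "M * norm ?T * norm (?B (Q j)) \<le> M * (2 * \<delta>) * (2 * norm (Q j))"
          using near_id_inv_bound[OF near', of "Q j"] nn T2 \<delta>
          by (intro mult_mono mult_left_mono) auto
        have 5: "?D ?T (\<Delta> j) - ?D (\<Delta> j) ?T =
            (?D ?T (?B ?s) - ?D (?B ?s) ?T) + (?D ?T (?B (Q j)) - ?D (?B (Q j)) ?T)"
          unfolding \<Delta>_eq by (simp add: blinfun.add_right blinfun.add_left)
        have "norm (?D ?T (\<Delta> j) - ?D (\<Delta> j) ?T) \<le> S * (2 * \<delta>) * (2 * norm h) + M * (2 * \<delta>) * (2 * norm (Q j))"
          unfolding 5 using 1 2 3 4 norm_triangle_ineq[of "?D ?T (?B ?s) - ?D (?B ?s) ?T" "?D ?T (?B (Q j)) - ?D (?B (Q j)) ?T"]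
          by linarith
        then show ?thesis by (simp add: mult_ac)
      qed
      have e1: "2 * (2 * \<delta>) * \<epsilon> * norm (\<Delta> j) \<le> \<kappa> / 3 * norm h"
      proof -
        have "2 * (2 * \<delta>) * \<epsilon> * norm (\<Delta> j) \<le> 2 * (2 * \<delta>) * \<epsilon> * (C1 * norm h)"
          using \<delta> \<open>0 < \<epsilon>\<close> by (intro mult_left_mono \<Delta>_le j) auto
        also have "\<dots> = \<kappa> / 3 * norm h" using \<delta> C by (simp add: \<epsilon>_def)
        finally show ?thesis .
      qed
      \<comment> \<open>One third of \<open>\<kappa>\<close> for the quadratic term in
        \<open>h\<close>, one for the step length.\<close>
      have e2: "\<Lambda> * (norm (\<Delta> j) + ?\<eta> * (2 * \<delta>)) * norm (W j) \<le> 2 * \<kappa> / 3 * norm h"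
      proof -
        have "\<Lambda> * (norm (\<Delta> j) + ?\<eta> * (2 * \<delta>)) * norm (W j)
            \<le> \<Lambda> * (C1 * norm h + ?\<eta> * (2 * \<delta>)) * (C2 * norm h)"
          using \<open>0 < \<Lambda>\<close> \<delta> C by (intro mult_mono mult_left_mono add_right_mono \<Delta>_le W_le' j) auto
        also have "\<dots> = (\<Lambda> * C2 * (C1 * norm h) + \<Lambda> * C2 * (2 * \<delta> / N)) * norm h"
          by (simp add: algebra_simps)
        also have "\<dots> \<le> (\<kappa> / 3 + \<kappa> / 3) * norm h"
          by (intro mult_right_mono add_mono C1h N2) simp
        finally show ?thesis by simp
      qed
      have "norm (Q (Suc j) - Q j) \<le> ?\<eta> * ((4 * \<delta> * S + \<kappa>) * norm h + 4 * \<delta> * M * norm (Q j))"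
      proof (rule order_trans[OF step], rule mult_left_mono)
        have "(4 * \<delta> * S + \<kappa>) * norm h + 4 * \<delta> * M * norm (Q j) =
            (4 * \<delta> * S * norm h + 4 * \<delta> * M * norm (Q j)) + \<kappa> / 3 * norm h + 2 * \<kappa> / 3 * norm h"
          by (simp add: algebra_simps)
        then show "norm (DA (g \<xi> j) ?T (\<Delta> j) - DA (g \<xi> j) (\<Delta> j) ?T)
          + 2 * (2 * \<delta>) * \<epsilon> * norm (\<Delta> j) + \<Lambda> * (norm (\<Delta> j) + ?\<eta> * (2 * \<delta>)) * norm (W j)
          \<le> (4 * \<delta> * S + \<kappa>) * norm h + 4 * \<delta> * M * norm (Q j)"
          using curv e1 e2 by linarith
      qed simp
      then have "norm (Q (Suc j)) \<le> norm (Q j) + ?\<eta> * ((4 * \<delta> * S + \<kappa>) * norm h + 4 * \<delta> * M * norm (Q j))"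
        using norm_triangle_sub[of "Q (Suc j)" "Q j"] by linarith
      also have "\<dots> = (1 + 4 * \<delta> * M / real N) * norm (Q j) + (4 * \<delta> * S + \<kappa>) * norm h / real N"
        by (simp add: algebra_simps add_divide_distrib)
      finally show "norm (Q (Suc j)) \<le> (1 + 4 * \<delta> * M / real N) * norm (Q j) + (4 * \<delta> * S + \<kappa>) * norm h / real N" .
    qed (use nn \<delta> in auto)
    also have "\<dots> = \<tau> * norm h" using \<tau>_eq by (simp add: mult_ac)
    finally show ?thesis
      using \<open>0 < N\<close> by (simp add: Q_def \<Delta>_def)
  qed
  have "norm (A (g \<xi> N) (g \<xi>' N - g \<xi> N) - (\<xi>' - \<xi>)) \<le> \<tau> * norm (\<xi>' - \<xi>)"
    if "\<xi> \<in> L \<inter> cball 0 \<delta>" "\<xi>' \<in> L \<inter> cball 0 \<delta>" "norm (\<xi>' - \<xi>) \<le> d" for \<xi> \<xi>'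
    using main[of \<xi> "\<xi>' - \<xi>"] that L by (auto simp: subspace_diff)
  moreover have "g \<xi> N \<in> cball p (2 * \<delta>) \<and> P (g \<xi> N - p) = \<xi>" if "\<xi> \<in> L \<inter> cball 0 \<delta>" for \<xi>
    using g_in[of \<xi> N] Pg[of \<xi> N] that \<open>0 < N\<close> by auto
  ultimately show ?thesis
    using \<open>0 < d\<close> g_zero by (intro exI[of _ "\<lambda>\<xi>. g \<xi> N"] exI[of _ d]) blast
qed

section \<open>Limits of approximate integral sections\<close>

text \<open>Cutting the segment into steps no longer than \<open>d\<close> and telescoping removes
  the restriction to small increments; the variation of \<open>F\<close> around \<open>c\<close>
  enters only through \<open>\<omega>\<close>.\<close>

lemma linearization_chain:
  fixes G :: "'a::real_normed_vector \<Rightarrow> 'b::real_normed_vector" and F :: "'a \<Rightarrow> 'a \<Rightarrow>\<^sub>L 'b"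
  assumes "convex D" "0 < d" "\<xi> \<in> D" "\<xi>' \<in> D"
    and local: "\<And>\<zeta> \<zeta>'. \<zeta> \<in> D \<Longrightarrow> \<zeta>' \<in> D \<Longrightarrow> norm (\<zeta>' - \<zeta>) \<le> d \<Longrightarrow>
        norm (G \<zeta>' - G \<zeta> - F \<zeta> (\<zeta>' - \<zeta>)) \<le> \<sigma> * norm (\<zeta>' - \<zeta>)"
    and near: "\<And>\<zeta>. \<zeta> \<in> closed_segment \<xi> \<xi>' \<Longrightarrow> norm (F \<zeta> - c) \<le> \<omega>"
  shows "norm (G \<xi>' - G \<xi> - blinfun_apply c (\<xi>' - \<xi>)) \<le> (\<sigma> + \<omega>) * norm (\<xi>' - \<xi>)"
proof -
  obtain n :: nat where n: "norm (\<xi>' - \<xi>) / d < real n"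
    using reals_Archimedean2 by blast
  have "0 \<le> norm (\<xi>' - \<xi>) / d" using \<open>0 < d\<close> by simp
  with n have "0 < n" by (metis of_nat_0_less_iff order_le_less_trans)
  define h where "h = (1 / real n) *\<^sub>R (\<xi>' - \<xi>)"
  define \<zeta> where "\<zeta> = (\<lambda>i::nat. \<xi> + real i *\<^sub>R h)"
  have seg: "\<zeta> i \<in> closed_segment \<xi> \<xi>'" if "i \<le> n" for i
    unfolding closed_segment_def using that \<open>0 < n\<close>
    by (auto simp: \<zeta>_def h_def algebra_simps intro!: exI[of _ "real i / real n"])
  have D: "\<zeta> i \<in> D" if "i \<le> n" for i
    using seg[OF that] assms(1,3,4) closed_segment_subset by blast
  have \<zeta>: "\<zeta> (Suc i) - \<zeta> i = h" for i by (simp add: \<zeta>_def algebra_simps)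
  have h: "norm h \<le> d" using n \<open>0 < n\<close> \<open>0 < d\<close> by (simp add: h_def divide_simps mult.commute)
  have step: "norm (G (\<zeta> (Suc i)) - G (\<zeta> i) - c h) \<le> (\<sigma> + \<omega>) * norm h" if "i < n" for i
  proof -
    have "norm (G (\<zeta> (Suc i)) - G (\<zeta> i) - F (\<zeta> i) h) \<le> \<sigma> * norm h"
      using local[of "\<zeta> i" "\<zeta> (Suc i)"] D that h by (simp add: \<zeta>)
    moreover have "norm ((F (\<zeta> i) - c) h) \<le> \<omega> * norm h"
      using near seg that by (intro norm_blinfun_apply_le) auto
    ultimately have "norm ((G (\<zeta> (Suc i)) - G (\<zeta> i) - F (\<zeta> i) h) + (F (\<zeta> i) - c) h) \<le> \<sigma> * norm h + \<omega> * norm h"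
      by (intro norm_triangle_le add_mono)
    then show ?thesis by (simp add: blinfun.diff_left algebra_simps)
  qed
  have "norm (\<Sum>i<n. G (\<zeta> (Suc i)) - G (\<zeta> i) - c h) \<le> (\<Sum>i<n. (\<sigma> + \<omega>) * norm h)"
    using step by (intro sum_norm_le) auto
  moreover have "(\<Sum>i<n. G (\<zeta> (Suc i)) - G (\<zeta> i) - c h) = G (\<zeta> n) - G (\<zeta> 0) - real n *\<^sub>R c h"
    by (subst sum_subtractf) (simp only: sum_lessThan_telescope[of "\<lambda>i. G (\<zeta> i)"] sum_constant_scaleR card_lessThan)
  moreover have "\<zeta> n = \<xi>'" "\<zeta> 0 = \<xi>" "real n *\<^sub>R c h = c (\<xi>' - \<xi>)" "norm h = norm (\<xi>' - \<xi>) / n"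
    using \<open>0 < n\<close> by (simp_all add: \<zeta>_def h_def blinfun.scaleR_right)
  ultimately show ?thesis using \<open>0 < n\<close> by simp
qed

text \<open>The \<open>G k\<close> solve the equation \<open>DG = B(G)\<close> up to
  \<open>\<sigma> k\<close>, but only at scales \<open>d k\<close>, which may shrink with
  \<open>k\<close>. Chaining makes the estimates independent of \<open>d k\<close>; they then give
  equicontinuity and survive the limit of Arzela and Ascoli.\<close>

lemma approximate_sections_limit:
  fixes G :: "nat \<Rightarrow> 'a::euclidean_space \<Rightarrow> 'b::euclidean_space" and B :: "'b \<Rightarrow> 'a \<Rightarrow>\<^sub>L 'b"
  assumes "compact D" "convex D" "compact K" "continuous_on K B"
    and GK: "\<And>k \<xi>. \<xi> \<in> D \<Longrightarrow> G k \<xi> \<in> K"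
    and d: "\<And>k. 0 < d k" and \<sigma>: "\<sigma> \<longlonglongrightarrow> 0"
    and local: "\<And>k \<xi> \<xi>'. \<xi> \<in> D \<Longrightarrow> \<xi>' \<in> D \<Longrightarrow> norm (\<xi>' - \<xi>) \<le> d k \<Longrightarrow>
        norm (G k \<xi>' - G k \<xi> - B (G k \<xi>) (\<xi>' - \<xi>)) \<le> \<sigma> k * norm (\<xi>' - \<xi>)"
  obtains H r where "strict_mono (r :: nat \<Rightarrow> nat)" "\<And>\<xi>. \<xi> \<in> D \<Longrightarrow> (\<lambda>k. G (r k) \<xi>) \<longlonglongrightarrow> H \<xi>"
    "\<And>\<xi>. \<xi> \<in> D \<Longrightarrow> (H has_derivative blinfun_apply (B (H \<xi>))) (at \<xi> within D)"
proof -
  have "bounded (B ` K)"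
    by (intro compact_imp_bounded compact_continuous_image assms)
  then obtain b where b: "0 < b" "\<And>z. z \<in> K \<Longrightarrow> norm (B z) \<le> b"
    unfolding bounded_pos by auto
  have "Bseq \<sigma>" using \<sigma> by (intro convergent_imp_Bseq convergentI)
  then obtain s where s: "0 < s" "\<And>k. norm (\<sigma> k) \<le> s" unfolding Bseq_def by auto
  have chain: "norm (G k \<xi>' - G k \<xi> - c (\<xi>' - \<xi>)) \<le> (\<sigma> k + \<omega>) * norm (\<xi>' - \<xi>)"
    if "\<xi> \<in> D" "\<xi>' \<in> D" "\<And>\<zeta>. \<zeta> \<in> closed_segment \<xi> \<xi>' \<Longrightarrow> norm (B (G k \<zeta>) - c) \<le> \<omega>" for k \<xi> \<xi>' c \<omega>
    by (rule linearization_chain[OF \<open>convex D\<close> d that(1,2) local that(3)])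
  have seg: "\<zeta> \<in> D" if "\<zeta> \<in> closed_segment \<xi> \<xi>'" "\<xi> \<in> D" "\<xi>' \<in> D" for \<zeta> \<xi> \<xi>'
    using that \<open>convex D\<close> closed_segment_subset by blast
  \<comment> \<open>Comparison with the constant map \<open>c = 0\<close> yields a Lipschitz
    constant common to all \<open>k\<close>.\<close>
  have lip: "norm (G k \<xi>' - G k \<xi>) \<le> (s + b) * norm (\<xi>' - \<xi>)" if "\<xi> \<in> D" "\<xi>' \<in> D" for k \<xi> \<xi>'
  proof -
    have "norm (G k \<xi>' - G k \<xi> - (0 :: 'a \<Rightarrow>\<^sub>L 'b) (\<xi>' - \<xi>)) \<le> (\<sigma> k + b) * norm (\<xi>' - \<xi>)"
      using that seg[OF _ that] GK b by (intro chain) auto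
    also have "\<dots> \<le> (s + b) * norm (\<xi>' - \<xi>)"
      using s(2)[of k] by (intro mult_right_mono) auto
    finally show ?thesis by simp
  qed
  have "bounded K" by (rule compact_imp_bounded[OF \<open>compact K\<close>])
  then obtain R where R: "\<And>z. z \<in> K \<Longrightarrow> norm z \<le> R" unfolding bounded_iff by auto
  obtain H r where H: "continuous_on D H" "strict_mono (r :: nat \<Rightarrow> nat)"
    and unif: "\<And>e. 0 < e \<Longrightarrow> \<exists>N. \<forall>n x. n \<ge> N \<and> x \<in> D \<longrightarrow> norm (G (r n) x - H x) < e"
  proof (rule Arzela_Ascoli[OF \<open>compact D\<close>])
    show "norm (G n x) \<le> R" if "x \<in> D" for n x using R GK that by blast
    fix x e assume x: "x \<in> D" "0 < (e::real)"
    have "norm (G n x - G n y) < e" if y: "y \<in> D" "norm (x - y) < e / (s + b)" for n y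
    proof -
      have "norm (G n x - G n y) \<le> (s + b) * norm (x - y)" by (rule lip[OF y(1) x(1)])
      also have "\<dots> < (s + b) * (e / (s + b))"
        using s b y(2) by (intro mult_strict_left_mono) auto
      finally show ?thesis using s b by simp
    qed
    then show "\<exists>d>0. \<forall>n y. y \<in> D \<and> norm (x - y) < d \<longrightarrow> norm (G n x - G n y) < e"
      using x s b by (intro exI[of _ "e / (s + b)"]) auto
  qed blast
  have lim: "(\<lambda>k. G (r k) \<xi>) \<longlonglongrightarrow> H \<xi>" if "\<xi> \<in> D" for \<xi>
    unfolding LIMSEQ_def dist_norm using unif that by meson
  have HK: "H \<xi> \<in> K" if "\<xi> \<in> D" for \<xi>
    using closed_sequentially[OF compact_imp_closed[OF \<open>compact K\<close>] _ lim[OF that]] GK[OF that] by blast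
  have BH: "continuous_on D (\<lambda>\<xi>. B (H \<xi>))"
    by (rule continuous_on_compose2[OF \<open>continuous_on K B\<close> H(1)]) (use HK in auto)
  have B_unif: "uniformly_continuous_on K B"
    by (rule compact_uniformly_continuous[OF assms(4,3)])
  have der: "(H has_derivative blinfun_apply (B (H \<xi>))) (at \<xi> within D)" if \<xi>: "\<xi> \<in> D" for \<xi>
    unfolding has_derivative_within_alt
  proof (intro conjI allI impI)
    show "bounded_linear (blinfun_apply (B (H \<xi>)))" by (rule blinfun.bounded_linear_right)
    fix e :: real assume "0 < e"
    obtain d where d: "0 < d" "\<And>\<zeta>. \<zeta> \<in> D \<Longrightarrow> dist \<zeta> \<xi> < d \<Longrightarrow> dist (B (H \<zeta>)) (B (H \<xi>)) < e / 3"
      using BH \<xi> \<open>0 < e\<close> unfolding continuous_on_iff by (metis divide_pos_pos zero_less_numeral)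
    obtain t where t: "0 < t" "\<And>z z'. z \<in> K \<Longrightarrow> z' \<in> K \<Longrightarrow> dist z' z < t \<Longrightarrow> dist (B z') (B z) < e / 3"
      using B_unif \<open>0 < e\<close> unfolding uniformly_continuous_on_def by (metis divide_pos_pos zero_less_numeral)
    obtain N1 where N1: "\<And>n x. N1 \<le> n \<Longrightarrow> x \<in> D \<Longrightarrow> norm (G (r n) x - H x) < t"
      using unif[OF t(1)] by blast
    have "(\<lambda>n. \<sigma> (r n)) \<longlonglongrightarrow> 0"
      using LIMSEQ_subseq_LIMSEQ[OF \<sigma> H(2)] by (simp add: o_def)
    then obtain N2 where N2: "\<And>n. N2 \<le> n \<Longrightarrow> norm (\<sigma> (r n)) < e / 3"
      using \<open>0 < e\<close> LIMSEQ_D[of "\<lambda>n. \<sigma> (r n)" 0 "e / 3"] by (metis diff_zero divide_pos_pos zero_less_numeral)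
    \<comment> \<open>For fixed \<open>y\<close> the chained estimate with
      \<open>c = B (H \<xi>)\<close> passes to the limit. A third of \<open>e\<close> goes to
      \<open>\<sigma>\<close>, one to the distance of \<open>G (r n)\<close> from \<open>H\<close>,
      one to the variation of \<open>B\<close> along \<open>H\<close>.\<close>
    have "norm (H y - H \<xi> - B (H \<xi>) (y - \<xi>)) \<le> e * norm (y - \<xi>)"
      if y: "y \<in> D" "norm (y - \<xi>) < d" for y
    proof (rule tendsto_upperbound)
      show "(\<lambda>n. norm (G (r n) y - G (r n) \<xi> - B (H \<xi>) (y - \<xi>))) \<longlonglongrightarrow> norm (H y - H \<xi> - B (H \<xi>) (y - \<xi>))"
        by (intro tendsto_intros lim \<xi> y)
      have "norm (G (r n) y - G (r n) \<xi> - B (H \<xi>) (y - \<xi>)) \<le> e * norm (y - \<xi>)"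
        if n: "max N1 N2 \<le> n" for n
      proof -
        have "norm (G (r n) y - G (r n) \<xi> - B (H \<xi>) (y - \<xi>)) \<le> (\<sigma> (r n) + 2 * e / 3) * norm (y - \<xi>)"
        proof (rule chain[OF \<xi> y(1)])
          fix \<zeta> assume \<zeta>: "\<zeta> \<in> closed_segment \<xi> y"
          have \<zeta>D: "\<zeta> \<in> D" by (rule seg[OF \<zeta> \<xi> y(1)])
          have "norm (\<zeta> - \<xi>) < d" using segment_bound1[OF \<zeta>] y(2) by simp
          then have "dist (B (H \<zeta>)) (B (H \<xi>)) < e / 3"
            using d(2)[OF \<zeta>D] by (simp add: dist_norm)
          moreover have "dist (B (G (r n) \<zeta>)) (B (H \<zeta>)) < e / 3"
            using t(2)[OF HK[OF \<zeta>D] GK[OF \<zeta>D]] N1[OF _ \<zeta>D] n by (simp add: dist_norm)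
          ultimately have "dist (B (G (r n) \<zeta>)) (B (H \<xi>)) < 2 * e / 3"
            using dist_triangle[of "B (G (r n) \<zeta>)" "B (H \<xi>)" "B (H \<zeta>)"] by linarith
          then show "norm (B (G (r n) \<zeta>) - B (H \<xi>)) \<le> 2 * e / 3" by (simp add: dist_norm)
        qed
        also have "\<dots> \<le> e * norm (y - \<xi>)"
          using N2[of n] n by (intro mult_right_mono) auto
        finally show ?thesis .
      qed
      then show "\<forall>\<^sub>F n in sequentially. norm (G (r n) y - G (r n) \<xi> - B (H \<xi>) (y - \<xi>)) \<le> e * norm (y - \<xi>)"
        unfolding eventually_sequentially by blast
    qed simp
    then show "\<exists>d>0. \<forall>y\<in>D. norm (y - \<xi>) < d \<longrightarrow> norm (H y - H \<xi> - B (H \<xi>) (y - \<xi>)) \<le> e * norm (y - \<xi>)"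
      using d(1) by blast
  qed
  show thesis by (rule that[OF H(2) lim der])
qed

text \<open>Sections are built for ever better approximations \<open>A'\<close> of \<open>A\<close>.
  Inverting \<open>A'\<close> and then replacing it by \<open>A\<close> rewrites the estimate of
  \<open>approximate_integral_section\<close> as an approximate equation whose right-hand side is
  independent of the approximation, as the limit lemma requires.\<close>

lemma integral_section_exists:
  fixes A :: "'a::euclidean_space \<Rightarrow> 'a \<Rightarrow>\<^sub>L 'a"
  assumes near: "\<And>z. z \<in> cball p \<rho> \<Longrightarrow> norm (A z - id_blinfun) \<le> 1/4"
    and contA: "continuous_on (cball p \<rho>) A"
    and L: "subspace L"
    and P: "linear P" "\<And>v. v \<in> L \<Longrightarrow> P v = v"
    and approx: "\<And>e. 0 < e \<Longrightarrow> \<exists>A' DA' M S.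
        (\<forall>z\<in>cball p \<rho>. (A' has_derivative blinfun_apply (DA' z)) (at z)) \<and>
        continuous_on (cball p \<rho>) (DA' :: 'a \<Rightarrow> 'a \<Rightarrow>\<^sub>L 'a \<Rightarrow>\<^sub>L 'a) \<and> 0 \<le> M \<and> 0 \<le> S \<and>
        (\<forall>z\<in>cball p \<rho>. norm (A' z - A z) \<le> e) \<and>
        (\<forall>z\<in>cball p \<rho>. \<forall>v. P (A' z v) = P v) \<and>
        (\<forall>z\<in>cball p \<rho>. \<forall>u v. norm (DA' z u v - DA' z v u) \<le> M * norm u * norm v) \<and>
        (\<forall>z\<in>cball p \<rho>. \<forall>u v. A' z u \<in> L \<longrightarrow> A' z v \<in> L \<longrightarrow>
            norm (DA' z u v - DA' z v u) \<le> S * norm u * norm v) \<and>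
        S * exp (\<epsilon> * M) \<le> e"
    and \<delta>: "0 < \<delta>" "2 * \<delta> \<le> \<rho>" "4 * \<delta> \<le> \<epsilon>"
  obtains G where "G 0 = p"
    "\<And>\<xi>. \<xi> \<in> L \<inter> cball 0 \<delta> \<Longrightarrow> G \<xi> \<in> cball p \<rho> \<and> P (G \<xi> - p) = \<xi>"
    "\<And>\<xi>. \<xi> \<in> L \<inter> cball 0 \<delta> \<Longrightarrow>
        (G has_derivative blinfun_apply (blinfun_inv (A (G \<xi>)))) (at \<xi> within L \<inter> cball 0 \<delta>)"
proof -
  let ?K = "cball p \<rho>" and ?D = "L \<inter> cball 0 \<delta>"
  let ?B = "\<lambda>z. blinfun_inv (A z)"
  have ex: "\<exists>G d. 0 < d \<and> G 0 = p \<and> (\<forall>\<xi>\<in>?D. G \<xi> \<in> ?K \<and> P (G \<xi> - p) = \<xi>) \<and>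
      (\<forall>\<xi>\<in>?D. \<forall>\<xi>'\<in>?D. norm (\<xi>' - \<xi>) \<le> d \<longrightarrow>
         norm (G \<xi>' - G \<xi> - ?B (G \<xi>) (\<xi>' - \<xi>)) \<le> (2 * (4 * \<delta> + 1) + 4) * e * norm (\<xi>' - \<xi>))"
    if e: "0 < e" "e \<le> 1/4" for e
  proof -
    from approx[OF e(1)] obtain A' DA' M S where
      all: "\<forall>z\<in>?K. (A' has_derivative blinfun_apply (DA' z)) (at z)"
        "\<forall>z\<in>?K. norm (A' z - A z) \<le> e" "\<forall>z\<in>?K. \<forall>v. P (A' z v) = P v"
        "\<forall>z\<in>?K. \<forall>u v. norm (DA' z u v - DA' z v u) \<le> M * norm u * norm v"
        "\<forall>z\<in>?K. \<forall>u v. A' z u \<in> L \<longrightarrow> A' z v \<in> L \<longrightarrow>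
            norm (DA' z u v - DA' z v u) \<le> S * norm u * norm v"
      and cont: "continuous_on ?K (DA' :: 'a \<Rightarrow> 'a \<Rightarrow>\<^sub>L 'a \<Rightarrow>\<^sub>L 'a)" and nn: "0 \<le> M" "0 \<le> S"
      and SM: "S * exp (\<epsilon> * M) \<le> e" by (elim exE conjE) (rule that)
    note der = all(1)[rule_format] and AA = all(2)[rule_format] and PA = all(3)[rule_format]
      and M = all(4)[rule_format] and S = all(5)[rule_format]
    have near': "norm (A' z - id_blinfun) \<le> 1/2" if "z \<in> ?K" for z
      using near[OF that] AA[OF that] e norm_triangle_ineq[of "A' z - A z" "A z - id_blinfun"] by simp
    have near2: "norm (A z - id_blinfun) \<le> 1/2" if "z \<in> ?K" for z
      using near[OF that] by simp
    have "4 * \<delta> * S * exp (4 * \<delta> * M) \<le> 4 * \<delta> * (S * exp (\<epsilon> * M))"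
      using \<delta> nn mult_right_mono[OF \<delta>(3) nn(1)]
      by (auto simp: mult.assoc intro!: mult_left_mono mult_right_mono)
    also have "\<dots> \<le> 4 * \<delta> * e" using SM \<delta> by (intro mult_left_mono) auto
    \<comment> \<open>The added 1 supplies the strict inequality demanded of
      \<open>\<tau>\<close>.\<close>
    also have "\<dots> < (4 * \<delta> + 1) * e" using e by (simp add: algebra_simps)
    finally have \<tau>: "4 * \<delta> * S * exp (4 * \<delta> * M) < (4 * \<delta> + 1) * e" .
    obtain G d where G: "0 < d" "G 0 = p"
      "\<And>\<xi>. \<xi> \<in> ?D \<Longrightarrow> G \<xi> \<in> cball p (2 * \<delta>) \<and> P (G \<xi> - p) = \<xi>"
      "\<And>\<xi> \<xi>'. \<xi> \<in> ?D \<Longrightarrow> \<xi>' \<in> ?D \<Longrightarrow> norm (\<xi>' - \<xi>) \<le> d \<Longrightarrow>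
        norm (A' (G \<xi>) (G \<xi>' - G \<xi>) - (\<xi>' - \<xi>)) \<le> ((4 * \<delta> + 1) * e) * norm (\<xi>' - \<xi>)"
      using approximate_integral_section[OF near' der cont L P PA M S nn \<delta>(1,2) \<tau>] by blast
    have GK: "G \<xi> \<in> ?K" if "\<xi> \<in> ?D" for \<xi> using G(3)[of \<xi>] that \<delta>(2) by auto
    have "norm (G \<xi>' - G \<xi> - ?B (G \<xi>) (\<xi>' - \<xi>)) \<le> (2 * (4 * \<delta> + 1) + 4) * e * norm (\<xi>' - \<xi>)"
      if \<xi>: "\<xi> \<in> ?D" "\<xi>' \<in> ?D" "norm (\<xi>' - \<xi>) \<le> d" for \<xi> \<xi>'
    proof -
      define h where "h = \<xi>' - \<xi>"
      let ?B' = "blinfun_inv (A' (G \<xi>))"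
      have K: "G \<xi> \<in> ?K" by (rule GK[OF \<xi>(1)])
      have "norm (A' (G \<xi>) (G \<xi>' - G \<xi>) - h) \<le> ((4 * \<delta> + 1) * e) * norm h"
        unfolding h_def by (rule G(4)[OF \<xi>])
      moreover have "G \<xi>' - G \<xi> - ?B' h = ?B' (A' (G \<xi>) (G \<xi>' - G \<xi>) - h)"
        by (simp add: blinfun.diff_right[of ?B'] near_id_inv[OF near'[OF K]])
      ultimately have 1: "norm (G \<xi>' - G \<xi> - ?B' h) \<le> 2 * (((4 * \<delta> + 1) * e) * norm h)"
        using near_id_inv_bound[OF near'[OF K], of "A' (G \<xi>) (G \<xi>' - G \<xi>) - h"] by simp
      have "norm (?B' - ?B (G \<xi>)) \<le> 4 * e"
        using near_id_inv_diff[OF near'[OF K] near2[OF K]] AA[OF K] by simp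
      then have 2: "norm ((?B' - ?B (G \<xi>)) h) \<le> 4 * e * norm h"
        by (rule norm_blinfun_apply_le) simp
      have 3: "G \<xi>' - G \<xi> - ?B (G \<xi>) h = (G \<xi>' - G \<xi> - ?B' h) + (?B' - ?B (G \<xi>)) h"
        by (simp add: blinfun.diff_left)
      have "norm (G \<xi>' - G \<xi> - ?B (G \<xi>) h) \<le> 2 * (((4 * \<delta> + 1) * e) * norm h) + 4 * e * norm h"
        unfolding 3 by (rule norm_triangle_mono[OF 1 2])
      then show ?thesis unfolding h_def by (simp add: algebra_simps)
    qed
    then show ?thesis using G(1,2,3) GK by (intro exI[of _ G] exI[of _ d]) blast
  qed
  \<comment> \<open>The tolerances are \<open>e = 1 / (4 * (k + 1))\<close>. The factor 2 is the
    norm of the inverse of \<open>A'\<close>; the last 4 comes from replacing that inverse by the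
    one of \<open>A\<close>.\<close>
  define \<sigma> where "\<sigma> = (\<lambda>k. (2 * (4 * \<delta> + 1) + 4) * (1/4 * inverse (real (Suc k))))"
  have "\<forall>k. \<exists>G d. 0 < d \<and> G 0 = p \<and> (\<forall>\<xi>\<in>?D. G \<xi> \<in> ?K \<and> P (G \<xi> - p) = \<xi>) \<and>
      (\<forall>\<xi>\<in>?D. \<forall>\<xi>'\<in>?D. norm (\<xi>' - \<xi>) \<le> d \<longrightarrow>
         norm (G \<xi>' - G \<xi> - ?B (G \<xi>) (\<xi>' - \<xi>)) \<le> \<sigma> k * norm (\<xi>' - \<xi>))"
    unfolding \<sigma>_def by (intro allI ex) (auto simp: divide_simps)
  then obtain G d where Gd: "\<And>k. 0 < d k \<and> G k 0 = p \<and> (\<forall>\<xi>\<in>?D. G k \<xi> \<in> ?K \<and> P (G k \<xi> - p) = \<xi>) \<and>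
      (\<forall>\<xi>\<in>?D. \<forall>\<xi>'\<in>?D. norm (\<xi>' - \<xi>) \<le> d k \<longrightarrow>
         norm (G k \<xi>' - G k \<xi> - ?B (G k \<xi>) (\<xi>' - \<xi>)) \<le> \<sigma> k * norm (\<xi>' - \<xi>))"
    by metis
  have "compact ?D" "convex ?D"
    by (rule closed_Int_compact[OF closed_subspace[OF L] compact_cball],
        rule convex_Int[OF subspace_imp_convex[OF L] convex_cball])
  have contB: "continuous_on ?K ?B"
    by (rule continuous_on_near_id_inv[OF contA]) (use near in force)
  have "\<sigma> \<longlonglongrightarrow> (2 * (4 * \<delta> + 1) + 4) * (1/4 * 0)"
    unfolding \<sigma>_def by (intro tendsto_mult tendsto_const LIMSEQ_inverse_real_of_nat)
  then have \<sigma>0: "\<sigma> \<longlonglongrightarrow> 0" by simp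
  obtain H r where H: "strict_mono (r :: nat \<Rightarrow> nat)" "\<And>\<xi>. \<xi> \<in> ?D \<Longrightarrow> (\<lambda>k. G (r k) \<xi>) \<longlonglongrightarrow> H \<xi>"
    "\<And>\<xi>. \<xi> \<in> ?D \<Longrightarrow> (H has_derivative blinfun_apply (?B (H \<xi>))) (at \<xi> within ?D)"
    by (rule approximate_sections_limit[where G = G and d = d and B = ?B, OF \<open>compact ?D\<close> \<open>convex ?D\<close> compact_cball contB
          _ _ \<sigma>0])
      (use Gd in auto)
  show thesis
  proof
    have "0 \<in> ?D" using L \<delta> by (simp add: subspace_0)
    then have "(\<lambda>k. G (r k) 0) \<longlonglongrightarrow> H 0" by (rule H(2))
    then show "H 0 = p" using Gd by (simp add: LIMSEQ_const_iff)
    fix \<xi> assume \<xi>: "\<xi> \<in> ?D"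
    have "bounded_linear P" using P(1) by (rule linear_conv_bounded_linear[THEN iffD1])
    then have "(\<lambda>k. P (G (r k) \<xi> - p)) \<longlonglongrightarrow> P (H \<xi> - p)"
      by (rule bounded_linear.tendsto) (intro tendsto_intros H(2) \<xi>)
    then have "P (H \<xi> - p) = \<xi>" using Gd \<xi> by (simp add: LIMSEQ_const_iff)
    moreover have "H \<xi> \<in> ?K"
      using closed_sequentially[OF closed_cball _ H(2)[OF \<xi>]] Gd \<xi> by blast
    ultimately show "H \<xi> \<in> ?K \<and> P (H \<xi> - p) = \<xi>" by simp
    show "(H has_derivative blinfun_apply (?B (H \<xi>))) (at \<xi> within ?D)" by (rule H(3)[OF \<xi>])
  qed
qed

section \<open>Integral manifolds as images of sections\<close>

lemma C1_on_imp_continuous_on: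
  assumes "C1_on S f"
  shows "continuous_on S f"
proof -
  obtain f' where f': "\<And>x. x \<in> S \<Longrightarrow> (f has_derivative blinfun_apply (f' x)) (at x)"
    using assms unfolding C1_on_def by blast
  show ?thesis by (rule has_derivative_continuous_on[OF has_derivative_at_withinI[OF f']])
qed

text \<open>The velocity is realised by the image under \<open>F\<close> of the line through
  \<open>\<xi>\<close> in direction \<open>h\<close>, which for short times stays in
  \<open>L \<inter> W\<close>.\<close>

lemma tangent_space_C1_image:
  assumes "open W" and der: "\<And>w. w \<in> W \<Longrightarrow> (F has_derivative blinfun_apply (F' w)) (at w)"
    and cont: "continuous_on W F'"
    and "subspace L" and \<xi>: "\<xi> \<in> L" "\<xi> \<in> W" and "h \<in> L" and "F ` (L \<inter> W) \<subseteq> N"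
  shows "blinfun_apply (F' \<xi>) h \<in> tangent_space N (F \<xi>)"
proof -
  have cont_line: "continuous_on UNIV (\<lambda>t::real. \<xi> + t *\<^sub>R h)" by (intro continuous_intros)
  have "open ((\<lambda>t::real. \<xi> + t *\<^sub>R h) -` W)"
    using \<open>open W\<close> by (rule open_vimage[OF _ cont_line])
  moreover have "0 \<in> (\<lambda>t::real. \<xi> + t *\<^sub>R h) -` W" using \<xi> by simp
  ultimately obtain e where e: "0 < e" "ball 0 e \<subseteq> (\<lambda>t::real. \<xi> + t *\<^sub>R h) -` W"
    by (meson openE)
  have eW: "\<xi> + t *\<^sub>R h \<in> W" if "t \<in> {-e<..<e}" for t
    using e(2) that by (auto simp: subset_iff dist_real_def)
  define \<gamma> where "\<gamma> = (\<lambda>t. F (\<xi> + t *\<^sub>R h))"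
  have \<gamma>_der: "(\<gamma> has_vector_derivative F' (\<xi> + t *\<^sub>R h) h) (at t)" if "t \<in> {-e<..<e}" for t
  proof -
    have "((\<lambda>t. \<xi> + t *\<^sub>R h) has_derivative (\<lambda>s. s *\<^sub>R h)) (at t)"
      by (auto intro!: derivative_eq_intros)
    from has_derivative_compose[OF this der[OF eW[OF that]]]
    show ?thesis by (simp add: \<gamma>_def has_vector_derivative_def blinfun.scaleR_right)
  qed
  have "continuous_on {-e<..<e} (\<lambda>t. F' (\<xi> + t *\<^sub>R h))"
    by (rule continuous_on_compose2[OF cont continuous_on_subset[OF cont_line]]) (use eW in auto)
  then have "\<gamma> C1_differentiable_on {-e<..<e}"
    unfolding C1_differentiable_on_def using \<gamma>_der
    by (intro exI[of _ "\<lambda>t. F' (\<xi> + t *\<^sub>R h) h"] conjI ballI continuous_intros) auto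
  moreover have "\<gamma> ` {-e<..<e} \<subseteq> N"
  proof (intro image_subsetI)
    fix t assume "t \<in> {-e<..<e}"
    then have "\<xi> + t *\<^sub>R h \<in> L \<inter> W" using eW assms(4,5,7) by (simp add: subspace_add subspace_scale)
    then show "\<gamma> t \<in> N" using assms(8) unfolding \<gamma>_def by blast
  qed
  moreover have "\<gamma> 0 = F \<xi>" "(\<gamma> has_vector_derivative F' \<xi> h) (at 0)"
    using \<gamma>_der[of 0] e(1) by (simp_all add: \<gamma>_def)
  ultimately show ?thesis
    unfolding tangent_space_def using e(1) by blast
qed

text \<open>The image is a graph over a disc in \<open>L\<close>, because
  \<open>P (G \<xi> - p) = \<xi>\<close>; a shear along the fibres of \<open>P\<close> straightens
  it. Its tangent spaces are the images of \<open>L\<close> under \<open>B\<close>, hence the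
  preimages under \<open>A\<close>.\<close>

lemma integral_manifold_section_image:
  fixes A B :: "'a::euclidean_space \<Rightarrow> 'a \<Rightarrow>\<^sub>L 'a"
  assumes L: "subspace L" and P: "bounded_linear P" "\<And>v. P v \<in> L" "\<And>v. v \<in> L \<Longrightarrow> P v = v"
    and "0 < \<delta>" "K \<subseteq> U"
    and G: "\<And>\<xi>. \<xi> \<in> L \<inter> cball 0 \<delta> \<Longrightarrow> G \<xi> \<in> K \<and> P (G \<xi> - p) = \<xi>"
    and der: "\<And>\<xi>. \<xi> \<in> L \<inter> cball 0 \<delta> \<Longrightarrow>
        (G has_derivative blinfun_apply (B (G \<xi>))) (at \<xi> within L \<inter> cball 0 \<delta>)"
    and contB: "continuous_on K B"
    and AB: "\<And>z v. z \<in> K \<Longrightarrow> A z (B z v) = v" "\<And>z v. z \<in> K \<Longrightarrow> B z (A z v) = v"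
    and E: "\<And>z. z \<in> K \<Longrightarrow> E z = {v. A z v \<in> L}"
  shows "integral_manifold U (dim L) E (G ` (L \<inter> ball 0 \<delta>))"
proof -
  let ?D = "L \<inter> cball 0 \<delta>"
  define N where "N = G ` (L \<inter> ball 0 \<delta>)"
  define W where "W = {w. norm (P w) < \<delta>}"
  define V where "V = {z. norm (P (z - p)) < \<delta>}"
  \<comment> \<open>\<open>G\<close> is differentiable only within the disc in \<open>L\<close>;
    composing with \<open>P\<close> gives a map on an open set.\<close>
  define F where "F = (\<lambda>w. G (P w))"
  define F' where "F' = (\<lambda>w. B (F w) o\<^sub>L Blinfun P)"
  have Pb: "blinfun_apply (Blinfun P) = P" by (rule bounded_linear_Blinfun_apply[OF P(1)])
  have lin: "linear P" by (rule bounded_linear.linear[OF P(1)])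
  have contP: "continuous_on S P" for S by (rule linear_continuous_on[OF P(1)])
  have "open W" unfolding W_def by (intro open_Collect_less continuous_intros contP)
  have "open V" unfolding V_def
    by (intro open_Collect_less continuous_intros continuous_on_compose2[OF contP]) auto
  have PD: "P w \<in> ?D" if "w \<in> W" for w using that P(2) by (auto simp: W_def)
  have FK: "F w \<in> K" and PF: "P (F w - p) = P w" if "w \<in> W" for w
    using G[OF PD[OF that]] by (auto simp: F_def)
  have F_der: "(F has_derivative blinfun_apply (F' w)) (at w)" if w: "w \<in> W" for w
  proof -
    have "(G has_derivative blinfun_apply (B (F w))) (at (P w) within P ` W)"
      unfolding F_def by (rule has_derivative_subset[OF der[OF PD[OF w]]]) (use PD in blast)
    moreover have "(P has_derivative P) (at w within W)"
      using P(1) by (rule bounded_linear_imp_has_derivative)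
    ultimately have "(G \<circ> P has_derivative blinfun_apply (B (F w)) \<circ> P) (at w within W)"
      by (rule diff_chain_within[rotated])
    then show ?thesis
      using at_within_open[OF w \<open>open W\<close>] by (simp add: F_def F'_def o_def Pb blinfun_compose.rep_eq)
  qed
  have F_cont: "continuous_on W F"
    by (rule has_derivative_continuous_on[OF has_derivative_at_withinI[OF F_der]])
  have BF_cont: "continuous_on W (\<lambda>w. B (F w))"
    by (rule continuous_on_compose2[OF contB F_cont]) (use FK in auto)
  have F'_cont: "continuous_on W F'"
    unfolding F'_def by (intro continuous_intros BF_cont)
  have F_L: "F \<xi> = G \<xi>" if "\<xi> \<in> L" for \<xi> using P(3)[OF that] by (simp add: F_def)
  have LW: "\<xi> \<in> W \<longleftrightarrow> norm \<xi> < \<delta>" if "\<xi> \<in> L" for \<xi> using P(3)[OF that] by (simp add: W_def)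
  have NF: "N = F ` (L \<inter> W)" using F_L LW by (force simp: N_def)
  have N_proj: "z = F (P (z - p)) \<and> P (z - p) \<in> L \<inter> W" if "z \<in> N" for z
    using that PF P(3) unfolding NF by auto
  have PV: "P (z - p) \<in> W" if "z \<in> V" for z
    using that P(2,3) by (simp add: V_def W_def)
  \<comment> \<open>Mutually inverse shears. On \<open>L\<close> the map \<open>\<psi>\<close>
    coincides with \<open>F\<close>, and on \<open>N\<close> the map \<open>\<phi>\<close> coincides
    with the projection of \<open>z - p\<close>.\<close>
  define \<phi> where "\<phi> = (\<lambda>z. z - F (P (z - p)) + P (z - p))"
  define \<psi> where "\<psi> = (\<lambda>w. w + F w - P w)"
  have C1\<psi>: "C1_on W \<psi>"
    unfolding C1_on_def
  proof (intro exI conjI ballI)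
    show "(\<psi> has_derivative blinfun_apply (id_blinfun + F' w - Blinfun P)) (at w)" if "w \<in> W" for w
      unfolding \<psi>_def
      by (auto intro!: derivative_eq_intros F_der[OF that] bounded_linear_imp_has_derivative[OF P(1)]
          simp: fun_eq_iff blinfun.add_left blinfun.diff_left Pb)
    show "continuous_on W (\<lambda>w. id_blinfun + F' w - Blinfun P)"
      by (intro continuous_intros F'_cont)
  qed
  have C1\<phi>: "C1_on V \<phi>"
    unfolding C1_on_def
  proof (intro exI conjI ballI)
    let ?\<phi>' = "\<lambda>z. id_blinfun - (F' (P (z - p)) o\<^sub>L Blinfun P) + Blinfun P"
    have Pder: "((\<lambda>z. P (z - p)) has_derivative P) (at z)" for z
      by (rule has_derivative_eq_rhs[OF has_derivative_compose[OF _ bounded_linear_imp_has_derivative[OF P(1)]]])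
        (auto intro!: derivative_eq_intros)
    show "(\<phi> has_derivative blinfun_apply (?\<phi>' z)) (at z)" if "z \<in> V" for z
      unfolding \<phi>_def
      by (auto intro!: derivative_eq_intros Pder has_derivative_compose[OF Pder F_der[OF PV[OF that]]]
          simp: fun_eq_iff blinfun.add_left blinfun.diff_left Pb)
    have "continuous_on V (\<lambda>z. P (z - p))"
      by (rule has_derivative_continuous_on[OF has_derivative_at_withinI[OF Pder]])
    then have "continuous_on V (\<lambda>z. F' (P (z - p)))"
      by (rule continuous_on_compose2[OF F'_cont]) (use PV in auto)
    then show "continuous_on V ?\<phi>'" by (intro continuous_intros)
  qed
  have P\<psi>: "P (\<psi> w - p) = P w" if "w \<in> W" for w
  proof -
    have "\<psi> w - p = (w - P w) + (F w - p)" by (simp add: \<psi>_def)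
    then have "P (\<psi> w - p) = (P w - P (P w)) + P (F w - p)"
      by (simp only: linear_add[OF lin] linear_diff[OF lin, of w "P w"])
    then show ?thesis using PF[OF that] P(3)[OF P(2)] by simp
  qed
  have P\<phi>: "P (\<phi> z) = P (z - p)" if "z \<in> V" for z
  proof -
    have "\<phi> z = (z - p) - (F (P (z - p)) - p) + P (z - p)" by (simp add: \<phi>_def)
    then have "P (\<phi> z) = P (z - p) - P (F (P (z - p)) - p) + P (P (z - p))"
      by (simp only: linear_add[OF lin] linear_diff[OF lin, of "z - p" "F (P (z - p)) - p"])
    then show ?thesis using PF[OF PV[OF that]] by simp
  qed
  have hom: "homeomorphism V W \<phi> \<psi>"
  proof
    show "continuous_on V \<phi>" "continuous_on W \<psi>" using C1_on_imp_continuous_on C1\<phi> C1\<psi> by auto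
    show "\<phi> ` V \<subseteq> W" using P\<phi> by (auto simp: W_def V_def)
    show "\<psi> ` W \<subseteq> V" using P\<psi> by (auto simp: W_def V_def)
    show "\<psi> (\<phi> z) = z" if "z \<in> V" for z
      using P\<phi>[OF that] P(3)[OF P(2)] by (simp add: \<psi>_def F_def) (simp add: \<phi>_def F_def P(3)[OF P(2)])
    show "\<phi> (\<psi> w) = w" if "w \<in> W" for w
      using P\<psi>[OF that] P(3)[OF P(2)] by (simp add: \<phi>_def F_def) (simp add: \<psi>_def F_def)
  qed
  have NV: "N \<subseteq> V" using N_proj by (force simp: V_def LW)
  have \<phi>F: "\<phi> (F w) = w" if "w \<in> L \<inter> W" for w
    using PF[of w] P(3)[of w] that by (simp add: \<phi>_def)
  have "\<phi> ` (N \<inter> V) = L \<inter> W"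
  proof -
    have "\<phi> ` (N \<inter> V) = \<phi> ` F ` (L \<inter> W)" using NV NF by (metis Int_absorb2)
    also have "\<dots> = (\<lambda>w. w) ` (L \<inter> W)"
      unfolding image_image by (rule image_cong[OF refl \<phi>F])
    finally show ?thesis by simp
  qed
  then have sub: "C1_submanifold (dim L) N"
    unfolding C1_submanifold_def
    using \<open>open V\<close> \<open>open W\<close> hom C1\<phi> C1\<psi> L NV by blast
  have tan: "tangent_space N q = E q" if q: "q \<in> N" for q
  proof -
    define \<xi> where "\<xi> = P (q - p)"
    have \<xi>: "\<xi> \<in> L" "\<xi> \<in> W" "q = F \<xi>" using N_proj[OF q] by (auto simp: \<xi>_def)
    have qK: "q \<in> K" using FK \<xi> by simp
    show ?thesis
    proof (intro set_eqI iffI)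
      fix v assume "v \<in> tangent_space N q"
      then obtain \<gamma> e where \<gamma>: "0 < e" "\<gamma> ` {-e<..<e} \<subseteq> N" "\<gamma> 0 = q"
        "(\<gamma> has_vector_derivative v) (at 0)" unfolding tangent_space_def by blast
      \<comment> \<open>A curve in \<open>N\<close> is recovered from its projection by
        \<open>F\<close>, so its velocity satisfies \<open>v = B q (P v)\<close>, that is,
        \<open>A q v = P v\<close>.\<close>
      have "((\<lambda>t. P (\<gamma> t - p)) has_vector_derivative P v) (at 0)"
        using \<gamma>(4) by (intro bounded_linear.has_vector_derivative[OF P(1)]) (auto intro!: derivative_eq_intros)
      moreover have "(F has_derivative blinfun_apply (F' \<xi>)) (at (P (\<gamma> 0 - p)))"
        using F_der[OF \<xi>(2)] by (simp add: \<gamma>(3) \<xi>_def)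
      ultimately have "((\<lambda>t. F (P (\<gamma> t - p))) has_vector_derivative F' \<xi> (P v)) (at 0)"
        unfolding has_vector_derivative_def
        by (rule has_derivative_eq_rhs[OF has_derivative_compose]) (simp add: blinfun.scaleR_right)
      then have "(\<gamma> has_vector_derivative F' \<xi> (P v)) (at 0)"
      proof (rule has_vector_derivative_transform_within_open[where S = "{-e<..<e}"])
        show "F (P (\<gamma> t - p)) = \<gamma> t" if "t \<in> {-e<..<e}" for t
          using N_proj[OF subsetD[OF \<gamma>(2) imageI[OF that]]] by simp
      qed (use \<gamma>(1) in auto)
      then have "v = F' \<xi> (P v)" by (rule vector_derivative_unique_at[OF \<gamma>(4)])
      also have "\<dots> = B q (P v)" using \<xi>(3) P(3)[OF P(2)] by (simp add: F'_def Pb)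
      finally have "A q v = P v" using AB(1)[OF qK] by metis
      then show "v \<in> E q" using E[OF qK] P(2) by simp
    next
      fix v assume "v \<in> E q"
      then have h: "A q v \<in> L" using E[OF qK] by simp
      define h where "h = A q v"
      have v: "v = B q h" by (simp add: h_def AB(2)[OF qK])
      have hL: "h \<in> L" using h by (simp add: h_def)
      have "F' \<xi> h \<in> tangent_space N (F \<xi>)"
        by (rule tangent_space_C1_image[OF \<open>open W\<close> F_der F'_cont L]) (use \<xi> hL in \<open>auto simp: NF\<close>)
      then show "v \<in> tangent_space N q"
        using \<xi>(3) P(3)[OF hL] by (simp add: v F'_def Pb)
    qed
  qed
  have "N \<subseteq> U" using FK \<open>K \<subseteq> U\<close> unfolding NF by auto
  with sub tan show ?thesis unfolding integral_manifold_def N_def by blast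
qed

section \<open>Submanifolds as graphs, and local agreement of integral manifolds\<close>

lemma inv_eq_blinfun_inv:
  fixes A :: "'a::euclidean_space \<Rightarrow>\<^sub>L 'a"
  assumes "inj (blinfun_apply A)"
  shows "inv (blinfun_apply A) = blinfun_apply (blinfun_inv A)"
  by (rule ext, rule inv_f_eq[OF assms], rule blinfun_inv(2)[OF assms])

text \<open>A submanifold is locally a graph over its tangent plane. The slice chart is corrected so
  that its \<open>L\<close>-component is the projection itself; the inverse function theorem then
  provides a section.\<close>

lemma C1_submanifold_local_section:
  fixes N :: "'a::euclidean_space set"
  assumes N: "C1_submanifold m N" and "q \<in> N" and tan: "tangent_space N q \<subseteq> L"
    and L: "subspace L" "dim L = m"
    and P: "bounded_linear P" "\<And>v. P v \<in> L" "\<And>v. v \<in> L \<Longrightarrow> P v = v"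
  obtains \<delta> \<sigma> \<sigma>' T where "0 < \<delta>" "open T" "q \<in> T"
    "\<And>y. y \<in> ball 0 \<delta> \<Longrightarrow> (\<sigma> has_derivative blinfun_apply (\<sigma>' y)) (at y)"
    "continuous_on (ball 0 \<delta>) (\<sigma>' :: 'a \<Rightarrow> 'a \<Rightarrow>\<^sub>L 'a)"
    "\<And>y. y \<in> L \<inter> ball 0 \<delta> \<Longrightarrow> \<sigma> y \<in> N"
    "\<And>y. y \<in> L \<inter> ball 0 \<delta> \<Longrightarrow> P (\<sigma> y - q) = y"
    "\<And>z. z \<in> N \<inter> T \<Longrightarrow> P (z - q) \<in> ball 0 \<delta> \<and> \<sigma> (P (z - q)) = z"
proof -
  obtain V W \<phi> \<psi> L' where V: "open V" "q \<in> V" and W: "open (W :: 'a set)" and hom: "homeomorphism V W \<phi> \<psi>"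
    and C1: "C1_on V \<phi>" "C1_on W \<psi>" and L': "subspace L'" "dim L' = m"
    and slice: "\<phi> ` (N \<inter> V) = L' \<inter> W"
    using bspec[OF N[unfolded C1_submanifold_def] \<open>q \<in> N\<close>] by metis
  obtain \<phi>' where \<phi>': "\<And>z. z \<in> V \<Longrightarrow> (\<phi> has_derivative blinfun_apply (\<phi>' z)) (at z)" "continuous_on V \<phi>'"
    using C1(1) unfolding C1_on_def by blast
  obtain \<psi>' where \<psi>': "\<And>w. w \<in> W \<Longrightarrow> (\<psi> has_derivative blinfun_apply (\<psi>' w)) (at w)" "continuous_on W \<psi>'"
    using C1(2) unfolding C1_on_def by blast
  have \<psi>\<phi>: "\<psi> (\<phi> z) = z" "\<phi> z \<in> W" if "z \<in> V" for z
    using hom that by (auto simp: homeomorphism_def)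
  have \<phi>\<psi>: "\<phi> (\<psi> w) = w" "\<psi> w \<in> V" if "w \<in> W" for w
    using hom that by (auto simp: homeomorphism_def)
  have NV: "z \<in> N \<longleftrightarrow> \<phi> z \<in> L'" if z: "z \<in> V" for z
  proof
    assume "\<phi> z \<in> L'"
    then obtain z' where "z' \<in> N" "z' \<in> V" "\<phi> z' = \<phi> z"
      using slice \<psi>\<phi>(2)[OF z] by (metis (no_types, lifting) IntD1 IntD2 IntI imageE)
    then show "z \<in> N" using \<psi>\<phi>(1)[OF z] \<psi>\<phi>(1)[of z'] by simp
  qed (use slice z in blast)
  \<comment> \<open>\<open>S\<close> inverts the derivative of the chart at \<open>q\<close>, so it
    carries the model plane \<open>L'\<close> back to the tangent directions.\<close>
  define S where "S = \<psi>' (\<phi> q)"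
  have S\<phi>: "S (\<phi>' q v) = v" for v
  proof -
    have "(\<psi> \<circ> \<phi> has_derivative blinfun_apply S \<circ> blinfun_apply (\<phi>' q)) (at q)"
      unfolding S_def by (rule diff_chain_at[OF \<phi>'(1)[OF V(2)] \<psi>'(1)[OF \<psi>\<phi>(2)[OF V(2)]]])
    then have "((\<lambda>z. z) has_derivative blinfun_apply S \<circ> blinfun_apply (\<phi>' q)) (at q)"
      by (rule has_derivative_transform_within_open[OF _ V]) (simp add: \<psi>\<phi>)
    then have "blinfun_apply S \<circ> blinfun_apply (\<phi>' q) = (\<lambda>z. z)"
      by (rule has_derivative_unique) (rule has_derivative_ident)
    then show ?thesis by (metis comp_apply)
  qed
  have linS: "linear (blinfun_apply S)" by (rule bounded_linear.linear[OF blinfun.bounded_linear_right])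
  have "surj (blinfun_apply S)" using S\<phi> by (metis surjI)
  then have injS: "inj (blinfun_apply S)" using linS linear_surjective_imp_injective by blast
  have SL: "blinfun_apply S ` L' \<subseteq> L"
  proof
    fix v assume "v \<in> blinfun_apply S ` L'"
    then obtain h where h: "h \<in> L'" "v = S h" by blast
    have "\<psi> ` (L' \<inter> W) \<subseteq> N" using NV \<phi>\<psi> by auto
    from tangent_space_C1_image[OF W \<psi>' L'(1) _ _ h(1) this, of "\<phi> q"]
    have "v \<in> tangent_space N q"
      using NV[OF V(2)] \<open>q \<in> N\<close> \<psi>\<phi>[OF V(2)] by (simp add: h(2) S_def)
    then show "v \<in> L" using tan by blast
  qed
  \<comment> \<open>The inclusion becomes an equality by counting dimensions.\<close>
  have SL_eq: "blinfun_apply S ` L' = L"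
  proof (rule subspace_dim_equal[OF linear_subspace_image[OF linS L'(1)] L(1) SL])
    show "dim L \<le> dim (blinfun_apply S ` L')"
      using dim_image_eq[OF linS inj_on_subset[OF injS subset_UNIV], of L'] L(2) L'(2) by simp
  qed
  have S_iff: "S w \<in> L \<longleftrightarrow> w \<in> L'" for w
    using SL_eq injS by (metis inj_image_mem_iff)
  let ?P = "Blinfun P"
  have Pb: "blinfun_apply ?P = P" by (rule bounded_linear_Blinfun_apply[OF P(1)])
  have linP: "linear P" by (rule bounded_linear.linear[OF P(1)])
  \<comment> \<open>a chart of the ambient space that straightens \<open>N\<close> to \<open>L\<close> and has derivative 1 at \<open>q\<close>\<close>
  define \<Psi> where "\<Psi> = (\<lambda>z. P (z - q) + (S (\<phi> z) - P (S (\<phi> z))))"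
  define \<Psi>' where "\<Psi>' = (\<lambda>z. ?P + ((S o\<^sub>L \<phi>' z) - (?P o\<^sub>L S o\<^sub>L \<phi>' z)))"
  have \<Psi>_der: "(\<Psi> has_derivative blinfun_apply (\<Psi>' z)) (at z)" if z: "z \<in> V" for z
  proof -
    have 1: "((\<lambda>z. P (z - q)) has_derivative P) (at z)"
      by (rule has_derivative_eq_rhs[OF has_derivative_compose[OF _ bounded_linear_imp_has_derivative[OF P(1)]]])
        (auto intro!: derivative_eq_intros)
    have 2: "((\<lambda>z. S (\<phi> z)) has_derivative (\<lambda>v. S (\<phi>' z v))) (at z)"
      by (rule bounded_linear.has_derivative[OF blinfun.bounded_linear_right \<phi>'(1)[OF z]])
    have 3: "((\<lambda>z. P (S (\<phi> z))) has_derivative (\<lambda>v. P (S (\<phi>' z v)))) (at z)"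
      by (rule bounded_linear.has_derivative[OF P(1) 2])
    have "blinfun_apply (\<Psi>' z) = (\<lambda>v. P v + (S (\<phi>' z v) - P (S (\<phi>' z v))))"
      by (auto simp: \<Psi>'_def blinfun.add_left blinfun.diff_left Pb)
    then show ?thesis
      unfolding \<Psi>_def using has_derivative_add[OF 1 has_derivative_diff[OF 2 3]] by simp
  qed
  have \<Psi>'_cont: "continuous_on V \<Psi>'"
    unfolding \<Psi>'_def by (intro continuous_intros \<phi>'(2))
  have \<Psi>'q: "\<Psi>' q = id_blinfun"
    by (rule blinfun_eqI) (simp add: \<Psi>'_def blinfun.add_left blinfun.diff_left Pb S\<phi>)
  have P\<Psi>: "P (\<Psi> z) = P (z - q)" for z
    using P(3)[OF P(2)] by (simp add: \<Psi>_def linear_add[OF linP, of "P (z - q)"] linear_diff[OF linP, of _ "P _"])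
  \<comment> \<open>\<open>\<Psi> z\<close> lies in \<open>L\<close> exactly when its component
    complementary to \<open>L\<close> vanishes, which says \<open>S (\<phi> z) \<in> L\<close>, that
    is, \<open>\<phi> z \<in> L'\<close>.\<close>
  have N\<Psi>: "z \<in> N \<longleftrightarrow> \<Psi> z \<in> L" if z: "z \<in> V" for z
  proof -
    have "\<Psi> z \<in> L \<longleftrightarrow> \<Psi> z = P (z - q)" using P(2,3) P\<Psi> by metis
    also have "\<dots> \<longleftrightarrow> S (\<phi> z) = P (S (\<phi> z))" by (simp add: \<Psi>_def)
    also have "\<dots> \<longleftrightarrow> S (\<phi> z) \<in> L" using P(2,3) by metis
    finally show ?thesis using NV[OF z] S_iff by simp
  qed
  have \<Psi>q: "\<Psi> q = 0"
    using N\<Psi>[OF V(2)] \<open>q \<in> N\<close> P(3) P\<Psi>[of q] linear_0[OF linP] by simp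
  \<comment> \<open>Here the derivative of \<open>\<Psi>\<close> is close enough to the identity for
    \<open>continuous_on_near_id_inv\<close>, which makes the derivative of the local inverse
    continuous.\<close>
  define V0 where "V0 = {z \<in> V. norm (\<Psi>' z - id_blinfun) < 1/2}"
  have "continuous_on V (\<lambda>z. norm (\<Psi>' z - id_blinfun))"
    by (intro continuous_intros \<Psi>'_cont)
  then have "open (V \<inter> (\<lambda>z. norm (\<Psi>' z - id_blinfun)) -` {..<1/2})"
    using V(1) by (rule continuous_open_preimage) simp
  moreover have "V0 = V \<inter> (\<lambda>z. norm (\<Psi>' z - id_blinfun)) -` {..<1/2}" by (auto simp: V0_def)
  ultimately have "open V0" by simp
  have "q \<in> V0" using V \<Psi>'q by (simp add: V0_def)
  have V0V: "V0 \<subseteq> V" by (auto simp: V0_def)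
  obtain U' V' g g' where U': "U' \<subseteq> V0" "open U'" "q \<in> U'" and V': "open V'" "\<Psi> q \<in> V'"
    and hom': "homeomorphism U' V' \<Psi> g"
    and g: "\<And>y. y \<in> V' \<Longrightarrow> (g has_derivative g' y) (at y)"
      "\<And>y. y \<in> V' \<Longrightarrow> g' y = inv (blinfun_apply (\<Psi>' (g y)))"
  proof (rule inverse_function_theorem[OF \<open>open V0\<close> \<Psi>_der continuous_on_subset[OF \<Psi>'_cont V0V] \<open>q \<in> V0\<close>])
    show "z \<in> V" if "z \<in> V0" for z using that V0V by blast
    show "id_blinfun o\<^sub>L \<Psi>' q = id_blinfun" by (rule blinfun_eqI) (simp add: \<Psi>'q)
  qed blast
  have g\<Psi>: "g (\<Psi> z) = z" "\<Psi> z \<in> V'" if "z \<in> U'" for z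
    using hom' that by (auto simp: homeomorphism_def)
  have \<Psi>g: "\<Psi> (g y) = y" "g y \<in> U'" if "y \<in> V'" for y
    using hom' that by (auto simp: homeomorphism_def)
  obtain \<delta> where \<delta>: "0 < \<delta>" "ball 0 \<delta> \<subseteq> V'"
    using V' \<Psi>q by (metis openE)
  define \<sigma>' where "\<sigma>' = (\<lambda>y. blinfun_inv (\<Psi>' (g y)))"
  have near: "norm (\<Psi>' (g y) - id_blinfun) \<le> 1/2" if "y \<in> V'" for y
    using \<Psi>g(2)[OF that] U'(1) by (auto simp: V0_def)
  have g_der: "(g has_derivative blinfun_apply (\<sigma>' y)) (at y)" if "y \<in> V'" for y
    using g[OF that] inv_eq_blinfun_inv[OF near_id_inj[OF near[OF that]]] by (simp add: \<sigma>'_def)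
  have g_cont: "continuous_on V' g" using hom' by (simp add: homeomorphism_def)
  have "continuous_on V' (\<lambda>y. \<Psi>' (g y))"
    by (rule continuous_on_compose2[OF \<Psi>'_cont g_cont]) (use \<Psi>g(2) U'(1) V0V in blast)
  then have \<sigma>'_cont: "continuous_on V' \<sigma>'"
    unfolding \<sigma>'_def by (rule continuous_on_near_id_inv) (rule near)
  show thesis
  proof
    show "0 < \<delta>" by fact
    let ?T = "U' \<inter> {z. norm (P (z - q)) < \<delta>}"
    have contP: "continuous_on UNIV (\<lambda>z. P (z - q))"
      by (rule continuous_on_compose2[OF linear_continuous_on[OF P(1)]]) (auto intro!: continuous_intros)
    show "open ?T"
      by (intro open_Int U' open_Collect_less continuous_on_norm contP continuous_on_const)
    show "q \<in> ?T" using U' \<delta> linear_0[OF linP] by simp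
    show "(g has_derivative blinfun_apply (\<sigma>' y)) (at y)" if "y \<in> ball 0 \<delta>" for y
      using g_der that \<delta> by blast
    show "continuous_on (ball 0 \<delta>) \<sigma>'" by (rule continuous_on_subset[OF \<sigma>'_cont \<delta>(2)])
    fix y assume y: "y \<in> L \<inter> ball 0 \<delta>"
    then have yV: "y \<in> V'" using \<delta> by blast
    have gV: "g y \<in> V" using \<Psi>g(2)[OF yV] U'(1) V0V by blast
    show "g y \<in> N" using N\<Psi>[OF gV] \<Psi>g(1)[OF yV] y by simp
    show "P (g y - q) = y" using P\<Psi>[of "g y"] \<Psi>g(1)[OF yV] P(3) y by simp
  next
    fix z assume z: "z \<in> N \<inter> (U' \<inter> {z. norm (P (z - q)) < \<delta>})"
    then have "z \<in> V" using U'(1) V0V by blast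
    then have "\<Psi> z = P (z - q)" using N\<Psi> z P(3) P\<Psi> by (metis IntD1)
    then show "P (z - q) \<in> ball 0 \<delta> \<and> g (P (z - q)) = z" using z g\<Psi>(1)[of z] by auto
  qed
qed

text \<open>Both manifolds are graphs over \<open>E q\<close>. A segment from 0 to \<open>x\<close>
  in \<open>E q\<close> lifts to curves in the two graphs that solve the same equation, so
  \<open>integral_curves_unique\<close> identifies their endpoints.\<close>

lemma integral_manifolds_agree_locally:
  fixes A :: "'a::euclidean_space \<Rightarrow> 'a \<Rightarrow>\<^sub>L 'a"
  assumes near: "\<And>z. z \<in> ball q \<rho> \<Longrightarrow> norm (A z - id_blinfun) \<le> 1/4"
    and approx: "\<And>e. 0 < e \<Longrightarrow> \<exists>A' DA' M S.
        (\<forall>z\<in>ball q \<rho>. (A' has_derivative blinfun_apply (DA' z)) (at z)) \<and>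
        continuous_on (ball q \<rho>) (DA' :: 'a \<Rightarrow> 'a \<Rightarrow>\<^sub>L 'a \<Rightarrow>\<^sub>L 'a) \<and> 0 \<le> M \<and> 0 \<le> S \<and>
        (\<forall>z\<in>ball q \<rho>. norm (A' z - A z) \<le> S) \<and>
        (\<forall>z\<in>ball q \<rho>. \<forall>u v. norm (DA' z u v - DA' z v u) \<le> M * norm u * norm v) \<and>
        S * exp (\<epsilon> * M) \<le> e"
    and "0 < \<epsilon>" "0 < \<rho>"
    and P: "bounded_linear P" "\<And>v. P v \<in> E q" "\<And>v. v \<in> E q \<Longrightarrow> P v = v"
    and PA: "\<And>z v. z \<in> ball q \<rho> \<Longrightarrow> P (A z v) = P v"
    and EA: "\<And>z v. z \<in> ball q \<rho> \<Longrightarrow> v \<in> E z \<Longrightarrow> A z v \<in> E q"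
    and E: "subspace (E q)" "dim (E q) = m"
    and N: "integral_manifold U m E N\<^sub>1" "integral_manifold U m E N\<^sub>2" "q \<in> N\<^sub>1" "q \<in> N\<^sub>2"
  obtains T where "open T" "q \<in> T" "N\<^sub>1 \<inter> T \<subseteq> N\<^sub>2"
proof -
  have linP: "linear P" by (rule bounded_linear.linear[OF P(1)])
  have N': "C1_submanifold m N\<^sub>1" "C1_submanifold m N\<^sub>2"
    "\<And>z. z \<in> N\<^sub>1 \<Longrightarrow> tangent_space N\<^sub>1 z = E z" "\<And>z. z \<in> N\<^sub>2 \<Longrightarrow> tangent_space N\<^sub>2 z = E z"
    using N by (auto simp: integral_manifold_def)
  have tan: "tangent_space N\<^sub>1 q \<subseteq> E q" "tangent_space N\<^sub>2 q \<subseteq> E q" using N' N by auto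
  obtain \<delta>\<^sub>1 \<sigma>\<^sub>1 \<sigma>\<^sub>1' T\<^sub>1 where s1: "0 < \<delta>\<^sub>1" "open T\<^sub>1" "q \<in> T\<^sub>1"
    "\<And>y. y \<in> ball 0 \<delta>\<^sub>1 \<Longrightarrow> (\<sigma>\<^sub>1 has_derivative blinfun_apply (\<sigma>\<^sub>1' y)) (at y)"
    "continuous_on (ball 0 \<delta>\<^sub>1) (\<sigma>\<^sub>1' :: 'a \<Rightarrow> 'a \<Rightarrow>\<^sub>L 'a)"
    "\<And>y. y \<in> E q \<inter> ball 0 \<delta>\<^sub>1 \<Longrightarrow> \<sigma>\<^sub>1 y \<in> N\<^sub>1"
    "\<And>y. y \<in> E q \<inter> ball 0 \<delta>\<^sub>1 \<Longrightarrow> P (\<sigma>\<^sub>1 y - q) = y"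
    "\<And>z. z \<in> N\<^sub>1 \<inter> T\<^sub>1 \<Longrightarrow> P (z - q) \<in> ball 0 \<delta>\<^sub>1 \<and> \<sigma>\<^sub>1 (P (z - q)) = z"
    using C1_submanifold_local_section[OF N'(1) N(3) tan(1) E P] by metis
  obtain \<delta>\<^sub>2 \<sigma>\<^sub>2 \<sigma>\<^sub>2' T\<^sub>2 where s2: "0 < \<delta>\<^sub>2" "open T\<^sub>2" "q \<in> T\<^sub>2"
    "\<And>y. y \<in> ball 0 \<delta>\<^sub>2 \<Longrightarrow> (\<sigma>\<^sub>2 has_derivative blinfun_apply (\<sigma>\<^sub>2' y)) (at y)"
    "continuous_on (ball 0 \<delta>\<^sub>2) (\<sigma>\<^sub>2' :: 'a \<Rightarrow> 'a \<Rightarrow>\<^sub>L 'a)"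
    "\<And>y. y \<in> E q \<inter> ball 0 \<delta>\<^sub>2 \<Longrightarrow> \<sigma>\<^sub>2 y \<in> N\<^sub>2"
    "\<And>y. y \<in> E q \<inter> ball 0 \<delta>\<^sub>2 \<Longrightarrow> P (\<sigma>\<^sub>2 y - q) = y"
    "\<And>z. z \<in> N\<^sub>2 \<inter> T\<^sub>2 \<Longrightarrow> P (z - q) \<in> ball 0 \<delta>\<^sub>2 \<and> \<sigma>\<^sub>2 (P (z - q)) = z"
    using C1_submanifold_local_section[OF N'(2) N(4) tan(2) E P] by metis
  have near_q: "\<exists>\<eta>>0. \<forall>y\<in>ball 0 \<eta>. \<sigma> y \<in> ball q \<rho>"
    if "0 < \<delta>" "\<And>y. y \<in> ball 0 \<delta> \<Longrightarrow> (\<sigma> has_derivative blinfun_apply (\<sigma>' y)) (at y)" "\<sigma> 0 = q"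
    for \<delta> and \<sigma> :: "'a \<Rightarrow> 'a" and \<sigma>' :: "'a \<Rightarrow> 'a \<Rightarrow>\<^sub>L 'a"
  proof -
    have "continuous (at 0) \<sigma>"
      using that(1) by (intro has_derivative_continuous[OF that(2)]) simp
    then obtain \<eta> where "0 < \<eta>" "\<forall>y. dist y 0 < \<eta> \<longrightarrow> dist (\<sigma> y) (\<sigma> 0) < \<rho>"
      unfolding continuous_at_eps_delta using \<open>0 < \<rho>\<close> by blast
    then show ?thesis using that(3) by (intro exI[of _ \<eta>]) (auto simp: dist_commute)
  qed
  have \<sigma>0: "\<sigma>\<^sub>1 0 = q" "\<sigma>\<^sub>2 0 = q"
    using s1(8)[of q] s2(8)[of q] N s1(3) s2(3) linear_0[OF linP] by auto
  obtain \<eta>\<^sub>1 where \<eta>1: "0 < \<eta>\<^sub>1" "\<And>y. y \<in> ball 0 \<eta>\<^sub>1 \<Longrightarrow> \<sigma>\<^sub>1 y \<in> ball q \<rho>"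
    using near_q[OF s1(1,4) \<sigma>0(1)] by blast
  obtain \<eta>\<^sub>2 where \<eta>2: "0 < \<eta>\<^sub>2" "\<And>y. y \<in> ball 0 \<eta>\<^sub>2 \<Longrightarrow> \<sigma>\<^sub>2 y \<in> ball q \<rho>"
    using near_q[OF s2(1,4) \<sigma>0(2)] by blast
  \<comment> \<open>The entry \<open>\<epsilon> / 4\<close> secures the smallness of
    \<open>x\<close> required for uniqueness; the others keep both lifts defined and inside the
    ball.\<close>
  define \<eta> where "\<eta> = Min {\<delta>\<^sub>1, \<delta>\<^sub>2, \<eta>\<^sub>1, \<eta>\<^sub>2, \<epsilon> / 4}"
  have \<eta>: "0 < \<eta>" "\<eta> \<le> \<delta>\<^sub>1" "\<eta> \<le> \<delta>\<^sub>2" "\<eta> \<le> \<eta>\<^sub>1" "\<eta> \<le> \<eta>\<^sub>2" "4 * \<eta> \<le> \<epsilon>"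
    using s1(1) s2(1) \<eta>1(1) \<eta>2(1) \<open>0 < \<epsilon>\<close> by (auto simp: \<eta>_def min_def)
  have curve: "((\<lambda>t. \<sigma> (t *\<^sub>R x)) has_vector_derivative \<sigma>' (t *\<^sub>R x) x) (at t within {0..1}) \<and>
      \<sigma> (t *\<^sub>R x) \<in> ball q \<rho> \<and> A (\<sigma> (t *\<^sub>R x)) (\<sigma>' (t *\<^sub>R x) x) = x"
    "continuous_on {0..1} (\<lambda>t. \<sigma>' (t *\<^sub>R x) x)"
    if der: "\<And>y. y \<in> ball 0 \<delta> \<Longrightarrow> (\<sigma> has_derivative blinfun_apply (\<sigma>' y)) (at y)"
      and cont: "continuous_on (ball 0 \<delta>) \<sigma>'"
      and sN: "\<And>y. y \<in> E q \<inter> ball 0 \<delta> \<Longrightarrow> \<sigma> y \<in> N"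
      and sP: "\<And>y. y \<in> E q \<inter> ball 0 \<delta> \<Longrightarrow> P (\<sigma> y - q) = y"
      and EN: "\<And>z. z \<in> N \<Longrightarrow> tangent_space N z = E z"
      and x: "x \<in> E q" "norm x < \<eta>" and le: "\<eta> \<le> \<delta>" "\<eta> \<le> \<eta>'"
      and ball: "\<And>y. y \<in> ball 0 \<eta>' \<Longrightarrow> \<sigma> y \<in> ball q \<rho>"
      and t: "t \<in> {0..1}"
    for \<delta> N x t \<eta>' and \<sigma> :: "'a \<Rightarrow> 'a" and \<sigma>' :: "'a \<Rightarrow> 'a \<Rightarrow>\<^sub>L 'a"
  proof -
    have tx: "norm (t *\<^sub>R x) < \<eta>" "t *\<^sub>R x \<in> E q" if "t \<in> {0..1}" for t
    proof -
      have "\<bar>t\<bar> * norm x \<le> 1 * norm x" using that by (intro mult_right_mono) auto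
      then show "norm (t *\<^sub>R x) < \<eta>" using x(2) by simp
      show "t *\<^sub>R x \<in> E q" by (rule subspace_scale[OF E(1) x(1)])
    qed
    have tx': "t *\<^sub>R x \<in> ball 0 \<delta>" if "t \<in> {0..1}" for t using tx[OF that] le by simp
    have line: "((\<lambda>t. t *\<^sub>R x) has_derivative (\<lambda>s. s *\<^sub>R x)) (at t within X)" for X
      by (auto intro!: derivative_eq_intros)
    have vd: "((\<lambda>t. \<sigma> (t *\<^sub>R x)) has_vector_derivative \<sigma>' (t *\<^sub>R x) x) (at t within {0..1})"
      using has_derivative_compose[OF line der[OF tx'[OF t]]]
      by (simp add: has_vector_derivative_def blinfun.scaleR_right)
    have b: "\<sigma> (t *\<^sub>R x) \<in> ball q \<rho>" using ball[of "t *\<^sub>R x"] tx(1)[OF t] le by simp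
    have "\<sigma>' (t *\<^sub>R x) x \<in> tangent_space N (\<sigma> (t *\<^sub>R x))"
      by (rule tangent_space_C1_image[OF open_ball der cont E(1) tx(2)[OF t] tx'[OF t] x(1)]) (use sN in auto)
    moreover have "\<sigma> (t *\<^sub>R x) \<in> N" using sN tx(2)[OF t] tx'[OF t] by blast
    \<comment> \<open>Tangency puts the vector into \<open>E q\<close>, where \<open>P\<close> is
      the identity; hence it equals \<open>P (\<sigma>' (t *\<^sub>R x) x)\<close>, which is
      \<open>x\<close> because \<open>\<sigma>\<close> is a section of \<open>P\<close>.\<close>
    ultimately have Aq: "A (\<sigma> (t *\<^sub>R x)) (\<sigma>' (t *\<^sub>R x) x) \<in> E q"
      using EN EA[OF b] by simp
    have "((\<lambda>s. P (\<sigma> (s *\<^sub>R x) - q)) has_vector_derivative P (\<sigma>' (t *\<^sub>R x) x - 0)) (at t within {0..1})"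
      by (intro bounded_linear.has_vector_derivative[OF P(1)] has_vector_derivative_diff vd has_vector_derivative_const)
    then have "((\<lambda>s. s *\<^sub>R x) has_vector_derivative P (\<sigma>' (t *\<^sub>R x) x)) (at t within {0..1})"
      using t tx tx' sP by (auto elim!: has_vector_derivative_transform[rotated 2])
    moreover have "((\<lambda>s. s *\<^sub>R x) has_vector_derivative x) (at t within {0..1})"
      using line by (simp add: has_vector_derivative_def)
    ultimately have "P (\<sigma>' (t *\<^sub>R x) x) = x"
      using t by (intro vector_derivative_unique_within[of t "{0..1}" "\<lambda>s. s *\<^sub>R x"])
        (auto simp: trivial_limit_within islimpt_Icc)
    then have "A (\<sigma> (t *\<^sub>R x)) (\<sigma>' (t *\<^sub>R x) x) = x"
      using P(3)[OF Aq] PA[OF b] by simp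
    with vd b show "((\<lambda>t. \<sigma> (t *\<^sub>R x)) has_vector_derivative \<sigma>' (t *\<^sub>R x) x) (at t within {0..1}) \<and>
      \<sigma> (t *\<^sub>R x) \<in> ball q \<rho> \<and> A (\<sigma> (t *\<^sub>R x)) (\<sigma>' (t *\<^sub>R x) x) = x" by blast
    have "continuous_on {0..1} (\<lambda>t. \<sigma>' (t *\<^sub>R x))"
      by (rule continuous_on_compose2[OF cont]) (auto intro!: continuous_intros simp del: norm_scaleR simp: tx'[simplified])
    then show "continuous_on {0..1} (\<lambda>t. \<sigma>' (t *\<^sub>R x) x)" by (intro continuous_intros)
  qed
  show thesis
  proof
    have contP: "continuous_on UNIV (\<lambda>z. P (z - q))"
      by (rule continuous_on_compose2[OF linear_continuous_on[OF P(1)]]) (auto intro!: continuous_intros)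
    show "open (T\<^sub>1 \<inter> {z. norm (P (z - q)) < \<eta>})"
      by (intro open_Int s1(2) open_Collect_less continuous_on_norm contP continuous_on_const)
    show "q \<in> T\<^sub>1 \<inter> {z. norm (P (z - q)) < \<eta>}" using s1(3) \<eta> linear_0[OF linP] by simp
    show "N\<^sub>1 \<inter> (T\<^sub>1 \<inter> {z. norm (P (z - q)) < \<eta>}) \<subseteq> N\<^sub>2"
    proof
      fix z assume z: "z \<in> N\<^sub>1 \<inter> (T\<^sub>1 \<inter> {z. norm (P (z - q)) < \<eta>})"
      define x where "x = P (z - q)"
      have x: "x \<in> E q" "norm x < \<eta>" using z P(2) by (auto simp: x_def)
      have zx: "\<sigma>\<^sub>1 x = z" using s1(8)[of z] z by (simp add: x_def)
      note c1 = curve[OF s1(4,5,6,7) N'(3) x \<eta>(2,4) \<eta>1(2)]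
      note c2 = curve[OF s2(4,5,6,7) N'(4) x \<eta>(3,5) \<eta>2(2)]
      have "\<sigma>\<^sub>1 (1 *\<^sub>R x) = \<sigma>\<^sub>2 (1 *\<^sub>R x)"
      proof (rule integral_curves_unique[OF near approx \<open>0 < \<epsilon>\<close>, where x = x and t = 1
          and \<gamma>\<^sub>1 = "\<lambda>t. \<sigma>\<^sub>1 (t *\<^sub>R x)" and \<gamma>\<^sub>2 = "\<lambda>t. \<sigma>\<^sub>2 (t *\<^sub>R x)"
          and D\<^sub>1 = "\<lambda>t. \<sigma>\<^sub>1' (t *\<^sub>R x) x" and D\<^sub>2 = "\<lambda>t. \<sigma>\<^sub>2' (t *\<^sub>R x) x"])
        show "continuous_on {0..1} (\<lambda>t. \<sigma>\<^sub>1' (t *\<^sub>R x) x)" by (rule c1(2)[of 0]) auto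
        show "continuous_on {0..1} (\<lambda>t. \<sigma>\<^sub>2' (t *\<^sub>R x) x)" by (rule c2(2)[of 0]) auto
        show "4 * norm x \<le> \<epsilon>" using x(2) \<eta>(6) by simp
        show "\<sigma>\<^sub>1 (0 *\<^sub>R x) = \<sigma>\<^sub>2 (0 *\<^sub>R x)" by (simp add: \<sigma>0)
      qed (use c1(1) c2(1) in auto)
      then have "z = \<sigma>\<^sub>2 x" using zx by simp
      then show "z \<in> N\<^sub>2" using s2(6)[of x] x \<eta>(3) by simp
    qed
  qed
qed

section \<open>Coframes and their duals\<close>

lemma continuous_subbundle_fibre:
  fixes E :: "'a::euclidean_space \<Rightarrow> 'a set"
  assumes "continuous_subbundle U m E" "p \<in> U"
  shows "subspace (E p)" "dim (E p) = m"
proof -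
  obtain V and X :: "nat \<Rightarrow> 'a \<Rightarrow> 'a" where "p \<in> V" and
    X: "\<And>q. q \<in> U \<inter> V \<Longrightarrow> inj_on (\<lambda>i. X i q) {..<m} \<and> independent ((\<lambda>i. X i q) ` {..<m}) \<and>
        E q = span ((\<lambda>i. X i q) ` {..<m})"
    using assms unfolding continuous_subbundle_def by metis
  with assms(2) have X: "inj_on (\<lambda>i. X i p) {..<m}" "independent ((\<lambda>i. X i p) ` {..<m})"
    "E p = span ((\<lambda>i. X i p) ` {..<m})" by auto
  show "subspace (E p)" by (simp add: X(3))
  show "dim (E p) = m" unfolding X(3) dim_span_eq_card_independent[OF X(2)] card_image[OF X(1)] by simp
qed

text \<open>Moves covectors into the Euclidean space, where orthogonal complements and adjoints can
  be used.\<close>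

definition riesz :: "('a::euclidean_space \<Rightarrow>\<^sub>L real) \<Rightarrow> 'a" where
  "riesz a = (\<Sum>b\<in>Basis. blinfun_apply a b *\<^sub>R b)"

lemma riesz_inner: "riesz a \<bullet> v = blinfun_apply a v"
proof -
  have "blinfun_apply a v = blinfun_apply a (\<Sum>b\<in>Basis. (v \<bullet> b) *\<^sub>R b)"
    by (simp add: euclidean_representation)
  also have "\<dots> = riesz a \<bullet> v"
    by (simp add: riesz_def blinfun.sum_right blinfun.scaleR_right inner_sum_left inner_commute[of v] mult.commute)
  finally show ?thesis by simp
qed

lemma inj_riesz: "inj riesz"
  by (rule injI, rule blinfun_eqI) (metis riesz_inner)

lemma linear_riesz: "linear riesz"
  by (rule linearI) (simp_all add: riesz_def blinfun.add_left blinfun.scaleR_left scaleR_left_distrib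
      sum.distrib scaleR_sum_right)

text \<open>The common kernel is the orthogonal complement of the Riesz vectors. A dual vector
  represents the linear functional that is 1 on one Riesz vector and 0 on the others.\<close>

lemma independent_covectors_dual:
  fixes a :: "nat \<Rightarrow> 'a::euclidean_space \<Rightarrow>\<^sub>L real"
  assumes "inj_on a {..<n}" "independent (a ` {..<n})"
  shows "dim {v. \<forall>i<n. blinfun_apply (a i) v = 0} + n = DIM('a)"
    and "\<exists>k. \<forall>i<n. \<forall>j<n. blinfun_apply (a i) (k j) = (if i = j then 1 else 0)"
proof -
  define g where "g = (\<lambda>i. riesz (a i))"
  have inj: "inj_on g {..<n}"
    using assms(1) inj_riesz by (auto simp: g_def inj_on_def inj_def)
  have "independent (riesz ` a ` {..<n})"
    using linear_independent_injective_image[OF linear_riesz assms(2)] inj_riesz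
    by (blast intro: inj_on_subset)
  then have ind: "independent (g ` {..<n})" by (simp add: g_def image_image)
  have "dim {y \<in> UNIV. \<forall>x\<in>span (g ` {..<n}). orthogonal x y} + dim (span (g ` {..<n})) = dim (UNIV :: 'a set)"
    by (rule dim_subspace_orthogonal_to_vectors) auto
  moreover have "dim (span (g ` {..<n})) = n"
    unfolding dim_span_eq_card_independent[OF ind] card_image[OF inj] by simp
  moreover have "{y \<in> UNIV. \<forall>x\<in>span (g ` {..<n}). orthogonal x y} = {v. \<forall>i<n. blinfun_apply (a i) v = 0}"
  proof -
    have "(\<forall>x\<in>span (g ` {..<n}). orthogonal x y) \<longleftrightarrow> (\<forall>i<n. g i \<bullet> y = 0)" for y
    proof
      assume "\<forall>i<n. g i \<bullet> y = 0"
      then have "orthogonal y x" if "x \<in> span (g ` {..<n})" for x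
        by (intro orthogonal_to_span[OF that]) (auto simp: orthogonal_def inner_commute)
      then show "\<forall>x\<in>span (g ` {..<n}). orthogonal x y" by (simp add: orthogonal_commute)
    qed (auto simp: orthogonal_def intro: span_base)
    then show ?thesis by (simp add: g_def riesz_inner)
  qed
  ultimately show "dim {v. \<forall>i<n. blinfun_apply (a i) v = 0} + n = DIM('a)" by simp
  have "\<exists>k. \<forall>i<n. g i \<bullet> k = (if i = j then 1 else 0)" if "j < n" for j
  proof -
    obtain f :: "'a \<Rightarrow> real" where f: "linear f" "\<And>x. x \<in> g ` {..<n} \<Longrightarrow> f x = (if x = g j then 1 else 0)"
      using linear_independent_extend[OF ind, of "\<lambda>x. if x = g j then 1 else 0"] by blast
    \<comment> \<open>\<open>adjoint f 1\<close> is the vector that represents the functional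
      \<open>f\<close>.\<close>
    have "f x = x \<bullet> adjoint f 1" for x using adjoint_works[OF f(1), of x 1] by (simp add: inner_commute)
    then have "g i \<bullet> adjoint f 1 = (if i = j then 1 else 0)" if "i < n" for i
      using f(2)[of "g i"] that \<open>j < n\<close> inj by (auto simp: inj_on_def)
    then show ?thesis by blast
  qed
  then obtain k where k: "\<And>j i. j < n \<Longrightarrow> i < n \<Longrightarrow> g i \<bullet> k j = (if i = j then 1 else 0)"
    by metis
  show "\<exists>k. \<forall>i<n. \<forall>j<n. blinfun_apply (a i) (k j) = (if i = j then 1 else 0)"
    using k by (intro exI[of _ k]) (simp add: g_def riesz_inner)
qed

text \<open>\<open>E p\<close> lies in the common kernel by definition of the annihilator, and both
  have dimension \<open>m\<close>.\<close>

lemma annihilator_basis_kernel: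
  fixes E :: "'a::euclidean_space \<Rightarrow> 'a set"
  assumes "DIM('a) = n + m" "continuous_subbundle U m E" "annihilator_basis U n E \<eta>" "p \<in> U"
  shows "E p = {v. \<forall>i<n. \<eta> i p v = 0}"
proof (rule subspace_dim_equal)
  show "subspace (E p)" by (rule continuous_subbundle_fibre[OF assms(2,4)])
  show "subspace {v. \<forall>i<n. \<eta> i p v = 0}"
    by (simp add: subspace_def blinfun.add_right blinfun.scaleR_right)
  show "E p \<subseteq> {v. \<forall>i<n. \<eta> i p v = 0}"
    using assms(3,4) unfolding annihilator_basis_def annihilator_forms_def by auto
  have "dim {v. \<forall>i<n. \<eta> i p v = 0} + n = DIM('a)"
    using assms(3,4) by (intro independent_covectors_dual(1)) (auto simp: annihilator_basis_def)
  then show "dim {v. \<forall>i<n. \<eta> i p v = 0} \<le> dim (E p)"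
    using assms(1) continuous_subbundle_fibre(2)[OF assms(2,4)] by simp
qed

section \<open>The endomorphism attached to a coframe, its derivative and its curvature\<close>

text \<open>In the applications \<open>a\<close> consists of the values of the forms at a base
  point, and \<open>k\<close> is dual to them.\<close>

locale dual_coframe =
  fixes n :: nat and a :: "nat \<Rightarrow> 'a::euclidean_space \<Rightarrow>\<^sub>L real" and k :: "nat \<Rightarrow> 'a"
  assumes dual: "\<And>i j. i < n \<Longrightarrow> j < n \<Longrightarrow> a i (k j) = (if i = j then 1 else 0)"
begin

definition kernel :: "'a set" where
  "kernel = {v. \<forall>i<n. a i v = 0}"

definition kernel_proj :: "'a \<Rightarrow> 'a" where
  "kernel_proj v = v - (\<Sum>i<n. a i v *\<^sub>R k i)"

text \<open>The endomorphism that acts as the projection on the kernel and has the components \<open>b i\<close> along \<open>k i\<close>;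
  it is the identity for \<open>b = a\<close>.\<close>

definition frame_map :: "(nat \<Rightarrow> 'a \<Rightarrow>\<^sub>L real) \<Rightarrow> 'a \<Rightarrow>\<^sub>L 'a" where
  "frame_map b = id_blinfun + (\<Sum>i<n. blinfun_scaleR_left (k i) o\<^sub>L (b i - a i))"

text \<open>The derivative of \<open>frame_map\<close> when the covectors \<open>b i\<close> vary
  with derivatives \<open>D i\<close>, written as a composition of bounded operators so that it
  depends continuously on \<open>D\<close>.\<close>

definition frame_deriv :: "(nat \<Rightarrow> 'a \<Rightarrow>\<^sub>L 'a \<Rightarrow>\<^sub>L real) \<Rightarrow> 'a \<Rightarrow>\<^sub>L 'a \<Rightarrow>\<^sub>L 'a" where
  "frame_deriv D = (\<Sum>i<n. Blinfun (\<lambda>X. blinfun_scaleR_left (k i) o\<^sub>L X) o\<^sub>L D i)"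

lemma sum_dual: "j < n \<Longrightarrow> (\<Sum>i<n. c i * a j (k i)) = c j"
proof -
  assume j: "j < n"
  have "(\<Sum>i<n. c i * a j (k i)) = (\<Sum>i<n. if i = j then c i else 0)"
    by (intro sum.cong) (auto simp: dual j)
  then show ?thesis using j by simp
qed

lemma frame_map_apply:
  "frame_map b v = v + (\<Sum>i<n. (blinfun_apply (b i) v - a i v) *\<^sub>R k i)"
  by (simp add: frame_map_def blinfun.add_left blinfun.sum_left blinfun.diff_left)

lemma frame_map_self: "frame_map a = id_blinfun"
  by (rule blinfun_eqI) (simp add: frame_map_apply)

text \<open>Duality lets the correction along \<open>k j\<close> replace \<open>a j v\<close> by
  \<open>b j v\<close>. Thus \<open>frame_map b\<close> pulls \<open>kernel\<close> back to the
  common kernel of the \<open>b i\<close>.\<close>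

lemma coframe_frame_map:
  assumes "j < n"
  shows "a j (frame_map b v) = blinfun_apply (b j) v"
proof -
  have "a j (frame_map b v) = a j v +
      (\<Sum>i<n. (blinfun_apply (b i) v - a i v) * a j (k i))"
    by (simp add: frame_map_apply blinfun.add_right blinfun.sum_right blinfun.scaleR_right)
  then show ?thesis using sum_dual[OF assms, of "\<lambda>i. blinfun_apply (b i) v - a i v"] by simp
qed

lemma frame_map_kernel: "frame_map b v \<in> kernel \<longleftrightarrow> (\<forall>i<n. blinfun_apply (b i) v = 0)"
  by (simp add: kernel_def coframe_frame_map)

lemma subspace_kernel: "subspace kernel"
  by (simp add: kernel_def subspace_def blinfun.add_right blinfun.scaleR_right)

lemma bounded_linear_kernel_proj: "bounded_linear kernel_proj"
  unfolding kernel_proj_def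
  by (intro bounded_linear_sub bounded_linear_ident bounded_linear_sum
      bounded_linear_compose[OF bounded_linear_scaleR_left] blinfun.bounded_linear_right)

lemma kernel_proj_in: "kernel_proj v \<in> kernel"
  unfolding kernel_def kernel_proj_def
  by (simp add: blinfun.diff_right blinfun.sum_right blinfun.scaleR_right sum_dual)

lemma kernel_proj_id: "v \<in> kernel \<Longrightarrow> kernel_proj v = v"
  by (simp add: kernel_def kernel_proj_def)

text \<open>\<open>frame_map b\<close> changes a vector only along the \<open>k i\<close>, which the
  projection discards.\<close>

lemma kernel_proj_frame_map: "kernel_proj (frame_map b v) = kernel_proj v"
proof -
  have "(\<Sum>i<n. a i (frame_map b v) *\<^sub>R k i) = (\<Sum>i<n. blinfun_apply (b i) v *\<^sub>R k i)"
    by (intro sum.cong) (auto simp: coframe_frame_map)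
  then show ?thesis
    by (simp add: kernel_proj_def frame_map_apply scaleR_left_diff_distrib sum_subtractf)
qed

lemma frame_map_diff:
  "norm (frame_map b - frame_map b') \<le> (\<Sum>i<n. norm (k i) * norm (b i - b' i))"
proof (rule norm_blinfun_bound)
  fix v
  have "(frame_map b - frame_map b') v = (\<Sum>i<n. blinfun_apply (b i - b' i) v *\<^sub>R k i)"
    by (simp add: blinfun.diff_left frame_map_apply sum_subtractf[symmetric] scaleR_left_diff_distrib[symmetric])
  also have "norm \<dots> \<le> (\<Sum>i<n. norm (k i) * norm (b i - b' i) * norm v)"
  proof (rule sum_norm_le)
    fix i
    have "norm (k i) * norm (blinfun_apply (b i - b' i) v) \<le> norm (k i) * (norm (b i - b' i) * norm v)"
      by (intro mult_left_mono norm_blinfun) simp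
    then show "norm (blinfun_apply (b i - b' i) v *\<^sub>R k i) \<le> norm (k i) * norm (b i - b' i) * norm v"
      by (simp add: mult_ac)
  qed
  finally show "norm ((frame_map b - frame_map b') v) \<le> (\<Sum>i<n. norm (k i) * norm (b i - b' i)) * norm v"
    by (simp add: sum_distrib_right)
qed (simp add: sum_nonneg)

lemma frame_deriv_apply: "frame_deriv D u v = (\<Sum>i<n. blinfun_apply (D i u) v *\<^sub>R k i)"
proof -
  have "bounded_linear (\<lambda>X. blinfun_scaleR_left (k i) o\<^sub>L X)" for i
    by (rule bounded_bilinear.bounded_linear_right[OF bounded_bilinear_blinfun_compose])
  note bl = bounded_linear_Blinfun_apply[OF this]
  show ?thesis
    by (simp add: frame_deriv_def blinfun.sum_left bl)
qed

lemma frame_map_has_derivative: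
  assumes "\<And>i. i < n \<Longrightarrow> (\<eta> i has_derivative blinfun_apply (D i)) (at z)"
  shows "((\<lambda>z. frame_map (\<lambda>i. \<eta> i z)) has_derivative blinfun_apply (frame_deriv D)) (at z)"
proof -
  have bl: "bounded_linear (\<lambda>X. blinfun_scaleR_left (k i) o\<^sub>L X)" for i
    by (rule bounded_bilinear.bounded_linear_right[OF bounded_bilinear_blinfun_compose])
  have "((\<lambda>z. id_blinfun + (\<Sum>i<n. blinfun_scaleR_left (k i) o\<^sub>L (\<eta> i z - a i))) has_derivative
      (\<lambda>u. 0 + (\<Sum>i<n. blinfun_scaleR_left (k i) o\<^sub>L (D i u - 0)))) (at z)"
    by (intro has_derivative_add has_derivative_const has_derivative_sum bounded_linear.has_derivative[OF bl]
        has_derivative_diff assms) simp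
  moreover have "blinfun_apply (frame_deriv D) = (\<lambda>u. 0 + (\<Sum>i<n. blinfun_scaleR_left (k i) o\<^sub>L (D i u - 0)))"
    by (rule ext, rule blinfun_eqI) (simp add: frame_deriv_apply blinfun.sum_left)
  ultimately show ?thesis by (simp add: frame_map_def)
qed

lemma continuous_on_frame_map:
  "(\<And>i. i < n \<Longrightarrow> continuous_on S (\<eta> i)) \<Longrightarrow> continuous_on S (\<lambda>z. frame_map (\<lambda>i. \<eta> i z))"
  unfolding frame_map_def by (intro continuous_intros) auto

lemma continuous_on_frame_deriv:
  "(\<And>i. i < n \<Longrightarrow> continuous_on S (D i)) \<Longrightarrow> continuous_on S (\<lambda>z. frame_deriv (\<lambda>i. D i z))"
  unfolding frame_deriv_def by (intro continuous_intros) auto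

text \<open>Antisymmetrising the derivative of the frame map gives the exterior derivatives as
  components along \<open>k i\<close>, because the derivative provided by \<open>C1_on\<close> is
  the Frechet derivative used in \<open>ext_deriv\<close>.\<close>

lemma frame_map_C1:
  assumes "\<And>i. i < n \<Longrightarrow> C1_on U (\<eta> i)"
  obtains DA where "\<And>z. z \<in> U \<Longrightarrow>
      ((\<lambda>z. frame_map (\<lambda>i. \<eta> i z)) has_derivative blinfun_apply (DA z)) (at z)"
    "continuous_on U DA"
    "\<And>z u v. z \<in> U \<Longrightarrow> DA z u v - DA z v u =
        (\<Sum>i<n. ext_deriv (\<eta> i) z (\<lambda>j. if j = 0 then u else v) *\<^sub>R k i)"
proof -
  have "\<forall>i. \<exists>D. i < n \<longrightarrow> (\<forall>z\<in>U. (\<eta> i has_derivative blinfun_apply (D z)) (at z)) \<and> continuous_on U D"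
    using assms unfolding C1_on_def by blast
  then obtain D where D: "\<And>i z. i < n \<Longrightarrow> z \<in> U \<Longrightarrow> (\<eta> i has_derivative blinfun_apply (D i z)) (at z)"
    "\<And>i. i < n \<Longrightarrow> continuous_on U (D i)" by metis
  show thesis
  proof
    show "((\<lambda>z. frame_map (\<lambda>i. \<eta> i z)) has_derivative blinfun_apply (frame_deriv (\<lambda>i. D i z))) (at z)"
      if "z \<in> U" for z by (rule frame_map_has_derivative) (rule D(1)[OF _ that])
    show "continuous_on U (\<lambda>z. frame_deriv (\<lambda>i. D i z))"
      by (rule continuous_on_frame_deriv[OF D(2)])
    show "frame_deriv (\<lambda>i. D i z) u v - frame_deriv (\<lambda>i. D i z) v u =
        (\<Sum>i<n. ext_deriv (\<eta> i) z (\<lambda>j. if j = 0 then u else v) *\<^sub>R k i)" if "z \<in> U" for z u v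
    proof -
      have "frechet_derivative (\<eta> i) (at z) = blinfun_apply (D i z)" if "i < n" for i
        using frechet_derivative_at[OF D(1)[OF that \<open>z \<in> U\<close>]] by simp
      then show ?thesis
        by (simp add: frame_deriv_apply sum_subtractf[symmetric] scaleR_left_diff_distrib[symmetric] ext_deriv_def)
    qed
  qed
qed

lemma curvature_le:
  assumes "\<And>i. i < n \<Longrightarrow> \<bar>c i\<bar> \<le> C"
  shows "norm (\<Sum>i<n. c i *\<^sub>R k i) \<le> (\<Sum>i<n. norm (k i)) * C"
  unfolding sum_distrib_right
  by (intro sum_norm_le) (use assms in \<open>auto simp: mult.commute[of "norm _"] intro: mult_right_mono\<close>)

text \<open>The wedge is evaluated on a basis dual to the forms at \<open>z\<close>, followed by
  \<open>u\<close> and \<open>v\<close>; \<open>wedge_2_dual_kernel\<close> identifies the value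
  with that of the exterior derivative.\<close>

lemma ext_deriv_kernel_bound:
  assumes diff: "\<And>i. i < n \<Longrightarrow> \<eta> i differentiable (at z)"
    and near: "norm (frame_map (\<lambda>i. \<eta> i z) - id_blinfun) \<le> 1/2"
    and ker: "frame_map (\<lambda>i. \<eta> i z) u \<in> kernel" "frame_map (\<lambda>i. \<eta> i z) v \<in> kernel"
    and "j < n"
    and S: "form_norm (n + 2) (wedge n 2 (wedge_covectors (\<lambda>i. \<eta> i z) n) (ext_deriv (\<eta> j) z)) \<le> S"
  shows "\<bar>ext_deriv (\<eta> j) z (\<lambda>j. if j = 0 then u else v)\<bar>
    \<le> real DIM('a) ^ (n + 2) * sqrt (fact (n + 2)) * (\<Prod>i<n. 2 * norm (k i)) * S * norm u * norm v"
proof -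
  let ?A = "frame_map (\<lambda>i. \<eta> i z)"
  \<comment> \<open>The preimages of the \<open>k i\<close> under \<open>?A\<close> are dual to the
    \<open>\<eta> i z\<close> and at most twice as long as the \<open>k i\<close>.\<close>
  define t where "t = (\<lambda>i. if i < n then blinfun_inv ?A (k i) else if i = n then u else v)"
  let ?\<omega> = "wedge n 2 (wedge_covectors (\<lambda>i. \<eta> i z) n) (ext_deriv (\<eta> j) z)"
  have ml: "multilinear_form 2 (ext_deriv (\<eta> j) z)"
    by (rule multilinear_ext_deriv[OF diff[OF \<open>j < n\<close>]])
  have "?\<omega> t = ext_deriv (\<eta> j) z (\<lambda>i. t (n + i))"
  proof (rule wedge_2_dual_kernel)
    show "\<eta> i z (t l) = (if i = l then 1 else 0)" if "i < n" "l < n" for i l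
      using coframe_frame_map[OF that(1), of "\<lambda>i. \<eta> i z" "t l"] dual[OF that] that
      by (simp add: t_def near_id_inv[OF near])
    show "\<eta> i z (t n) = 0" "\<eta> i z (t (Suc n)) = 0" if "i < n" for i
      using ker that by (simp_all add: t_def frame_map_kernel)
    show "multilinear_form 2 (ext_deriv (\<eta> j) z)" by fact
    show "ext_deriv (\<eta> j) z (\<lambda>i. v (Transposition.transpose 0 1 i)) = - ext_deriv (\<eta> j) z v" for v
      by (simp add: ext_deriv_def)
  qed
  moreover have "ext_deriv (\<eta> j) z (\<lambda>i. t (n + i)) = ext_deriv (\<eta> j) z (\<lambda>j. if j = 0 then u else v)"
    by (simp add: ext_deriv_def t_def)
  moreover have "\<bar>?\<omega> t\<bar> \<le> real DIM('a) ^ (n + 2) * sqrt (fact (n + 2)) * form_norm (n + 2) ?\<omega> * (\<Prod>i<n + 2. norm (t i))"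
    by (rule multilinear_form_bound[OF multilinear_wedge[OF multilinear_wedge_covectors ml]])
  moreover have "(\<Prod>i<n + 2. norm (t i)) \<le> (\<Prod>i<n. 2 * norm (k i)) * (norm u * norm v)"
  proof -
    have "(\<Prod>i<n + 2. norm (t i)) = (\<Prod>i<n. norm (t i)) * (norm u * norm v)"
      by (simp add: t_def numeral_2_eq_2)
    also have "\<dots> \<le> (\<Prod>i<n. 2 * norm (k i)) * (norm u * norm v)"
      by (intro mult_right_mono prod_mono) (auto simp: t_def near_id_inv_bound[OF near])
    finally show ?thesis .
  qed
  ultimately have prod: "(\<Prod>i<n + 2. norm (t i)) \<le> (\<Prod>i<n. 2 * norm (k i)) * (norm u * norm v)"
    and "\<bar>ext_deriv (\<eta> j) z (\<lambda>j. if j = 0 then u else v)\<bar> \<le>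
      real DIM('a) ^ (n + 2) * sqrt (fact (n + 2)) * form_norm (n + 2) ?\<omega> * (\<Prod>i<n + 2. norm (t i))"
    by simp_all
  note this(2)
  also have "real DIM('a) ^ (n + 2) * sqrt (fact (n + 2)) * form_norm (n + 2) ?\<omega> * (\<Prod>i<n + 2. norm (t i))
      \<le> real DIM('a) ^ (n + 2) * sqrt (fact (n + 2)) * S * ((\<Prod>i<n. 2 * norm (k i)) * (norm u * norm v))"
  proof -
    have "0 \<le> form_norm (n + 2) ?\<omega>" unfolding form_norm_def by (simp add: sum_nonneg)
    then have "0 \<le> S" using S by linarith
    then show ?thesis
      by (intro mult_mono[OF mult_left_mono[OF S] prod] mult_nonneg_nonneg) (simp_all add: prod_nonneg)
  qed
  finally show ?thesis by (simp add: mult_ac)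
qed

end

lemma ext_deriv_bound:
  fixes \<eta> :: "'a::euclidean_space one_form"
  assumes "\<eta> differentiable (at z)" "form_norm 2 (ext_deriv \<eta> z) \<le> M"
  shows "\<bar>ext_deriv \<eta> z (\<lambda>j. if j = 0 then u else v)\<bar> \<le> real DIM('a) ^ 2 * sqrt 2 * M * norm u * norm v"
proof -
  have "\<bar>ext_deriv \<eta> z (\<lambda>j. if j = 0 then u else v)\<bar> \<le>
      real DIM('a) ^ 2 * sqrt (fact 2) * form_norm 2 (ext_deriv \<eta> z) * (\<Prod>i<2. norm (if i = (0::nat) then u else v))"
    by (rule multilinear_form_bound[OF multilinear_ext_deriv[OF assms(1)]])
  also have "\<dots> \<le> real DIM('a) ^ 2 * sqrt (fact 2) * M * (\<Prod>i<2. norm (if i = (0::nat) then u else v))"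
    using assms(2) by (intro mult_right_mono mult_left_mono) (auto simp: prod_nonneg)
  also have "\<dots> = real DIM('a) ^ 2 * sqrt 2 * M * norm u * norm v"
    by (simp add: numeral_2_eq_2)
  finally show ?thesis .
qed

lemma norm_covector_le:
  fixes a :: "'a::euclidean_space \<Rightarrow>\<^sub>L real"
  shows "norm a \<le> real DIM('a) * form_norm 1 (covector_form a)"
proof (rule norm_blinfun_bound)
  show "0 \<le> real DIM('a) * form_norm 1 (covector_form a)"
    by (simp add: form_norm_def sum_nonneg)
  fix v
  show "norm (blinfun_apply a v) \<le> real DIM('a) * form_norm 1 (covector_form a) * norm v"
    using multilinear_form_bound[OF multilinear_covector_form, of a "\<lambda>_. v"] by (simp add: covector_form_def)
qed

section \<open>Approximations from the sequences of forms\<close>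

text \<open>The added 1 makes the quotient usable when \<open>c = 0\<close>.\<close>

lemma mult_divide_Suc_le:
  fixes c x :: real
  assumes "0 \<le> c" "0 \<le> x"
  shows "c * (x / (c + 1)) \<le> x"
  using assms by (simp add: pos_divide_le_eq algebra_simps)

text \<open>By the convention \<open>0 * \<infinity> = 0\<close> a small product says nothing about
  \<open>m\<close> if \<open>s = 0\<close>; otherwise both factors must be finite.\<close>

lemma ennreal_exp_product_less:
  assumes less: "s * ennreal_exp (ennreal \<epsilon> * m) < ennreal e" and "0 < \<epsilon>"
  shows "s = 0 \<or> (\<exists>S M. 0 \<le> S \<and> 0 \<le> M \<and> s = ennreal S \<and> m = ennreal M \<and> S * exp (\<epsilon> * M) < e)"
proof (cases "s = 0")
  case False
  have "m \<noteq> top"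
  proof
    assume "m = top"
    then have "s * ennreal_exp (ennreal \<epsilon> * m) = top"
      using \<open>0 < \<epsilon>\<close> False by (simp add: ennreal_exp_def ennreal_mult_top ennreal_mult_eq_top_iff)
    with less show False by simp
  qed
  then obtain M where M: "0 \<le> M" "m = ennreal M" by (cases m) auto
  have ex: "ennreal_exp (ennreal \<epsilon> * m) = ennreal (exp (\<epsilon> * M))"
    using M \<open>0 < \<epsilon>\<close> by (simp add: ennreal_exp_def flip: ennreal_mult)
  have "s \<noteq> top"
    using less unfolding ex by (auto simp: ennreal_top_mult)
  then obtain S where S: "0 \<le> S" "s = ennreal S" by (cases s) auto
  have "ennreal (S * exp (\<epsilon> * M)) < ennreal e"
    using less S unfolding ex by (simp add: ennreal_mult)
  then have "S * exp (\<epsilon> * M) < e" using S by (simp add: ennreal_less_iff)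
  with M S show ?thesis by blast
qed simp

lemma form_sup_norm_bound:
  assumes "(SUP i\<in>{..<n}. form_sup_norm U k (\<omega> i)) \<le> ennreal S" "0 \<le> S" "i < n" "x \<in> U"
  shows "form_norm k (\<omega> i x) \<le> S"
proof -
  have "ennreal (form_norm k (\<omega> i x)) \<le> form_sup_norm U k (\<omega> i)"
    unfolding form_sup_norm_def by (rule SUP_upper) (rule assms)
  also have "\<dots> \<le> (SUP i\<in>{..<n}. form_sup_norm U k (\<omega> i))"
    by (rule SUP_upper) (simp add: assms)
  also note assms(1)
  finally show ?thesis using assms(2) by (simp add: ennreal_le_iff)
qed

context dual_coframe
begin

abbreviation size :: real where "size \<equiv> \<Sum>i<n. norm (k i)"

text \<open>The factor by which a bound on the norms of the exterior derivatives turns into one on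
  the antisymmetrised derivative of the frame map.\<close>

abbreviation curv_const :: real where "curv_const \<equiv> size * (real DIM('a) ^ 2 * sqrt 2)"

lemma size_nonneg: "0 \<le> size" by (simp add: sum_nonneg)

lemma frame_map_diff_le:
  assumes "\<And>i. i < n \<Longrightarrow> form_norm 1 (covector_form (b i - b' i)) \<le> S"
  shows "norm (frame_map b - frame_map b') \<le> size * real DIM('a) * S"
proof -
  have "norm (frame_map b - frame_map b') \<le> (\<Sum>i<n. norm (k i) * norm (b i - b' i))"
    by (rule frame_map_diff)
  also have "\<dots> \<le> (\<Sum>i<n. norm (k i) * (real DIM('a) * S))"
  proof (intro sum_mono mult_left_mono)
    fix i assume "i \<in> {..<n}"
    then show "norm (b i - b' i) \<le> real DIM('a) * S"
      by (intro order_trans[OF norm_covector_le] mult_left_mono assms) auto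
  qed simp
  also have "\<dots> = size * real DIM('a) * S" by (simp add: sum_distrib_right mult.assoc)
  finally show ?thesis .
qed

text \<open>If the supremum of the \<open>d\<eta>\<^sub>i\<close> is infinite, then the other factor vanishes, so that a local bound
  on the compact set \<open>K\<close> suffices.\<close>

lemma curvature_majorant:
  assumes "\<forall>i<n. C1_on U (\<eta> i)" and K: "compact K" "K \<subseteq> U" and "0 < \<epsilon>" "0 < e"
    and less: "s * ennreal_exp (ennreal \<epsilon> * (SUP i\<in>{..<n}. form_sup_norm U 2 (ext_deriv (\<eta> i)))) < ennreal e"
  shows "\<exists>DA M S.
    (\<forall>z\<in>K. ((\<lambda>z. frame_map (\<lambda>i. \<eta> i z)) has_derivative blinfun_apply (DA z)) (at z)) \<and>
    continuous_on K DA \<and>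
    (\<forall>z\<in>K. \<forall>u v. DA z u v - DA z v u =
        (\<Sum>i<n. ext_deriv (\<eta> i) z (\<lambda>j. if j = 0 then u else v) *\<^sub>R k i)) \<and>
    0 \<le> M \<and> (\<forall>z\<in>K. \<forall>u v. norm (DA z u v - DA z v u) \<le> M * norm u * norm v) \<and>
    0 \<le> S \<and> s = ennreal S \<and> S * exp (\<epsilon> / (curv_const + 1) * M) \<le> e"
proof -
  have C1: "C1_on U (\<eta> i)" if "i < n" for i using assms(1) that by blast
  obtain DA where DA: "\<And>z. z \<in> U \<Longrightarrow>
      ((\<lambda>z. frame_map (\<lambda>i. \<eta> i z)) has_derivative blinfun_apply (DA z)) (at z)"
    "continuous_on U DA"
    "\<And>z u v. z \<in> U \<Longrightarrow> DA z u v - DA z v u =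
        (\<Sum>i<n. ext_deriv (\<eta> i) z (\<lambda>j. if j = 0 then u else v) *\<^sub>R k i)"
    using frame_map_C1[of U \<eta>, OF C1] by blast
  have contK: "continuous_on K DA" by (rule continuous_on_subset[OF DA(2) K(2)])
  have diff: "\<eta> i differentiable (at z)" if "i < n" "z \<in> U" for i z
    using C1[OF that(1)] that(2) unfolding C1_on_def differentiable_def by blast
  have cc: "0 \<le> curv_const" using size_nonneg by simp
  consider "s = 0" | S0 M0 where "0 \<le> S0" "0 \<le> M0" "s = ennreal S0"
    "(SUP i\<in>{..<n}. form_sup_norm U 2 (ext_deriv (\<eta> i))) = ennreal M0" "S0 * exp (\<epsilon> * M0) < e"
    using ennreal_exp_product_less[OF less \<open>0 < \<epsilon>\<close>] by blast
  then show ?thesis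
  proof cases
    case 1
    \<comment> \<open>With \<open>S = 0\<close> the product vanishes for every \<open>M\<close>, so
      the bound of \<open>DA\<close> on the compact set may serve.\<close>
    have "bounded (DA ` K)"
      by (intro compact_imp_bounded compact_continuous_image contK K)
    then obtain \<Lambda> where \<Lambda>: "0 < \<Lambda>" "\<And>z. z \<in> K \<Longrightarrow> norm (DA z) \<le> \<Lambda>"
      unfolding bounded_pos by auto
    have bound: "norm (DA z u v - DA z v u) \<le> (2 * \<Lambda>) * norm u * norm v" if "z \<in> K" for z u v
    proof -
      have *: "norm (DA z u v) \<le> \<Lambda> * norm u * norm v" for u v
        by (intro norm_blinfun_apply_le \<Lambda> that) auto
      show ?thesis
        using *[of u v] *[of v u] norm_triangle_ineq4[of "DA z u v" "DA z v u"] by (simp add: mult_ac)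
    qed
    then show ?thesis using DA K contK \<Lambda>(1) \<open>0 < e\<close> 1
      by (intro exI[of _ DA] exI[of _ "2 * \<Lambda>"] exI[of _ 0]) auto
  next
    case 2
    have bound: "norm (DA z u v - DA z v u) \<le> (curv_const * M0) * norm u * norm v" if "z \<in> K" for z u v
    proof -
      have zU: "z \<in> U" using that K by blast
      have "norm (\<Sum>i<n. ext_deriv (\<eta> i) z (\<lambda>j. if j = 0 then u else v) *\<^sub>R k i)
          \<le> size * (real DIM('a) ^ 2 * sqrt 2 * M0 * norm u * norm v)"
        by (intro curvature_le ext_deriv_bound diff zU form_sup_norm_bound[OF eq_refl[OF 2(4)] 2(2)])
      then show ?thesis unfolding DA(3)[OF zU] by (simp add: mult_ac)
    qed
    \<comment> \<open>Dividing \<open>\<epsilon>\<close> beforehand compensates the factor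
      \<open>curv_const\<close> in the exponent.\<close>
    have "\<epsilon> / (curv_const + 1) * (curv_const * M0) \<le> \<epsilon> * M0"
    proof -
      have "\<epsilon> / (curv_const + 1) * curv_const \<le> \<epsilon>"
        using cc \<open>0 < \<epsilon>\<close> by (simp add: divide_simps)
      from mult_right_mono[OF this 2(2)] show ?thesis by (simp only: mult.assoc)
    qed
    then have "S0 * exp (\<epsilon> / (curv_const + 1) * (curv_const * M0)) \<le> S0 * exp (\<epsilon> * M0)"
      using 2(1) by (intro mult_left_mono) auto
    then have e: "S0 * exp (\<epsilon> / (curv_const + 1) * (curv_const * M0)) \<le> e" using 2(5) by linarith
    moreover have "0 \<le> curv_const * M0" using cc 2(2) by simp
    ultimately show ?thesis using DA K contK 2(1,3) bound
      by (intro exI[of _ DA] exI[of _ "curv_const * M0"] exI[of _ S0]) blast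
  qed
qed

text \<open>Translates exterior regularity into the approximation hypothesis of the uniqueness
  argument: one late member of the sequence serves for each \<open>e\<close>.\<close>

lemma exterior_regular_frame_approx:
  fixes \<beta> :: "nat \<Rightarrow> 'a one_form" and \<beta>k :: "nat \<Rightarrow> nat \<Rightarrow> 'a one_form"
  assumes C1: "\<And>j i. i < n \<Longrightarrow> C1_on U (\<beta>k j i)" and K: "compact K" "K \<subseteq> U" and "0 < \<epsilon>" "0 < e"
    and lim: "(\<lambda>j. (SUP i\<in>{..<n}. form_sup_norm U 1 (\<lambda>x. covector_form (\<beta>k j i x - \<beta> i x))) *
          ennreal_exp (ennreal \<epsilon> * (SUP i\<in>{..<n}. form_sup_norm U 2 (ext_deriv (\<beta>k j i))))) \<longlonglongrightarrow> 0"
  shows "\<exists>A' DA' M S.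
        (\<forall>z\<in>K. (A' has_derivative blinfun_apply (DA' z)) (at z)) \<and>
        continuous_on K (DA' :: 'a \<Rightarrow> 'a \<Rightarrow>\<^sub>L 'a \<Rightarrow>\<^sub>L 'a) \<and> 0 \<le> M \<and> 0 \<le> S \<and>
        (\<forall>z\<in>K. norm (A' z - frame_map (\<lambda>i. \<beta> i z)) \<le> S) \<and>
        (\<forall>z\<in>K. \<forall>u v. norm (DA' z u v - DA' z v u) \<le> M * norm u * norm v) \<and>
        S * exp (\<epsilon> / (curv_const + 1) * M) \<le> e"
proof -
  let ?c = "size * real DIM('a)"
  have c: "0 \<le> ?c" using size_nonneg by simp
  \<comment> \<open>Compensates the factor \<open>?c\<close> between the norms of the covectors and
    that of the endomorphism.\<close>
  define e' where "e' = e / (?c + 1)"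
  have "0 < e'" using \<open>0 < e\<close> c by (simp add: e'_def)
  then have "\<forall>\<^sub>F j in sequentially. (SUP i\<in>{..<n}. form_sup_norm U 1 (\<lambda>x. covector_form (\<beta>k j i x - \<beta> i x))) *
          ennreal_exp (ennreal \<epsilon> * (SUP i\<in>{..<n}. form_sup_norm U 2 (ext_deriv (\<beta>k j i)))) < ennreal e'"
    by (intro order_tendstoD(2)[OF lim]) simp
  then obtain j where j: "(SUP i\<in>{..<n}. form_sup_norm U 1 (\<lambda>x. covector_form (\<beta>k j i x - \<beta> i x))) *
          ennreal_exp (ennreal \<epsilon> * (SUP i\<in>{..<n}. form_sup_norm U 2 (ext_deriv (\<beta>k j i)))) < ennreal e'"
    by (auto simp: eventually_sequentially)
  let ?A = "\<lambda>z. frame_map (\<lambda>i. \<beta>k j i z)"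
  have C1j: "\<forall>i<n. C1_on U (\<beta>k j i)" using C1 by blast
  obtain DA M S where DA:
    "\<forall>z\<in>K. (?A has_derivative blinfun_apply (DA z)) (at z)" "continuous_on K DA"
    "0 \<le> M" "\<forall>z\<in>K. \<forall>u v. norm (DA z u v - DA z v u) \<le> M * norm u * norm v"
    "0 \<le> S" "(SUP i\<in>{..<n}. form_sup_norm U 1 (\<lambda>x. covector_form (\<beta>k j i x - \<beta> i x))) = ennreal S"
    "S * exp (\<epsilon> / (curv_const + 1) * M) \<le> e'"
    using curvature_majorant[OF C1j K \<open>0 < \<epsilon>\<close> \<open>0 < e'\<close> j] by (elim exE conjE) (rule that)
  have "norm (frame_map (\<lambda>i. \<beta>k j i z) - frame_map (\<lambda>i. \<beta> i z)) \<le> ?c * S" if "z \<in> K" for z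
  proof (rule frame_map_diff_le)
    fix i assume i: "i < n"
    show "form_norm 1 (covector_form (\<beta>k j i z - \<beta> i z)) \<le> S"
      by (rule form_sup_norm_bound[OF eq_refl[OF DA(6)] DA(5) i]) (use that K in blast)
  qed
  moreover have "?c * S * exp (\<epsilon> / (curv_const + 1) * M) \<le> e"
  proof -
    have "?c * (S * exp (\<epsilon> / (curv_const + 1) * M)) \<le> ?c * e'"
      by (rule mult_left_mono[OF DA(7) c])
    also have "\<dots> \<le> e"
      unfolding e'_def by (rule mult_divide_Suc_le[OF c]) (use \<open>0 < e\<close> in simp)
    finally show ?thesis by (simp only: mult.assoc)
  qed
  moreover have "0 \<le> ?c * S" using c DA(5) by simp
  ultimately show ?thesis using DA(1-4)
    by (intro exI[of _ "\<lambda>z. frame_map (\<lambda>i. \<beta>k j i z)"] exI[of _ DA] exI[of _ M] exI[of _ "?c * S"]) blast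
qed

text \<open>The counterpart for existence. The wedge condition supplies the bound \<open>S\<close>
  on vectors that \<open>A'\<close> maps into \<open>kernel\<close>, while \<open>M\<close> bounds
  the curvature on all vectors.\<close>

lemma involutive_frame_approx:
  fixes \<eta> :: "nat \<Rightarrow> 'a one_form" and \<eta>k :: "nat \<Rightarrow> nat \<Rightarrow> 'a one_form"
  assumes C1: "\<And>j i. i < n \<Longrightarrow> C1_on U (\<eta>k j i)" and K: "compact K" "K \<subseteq> U" and "0 < \<epsilon>" "0 < e"
    and near: "\<And>z. z \<in> K \<Longrightarrow> norm (frame_map (\<lambda>i. \<eta> i z) - id_blinfun) \<le> 1/4"
    and lim1: "(\<lambda>j. SUP i\<in>{..<n}. form_sup_norm U 1 (\<lambda>x. covector_form (\<eta>k j i x - \<eta> i x))) \<longlonglongrightarrow> 0"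
    and lim2: "(\<lambda>j. (SUP l\<in>{..<n}. form_sup_norm U (n + 2)
                 (\<lambda>x. wedge n 2 (wedge_covectors (\<lambda>i. \<eta>k j i x) n) (ext_deriv (\<eta>k j l) x))) *
          ennreal_exp (ennreal \<epsilon> * (SUP i\<in>{..<n}. form_sup_norm U 2 (ext_deriv (\<eta>k j i))))) \<longlonglongrightarrow> 0"
  shows "\<exists>A' DA' M S.
        (\<forall>z\<in>K. (A' has_derivative blinfun_apply (DA' z)) (at z)) \<and>
        continuous_on K (DA' :: 'a \<Rightarrow> 'a \<Rightarrow>\<^sub>L 'a \<Rightarrow>\<^sub>L 'a) \<and> 0 \<le> M \<and> 0 \<le> S \<and>
        (\<forall>z\<in>K. norm (A' z - frame_map (\<lambda>i. \<eta> i z)) \<le> e) \<and>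
        (\<forall>z\<in>K. \<forall>v. kernel_proj (A' z v) = kernel_proj v) \<and>
        (\<forall>z\<in>K. \<forall>u v. norm (DA' z u v - DA' z v u) \<le> M * norm u * norm v) \<and>
        (\<forall>z\<in>K. \<forall>u v. A' z u \<in> kernel \<longrightarrow> A' z v \<in> kernel \<longrightarrow>
            norm (DA' z u v - DA' z v u) \<le> S * norm u * norm v) \<and>
        S * exp (\<epsilon> / (curv_const + 1) * M) \<le> e"
proof -
  let ?c = "size * real DIM('a)"
  let ?d = "real DIM('a) ^ (n + 2) * sqrt (fact (n + 2)) * (\<Prod>i<n. 2 * norm (k i))"
  let ?W = "\<lambda>j l x. wedge n 2 (wedge_covectors (\<lambda>i. \<eta>k j i x) n) (ext_deriv (\<eta>k j l) x)"
  have c: "0 \<le> ?c" using size_nonneg by simp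
  have d: "0 \<le> size * ?d" using size_nonneg by (simp add: prod_nonneg)
  \<comment> \<open>The cap 1/4 keeps the approximating frame map within 1/2 of the identity, as
    \<open>ext_deriv_kernel_bound\<close> requires.\<close>
  define e1 where "e1 = min e (1/4) / (?c + 1)"
  define e2 where "e2 = e / (size * ?d + 1)"
  have "0 < e1" using \<open>0 < e\<close> c by (simp add: e1_def)
  have "0 < e2" using \<open>0 < e\<close> d by (simp add: e2_def)
  have "\<forall>\<^sub>F j in sequentially. (SUP i\<in>{..<n}. form_sup_norm U 1 (\<lambda>x. covector_form (\<eta>k j i x - \<eta> i x))) < ennreal e1"
    using \<open>0 < e1\<close> by (intro order_tendstoD(2)[OF lim1]) simp
  moreover have "\<forall>\<^sub>F j in sequentially. (SUP l\<in>{..<n}. form_sup_norm U (n + 2) (?W j l)) *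
      ennreal_exp (ennreal \<epsilon> * (SUP i\<in>{..<n}. form_sup_norm U 2 (ext_deriv (\<eta>k j i)))) < ennreal e2"
    using \<open>0 < e2\<close> by (intro order_tendstoD(2)[OF lim2]) simp
  ultimately have "\<forall>\<^sub>F j in sequentially.
      (SUP i\<in>{..<n}. form_sup_norm U 1 (\<lambda>x. covector_form (\<eta>k j i x - \<eta> i x))) < ennreal e1 \<and>
      (SUP l\<in>{..<n}. form_sup_norm U (n + 2) (?W j l)) *
      ennreal_exp (ennreal \<epsilon> * (SUP i\<in>{..<n}. form_sup_norm U 2 (ext_deriv (\<eta>k j i)))) < ennreal e2"
    by (rule eventually_conj)
  then obtain j where j1: "(SUP i\<in>{..<n}. form_sup_norm U 1 (\<lambda>x. covector_form (\<eta>k j i x - \<eta> i x))) < ennreal e1"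
    and j2: "(SUP l\<in>{..<n}. form_sup_norm U (n + 2) (?W j l)) *
      ennreal_exp (ennreal \<epsilon> * (SUP i\<in>{..<n}. form_sup_norm U 2 (ext_deriv (\<eta>k j i)))) < ennreal e2"
    by (auto simp: eventually_sequentially)
  let ?A = "\<lambda>z. frame_map (\<lambda>i. \<eta>k j i z)"
  have C1j: "\<forall>i<n. C1_on U (\<eta>k j i)" using C1 by blast
  obtain DA M S where DA:
    "\<forall>z\<in>K. (?A has_derivative blinfun_apply (DA z)) (at z)" "continuous_on K DA"
    "\<forall>z\<in>K. \<forall>u v. DA z u v - DA z v u =
        (\<Sum>i<n. ext_deriv (\<eta>k j i) z (\<lambda>j. if j = 0 then u else v) *\<^sub>R k i)"
    "0 \<le> M" "\<forall>z\<in>K. \<forall>u v. norm (DA z u v - DA z v u) \<le> M * norm u * norm v"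
    "0 \<le> S" "(SUP l\<in>{..<n}. form_sup_norm U (n + 2) (?W j l)) = ennreal S"
    "S * exp (\<epsilon> / (curv_const + 1) * M) \<le> e2"
    using curvature_majorant[OF C1j K \<open>0 < \<epsilon>\<close> \<open>0 < e2\<close> j2] by (elim exE conjE) (rule that)
  have close: "norm (?A z - frame_map (\<lambda>i. \<eta> i z)) \<le> min e (1/4)" if "z \<in> K" for z
  proof -
    have "norm (?A z - frame_map (\<lambda>i. \<eta> i z)) \<le> ?c * e1"
    proof (rule frame_map_diff_le)
      fix i assume i: "i < n"
      show "form_norm 1 (covector_form (\<eta>k j i z - \<eta> i z)) \<le> e1"
        by (rule form_sup_norm_bound[OF less_imp_le[OF j1] less_imp_le[OF \<open>0 < e1\<close>] i]) (use that K in blast)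
    qed
    also have "\<dots> \<le> min e (1/4)"
      unfolding e1_def by (rule mult_divide_Suc_le[OF c]) (use \<open>0 < e\<close> in simp)
    finally show ?thesis .
  qed
  have near': "norm (?A z - id_blinfun) \<le> 1/2" if "z \<in> K" for z
    using near[OF that] close[OF that]
      norm_triangle_ineq[of "?A z - frame_map (\<lambda>i. \<eta> i z)" "frame_map (\<lambda>i. \<eta> i z) - id_blinfun"] by simp
  have diff: "\<eta>k j i differentiable (at z)" if "i < n" "z \<in> U" for i z
    using C1[OF that(1)] that(2) unfolding C1_on_def differentiable_def by blast
  have curv: "norm (DA z u v - DA z v u) \<le> (size * ?d * S) * norm u * norm v"
    if z: "z \<in> K" and ker: "?A z u \<in> kernel" "?A z v \<in> kernel" for z u v
  proof -
    have zU: "z \<in> U" using z K by blast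
    have "norm (\<Sum>i<n. ext_deriv (\<eta>k j i) z (\<lambda>j. if j = 0 then u else v) *\<^sub>R k i)
        \<le> size * (?d * S * norm u * norm v)"
    proof (rule curvature_le)
      fix l assume l: "l < n"
      show "\<bar>ext_deriv (\<eta>k j l) z (\<lambda>j. if j = 0 then u else v)\<bar> \<le> ?d * S * norm u * norm v"
      proof (rule ext_deriv_kernel_bound[of "\<eta>k j" z, OF _ near'[OF z] ker l])
        show "form_norm (n + 2) (?W j l z) \<le> S"
          by (rule form_sup_norm_bound[OF eq_refl[OF DA(7)] DA(6) l zU])
      qed (rule diff[OF _ zU])
    qed
    then show ?thesis unfolding DA(3)[rule_format, OF z] by (simp only: mult.assoc)
  qed
  have final: "size * ?d * S * exp (\<epsilon> / (curv_const + 1) * M) \<le> e"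
  proof -
    have "size * ?d * (S * exp (\<epsilon> / (curv_const + 1) * M)) \<le> size * ?d * e2"
      by (rule mult_left_mono[OF DA(8) d])
    also have "\<dots> \<le> e"
      unfolding e2_def by (rule mult_divide_Suc_le[OF d]) (use \<open>0 < e\<close> in simp)
    finally show ?thesis by (simp only: mult.assoc)
  qed
  have "0 \<le> size * ?d * S" using d DA(6) by (rule mult_nonneg_nonneg)
  moreover have "kernel_proj (?A z v) = kernel_proj v" for z v by (rule kernel_proj_frame_map)
  moreover have "norm (?A z - frame_map (\<lambda>i. \<eta> i z)) \<le> e" if "z \<in> K" for z using close[OF that] by simp
  ultimately show ?thesis using DA(1,2,4,5) curv final
    by (intro exI[of _ ?A] exI[of _ DA] exI[of _ M] exI[of _ "size * ?d * S"] conjI ballI allI impI) auto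
qed

end

section \<open>Frames at a point, and the two implications\<close>

text \<open>With the dual basis taken at \<open>p\<close> the frame map is the identity there, so
  continuity keeps it close to the identity on a small ball.\<close>

lemma annihilator_basis_frame:
  fixes \<eta> :: "nat \<Rightarrow> 'a::euclidean_space one_form"
  assumes dim: "DIM('a) = n + m" and "open U" and E: "continuous_subbundle U m E"
    and \<eta>: "annihilator_basis U n E \<eta>" and p: "p \<in> U"
  obtains k \<rho> where "dual_coframe n (\<lambda>i. \<eta> i p) k" "0 < \<rho>" "cball p \<rho> \<subseteq> U"
    "\<And>z. z \<in> cball p \<rho> \<Longrightarrow>
        norm (dual_coframe.frame_map n (\<lambda>i. \<eta> i p) k (\<lambda>i. \<eta> i z) - id_blinfun) \<le> 1/4"
    "continuous_on U (\<lambda>z. dual_coframe.frame_map n (\<lambda>i. \<eta> i p) k (\<lambda>i. \<eta> i z))"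
    "\<And>z. z \<in> U \<Longrightarrow> E z = {v. dual_coframe.frame_map n (\<lambda>i. \<eta> i p) k (\<lambda>i. \<eta> i z) v \<in> E p}"
    "E p = dual_coframe.kernel n (\<lambda>i. \<eta> i p)"
proof -
  obtain k where "\<forall>i<n. \<forall>j<n. blinfun_apply (\<eta> i p) (k j) = (if i = j then 1 else 0)"
    using independent_covectors_dual(2)[of "\<lambda>i. \<eta> i p" n] \<eta> p unfolding annihilator_basis_def by blast
  then interpret dual_coframe n "\<lambda>i. \<eta> i p" k by unfold_locales blast
  let ?A = "\<lambda>z. frame_map (\<lambda>i. \<eta> i z)"
  have cont: "continuous_on U ?A"
    using \<eta> by (intro continuous_on_frame_map) (auto simp: annihilator_basis_def annihilator_forms_def)
  have Ep: "E p = kernel"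
    unfolding kernel_def by (rule annihilator_basis_kernel[OF dim E \<eta> p])
  have Ez: "E z = {v. ?A z v \<in> E p}" if "z \<in> U" for z
    unfolding Ep frame_map_kernel by (rule annihilator_basis_kernel[OF dim E \<eta> that])
  obtain r where r: "0 < r" "cball p r \<subseteq> U"
    using \<open>open U\<close> p open_contains_cball by blast
  obtain d where d: "0 < d" "\<And>z. z \<in> U \<Longrightarrow> dist z p < d \<Longrightarrow> dist (?A z) (?A p) < 1/4"
    using cont p unfolding continuous_on_iff by (meson zero_less_divide_1_iff zero_less_numeral)
  define \<rho> where "\<rho> = min r (d / 2)"
  have \<rho>: "0 < \<rho>" "cball p \<rho> \<subseteq> U" using r d(1) by (auto simp: \<rho>_def)
  have "norm (?A z - id_blinfun) \<le> 1/4" if "z \<in> cball p \<rho>" for z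
  proof -
    have "dist z p < d" using that d(1) by (auto simp: \<rho>_def dist_commute)
    then show ?thesis using d(2)[of z] that \<rho>(2) by (force simp: frame_map_self dist_norm)
  qed
  from that[OF dual_coframe_axioms \<rho> this cont Ez Ep] show thesis .
qed

text \<open>At each point the frame of the given basis turns the sequence of forms into the
  approximations needed for an integral section, whose image is the manifold sought.\<close>

lemma strongly_asymptotically_involutive_imp_integrable:
  fixes U :: "'a::euclidean_space set"
  assumes dim: "DIM('a) = n + m" and "open U" and E: "continuous_subbundle U m E"
    and inv: "strongly_asymptotically_involutive U n E"
  shows "integrable_bundle U m E"
  unfolding integrable_bundle_def
proof
  fix p assume p: "p \<in> U"
  obtain \<eta> :: "nat \<Rightarrow> 'a one_form" and \<epsilon> \<eta>k where \<eta>: "annihilator_basis U n E \<eta>" and "0 < \<epsilon>"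
    and C1: "\<And>j i. i < n \<Longrightarrow> C1_on U (\<eta>k j i)"
    and lim: "(\<lambda>j. SUP i\<in>{..<n}. form_sup_norm U 1 (\<lambda>x. covector_form (\<eta>k j i x - \<eta> i x))) \<longlonglongrightarrow> 0"
      "(\<lambda>j. (SUP l\<in>{..<n}. form_sup_norm U (n + 2)
                 (\<lambda>x. wedge n 2 (wedge_covectors (\<lambda>i. \<eta>k j i x) n) (ext_deriv (\<eta>k j l) x))) *
          ennreal_exp (ennreal \<epsilon> * (SUP i\<in>{..<n}. form_sup_norm U 2 (ext_deriv (\<eta>k j i))))) \<longlonglongrightarrow> 0"
    using inv unfolding strongly_asymptotically_involutive_def by blast
  obtain k \<rho> where co: "dual_coframe n (\<lambda>i. \<eta> i p) k" and \<rho>: "0 < \<rho>" "cball p \<rho> \<subseteq> U"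
    and frame: "\<And>z. z \<in> cball p \<rho> \<Longrightarrow>
        norm (dual_coframe.frame_map n (\<lambda>i. \<eta> i p) k (\<lambda>i. \<eta> i z) - id_blinfun) \<le> 1/4"
      "continuous_on U (\<lambda>z. dual_coframe.frame_map n (\<lambda>i. \<eta> i p) k (\<lambda>i. \<eta> i z))"
      "\<And>z. z \<in> U \<Longrightarrow> E z = {v. dual_coframe.frame_map n (\<lambda>i. \<eta> i p) k (\<lambda>i. \<eta> i z) v \<in> E p}"
      "E p = dual_coframe.kernel n (\<lambda>i. \<eta> i p)"
    by (rule annihilator_basis_frame[OF dim \<open>open U\<close> E \<eta> p]) (rule that)
  interpret dual_coframe n "\<lambda>i. \<eta> i p" k by (rule co)
  let ?A = "\<lambda>z. frame_map (\<lambda>i. \<eta> i z)" and ?\<epsilon> = "\<epsilon> / (curv_const + 1)"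
  have "0 \<le> curv_const" using size_nonneg by simp
  then have \<epsilon>: "0 < ?\<epsilon>" using \<open>0 < \<epsilon>\<close> by simp
  \<comment> \<open>\<open>2 * \<delta> \<le> \<rho>\<close> keeps the Euler polygons in the ball;
    the second bound matches Gronwall's exponent \<open>4 * \<delta> * M\<close> with the
    exponential weight.\<close>
  have "\<exists>\<delta>>0. 2 * \<delta> \<le> \<rho> \<and> 4 * \<delta> \<le> x" if "0 < x" for x :: real
    using that \<rho>(1) by (intro exI[of _ "min (\<rho> / 2) (x / 4)"]) (auto simp: min_def)
  from this[OF \<epsilon>] obtain \<delta> where \<delta>: "0 < \<delta>" "2 * \<delta> \<le> \<rho>" "4 * \<delta> \<le> ?\<epsilon>"
    by blast
  have contK: "continuous_on (cball p \<rho>) ?A" by (rule continuous_on_subset[OF frame(2) \<rho>(2)])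
  have linP: "linear kernel_proj" by (rule bounded_linear.linear[OF bounded_linear_kernel_proj])
  have near: "norm (?A z - id_blinfun) \<le> 1/2" if "z \<in> cball p \<rho>" for z using frame(1)[OF that] by simp
  obtain G where G: "G 0 = p"
    "\<And>\<xi>. \<xi> \<in> kernel \<inter> cball 0 \<delta> \<Longrightarrow> G \<xi> \<in> cball p \<rho> \<and> kernel_proj (G \<xi> - p) = \<xi>"
    "\<And>\<xi>. \<xi> \<in> kernel \<inter> cball 0 \<delta> \<Longrightarrow>
        (G has_derivative blinfun_apply (blinfun_inv (?A (G \<xi>)))) (at \<xi> within kernel \<inter> cball 0 \<delta>)"
    by (rule integral_section_exists[OF frame(1) contK subspace_kernel linP kernel_proj_id
          involutive_frame_approx[OF C1 compact_cball \<rho>(2) \<open>0 < \<epsilon>\<close> _ frame(1) lim] \<delta>])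
      (assumption | rule that)+
  have "integral_manifold U (dim kernel) E (G ` (kernel \<inter> ball 0 \<delta>))"
  proof (rule integral_manifold_section_image[OF subspace_kernel bounded_linear_kernel_proj kernel_proj_in
        kernel_proj_id \<delta>(1) \<rho>(2) G(2)])
    show "(G has_derivative blinfun_apply (blinfun_inv (?A (G \<xi>)))) (at \<xi> within kernel \<inter> cball 0 \<delta>)"
      if "\<xi> \<in> kernel \<inter> cball 0 \<delta>" for \<xi> by (rule G(3)[OF that])
    show "continuous_on (cball p \<rho>) (\<lambda>z. blinfun_inv (?A z))"
      by (rule continuous_on_near_id_inv[OF contK near])
    fix z v assume z: "z \<in> cball p \<rho>"
    show "?A z (blinfun_inv (?A z) v) = v" "blinfun_inv (?A z) (?A z v) = v"
      by (rule near_id_inv[OF near[OF z]])+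
    show "E z = {v. ?A z v \<in> kernel}" using frame(3)[of z] frame(4) z \<rho>(2) by auto
  qed
  moreover have "dim kernel = m"
    using continuous_subbundle_fibre(2)[OF E p] frame(4) by simp
  moreover have "p \<in> G ` (kernel \<inter> ball 0 \<delta>)"
    using G(1) \<delta>(1) subspace_0[OF subspace_kernel] by (intro image_eqI[of _ _ 0]) auto
  ultimately show "\<exists>N. integral_manifold U m E N \<and> p \<in> N" by blast
qed

text \<open>Around each common point local agreement provides an open \<open>T\<close> with
  \<open>N\<^sub>1 \<inter> T\<close> inside \<open>N\<^sub>2\<close>, a relative neighbourhood
  within the intersection.\<close>

lemma strongly_exterior_regular_imp_agree:
  fixes U :: "'a::euclidean_space set"
  assumes dim: "DIM('a) = n + m" and "open U" and E: "continuous_subbundle U m E"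
    and reg: "strongly_exterior_regular U n E"
    and N: "integral_manifold U m E N\<^sub>1" "integral_manifold U m E N\<^sub>2"
  shows "openin (top_of_set N\<^sub>1) (N\<^sub>1 \<inter> N\<^sub>2)"
proof (subst openin_subopen, intro ballI)
  fix q assume q: "q \<in> N\<^sub>1 \<inter> N\<^sub>2"
  then have qU: "q \<in> U" using N by (auto simp: integral_manifold_def)
  obtain \<beta> :: "nat \<Rightarrow> 'a one_form" and \<epsilon> \<beta>k where \<beta>: "annihilator_basis U n E \<beta>" and "0 < \<epsilon>"
    and C1: "\<And>j i. i < n \<Longrightarrow> C1_on U (\<beta>k j i)"
    and lim: "(\<lambda>j. (SUP i\<in>{..<n}. form_sup_norm U 1 (\<lambda>x. covector_form (\<beta>k j i x - \<beta> i x))) *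
          ennreal_exp (ennreal \<epsilon> * (SUP i\<in>{..<n}. form_sup_norm U 2 (ext_deriv (\<beta>k j i))))) \<longlonglongrightarrow> 0"
    using reg unfolding strongly_exterior_regular_def by blast
  obtain k \<rho> where co: "dual_coframe n (\<lambda>i. \<beta> i q) k" and \<rho>: "0 < \<rho>" "cball q \<rho> \<subseteq> U"
    and frame: "\<And>z. z \<in> cball q \<rho> \<Longrightarrow>
        norm (dual_coframe.frame_map n (\<lambda>i. \<beta> i q) k (\<lambda>i. \<beta> i z) - id_blinfun) \<le> 1/4"
      "continuous_on U (\<lambda>z. dual_coframe.frame_map n (\<lambda>i. \<beta> i q) k (\<lambda>i. \<beta> i z))"
      "\<And>z. z \<in> U \<Longrightarrow> E z = {v. dual_coframe.frame_map n (\<lambda>i. \<beta> i q) k (\<lambda>i. \<beta> i z) v \<in> E q}"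
      "E q = dual_coframe.kernel n (\<lambda>i. \<beta> i q)"
    by (rule annihilator_basis_frame[OF dim \<open>open U\<close> E \<beta> qU]) (rule that)
  interpret dual_coframe n "\<lambda>i. \<beta> i q" k by (rule co)
  let ?A = "\<lambda>z. frame_map (\<lambda>i. \<beta> i z)" and ?\<epsilon> = "\<epsilon> / (curv_const + 1)"
  have "0 \<le> curv_const" using size_nonneg by simp
  then have \<epsilon>: "0 < ?\<epsilon>" using \<open>0 < \<epsilon>\<close> by simp
  have ball: "ball q \<rho> \<subseteq> cball q \<rho>" by (rule ball_subset_cball)
  obtain T where T: "open T" "q \<in> T" "N\<^sub>1 \<inter> T \<subseteq> N\<^sub>2"
  proof (rule integral_manifolds_agree_locally[where A = ?A and \<rho> = \<rho> and P = kernel_proj and q = q and E = E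
        and \<epsilon> = ?\<epsilon> and U = U and m = m and N\<^sub>1 = N\<^sub>1 and N\<^sub>2 = N\<^sub>2])
    show "norm (?A z - id_blinfun) \<le> 1/4" if "z \<in> ball q \<rho>" for z using frame(1) ball that by blast
    fix e :: real assume e: "0 < e"
    obtain A' DA' M S where A': "\<forall>z\<in>cball q \<rho>. (A' has_derivative blinfun_apply (DA' z)) (at z)"
      "continuous_on (cball q \<rho>) (DA' :: 'a \<Rightarrow> 'a \<Rightarrow>\<^sub>L 'a \<Rightarrow>\<^sub>L 'a)" "0 \<le> M" "0 \<le> S"
      "\<forall>z\<in>cball q \<rho>. norm (A' z - ?A z) \<le> S"
      "\<forall>z\<in>cball q \<rho>. \<forall>u v. norm (DA' z u v - DA' z v u) \<le> M * norm u * norm v"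
      "S * exp (?\<epsilon> * M) \<le> e"
      using exterior_regular_frame_approx[where \<beta>k = \<beta>k and \<beta> = \<beta>, OF _ compact_cball \<rho>(2) \<open>0 < \<epsilon>\<close> e lim] C1
      by blast
    show "\<exists>A' DA' M S.
        (\<forall>z\<in>ball q \<rho>. (A' has_derivative blinfun_apply (DA' z)) (at z)) \<and>
        continuous_on (ball q \<rho>) (DA' :: 'a \<Rightarrow> 'a \<Rightarrow>\<^sub>L 'a \<Rightarrow>\<^sub>L 'a) \<and> 0 \<le> M \<and> 0 \<le> S \<and>
        (\<forall>z\<in>ball q \<rho>. norm (A' z - ?A z) \<le> S) \<and>
        (\<forall>z\<in>ball q \<rho>. \<forall>u v. norm (DA' z u v - DA' z v u) \<le> M * norm u * norm v) \<and>
        S * exp (?\<epsilon> * M) \<le> e"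
      using A' continuous_on_subset[OF A'(2) ball] ball
      by (intro exI[of _ A'] exI[of _ DA'] exI[of _ M] exI[of _ S] conjI) blast+
  next
    show "?A z v \<in> E q" if "z \<in> ball q \<rho>" "v \<in> E z" for z v
      using frame(3)[of z] that ball \<rho>(2) by blast
    show "kernel_proj v \<in> E q" for v using kernel_proj_in frame(4) by simp
    show "kernel_proj v = v" if "v \<in> E q" for v using kernel_proj_id that frame(4) by simp
  qed (use \<epsilon> \<rho>(1) bounded_linear_kernel_proj kernel_proj_frame_map continuous_subbundle_fibre[OF E qU] N q
      in \<open>auto intro: that\<close>)
  then show "\<exists>T. openin (top_of_set N\<^sub>1) T \<and> q \<in> T \<and> T \<subseteq> N\<^sub>1 \<inter> N\<^sub>2"
    using q by (intro exI[of _ "N\<^sub>1 \<inter> T"]) (auto intro: openin_open_Int)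
qed

theorem theorem4:
  fixes U :: "'a::euclidean_space set" and E :: "'a \<Rightarrow> 'a set"
    and c :: 'a and r :: real and n m :: nat
  assumes "DIM('a) = n + m"
    and "0 < r" and "U = ball c r"
    and "continuous_subbundle U m E"
  shows "(strongly_asymptotically_involutive U n E \<longrightarrow> integrable_bundle U m E) \<and>
         (integrable_bundle U m E \<and> strongly_exterior_regular U n E \<longrightarrow>
            uniquely_integrable_bundle U m E)"
proof (intro conjI impI)
  have "open U" by (simp add: assms(3))
  then show "integrable_bundle U m E" if "strongly_asymptotically_involutive U n E"
    using strongly_asymptotically_involutive_imp_integrable assms(1,4) that by blast
  assume *: "integrable_bundle U m E \<and> strongly_exterior_regular U n E"
  \<comment> \<open>The statement is one-sided, so it is applied a second time with the two
    manifolds exchanged.\<close>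
  note agree = strongly_exterior_regular_imp_agree[OF assms(1) \<open>open U\<close> assms(4) conjunct2[OF *]]
  show "uniquely_integrable_bundle U m E"
    unfolding uniquely_integrable_bundle_def
  proof (intro conjI allI impI)
    show "integrable_bundle U m E" using * by simp
    fix N\<^sub>1 N\<^sub>2
    assume N: "integral_manifold U m E N\<^sub>1 \<and> integral_manifold U m E N\<^sub>2 \<and> N\<^sub>1 \<inter> N\<^sub>2 \<noteq> {}"
    show "openin (top_of_set N\<^sub>1) (N\<^sub>1 \<inter> N\<^sub>2)" using agree N by blast
    show "openin (top_of_set N\<^sub>2) (N\<^sub>1 \<inter> N\<^sub>2)" using agree[of N\<^sub>2 N\<^sub>1] N by (simp add: Int_commute)
  qed
qed

end
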